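(* Fix $\lambda\in(0,\infty)$. Suppose the stationary local random countable set $M$ admits an honest indexation $\tau$, and let $M'$ be another stationary local random countable set. Let $\tilde{\mathsf{W}}:=\mathsf{W}\times\mathrm{Exp}(\lambda)$, where $\mathrm{Exp}(\lambda)$ is the exponential law of mean $\lambda^{-1}$ on $(0,\infty)$, let $\mathsf{e}$ be the second coordinate, and use the same symbols for the random elements defined on $\Omega_0$ and for their copies on $\Omega_0\times(0,\infty)$. Write $\tau_t:=\tau_{0,t}$ and $\hat\tau_t:=\hat\tau_{0,t}$ for $t\in(0,\infty)$, where $\hat\tau$ is the dual indexation. Assume that $(t,\omega)\mapsto\tau_t(\omega)$ and $(t,\omega)\mapsto\hat\tau_t(\omega)$ satisfy $\tau_t(\omega),\hat\tau_t(\omega)\in[0,t]$ for all $(t,\omega)$, and are $(\mathcal{B}_{(0,\infty)}\otimes\mathcal{G})/\mathcal{B}_{[0,\infty)}$-measurable. Put $$\mathcal{F}_{-\infty,\tau_{\mathsf{e}}}:=\sigma\big(Z_{\tau_{\mathsf{e}}}: Z\text{ a bounded real left-continuous }\mathcal{F}^{\rightarrow}\text{-adapted process}\big).$$ Then: (i) $\mathcal{F}_{-\infty,\tau_{\mathsf{e}}}$, in particular the pair $(\tau_{\mathsf{e}},B^{\tau_{\mathsf{e}}})$, is independent of $(\mathsf{e}-\tau_{\mathsf{e}},\Delta_{\tau_{\mathsf{e}}}|_{[0,\infty)})$ under $\tilde{\mathsf{W}}$. (ii) The event $\{\tau_{\mathsf{e}}\in M'\}$ is $\tilde{\mathsf{W}}$-trivial,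 i.e. has $\tilde{\mathsf{W}}$-probability $0$ or $1$. (iii) The law under $\tilde{\mathsf{W}}$ of $(\mathsf{e}-\tau_{\mathsf{e}},\Delta_{\tau_{\mathsf{e}}}|_{[0,\infty)})$ equals the law under $\tilde{\mathsf{W}}$ of $(\hat\tau_{\mathsf{e}},(\mathsf{r}\circ\Delta_{\hat\tau_{\mathsf{e}}})|_{[0,\infty)})$.
   Context: $\Omega_0:=\{\omega:\mathbb{R}\to\mathbb{R}\text{ continuous},\ \omega(0)=0\}$, with canonical process $B=(B_t)_{t\in\mathbb{R}}$. $\mathsf{W}$ is the completed two-sided Wiener measure: $(B_t)_{t\ge0}$ and $(B_{-t})_{t\ge 0}$ are independent standard Brownian motions under $\mathsf{W}$; its domain $\mathcal{G}$ is the $\mathsf{W}$-completion of the Borel $\sigma$-field of $\Omega_0$ (locally uniform topology). For extended-real $s<t$, $\mathcal{F}_{s,t}$ is the $\sigma$-field generated by the increments of $B$ between the times $s$ and $t$ and by all events of $\mathsf{W}$-probability $0$ or $1$; $\mathcal{F}^{\rightarrow}:=(\mathcal{F}_{-\infty,t})_{t\in[0,\infty)}$. For $u\in\mathbb{R}$ the Lévy shift is $\Delta_u(\omega)(t):=\omega(u+t)-\omega(u)$; $\Delta_u|_{[0,\infty)}$ is the path $\Delta_u(\omega)$ restricted to times in $[0,\infty)$, viewed in the space $\{\theta:[0,\infty)\to\mathbb{R}\text{ continuous},\theta(0)=0\}$ with its Borel $\sigma$-field. $B^{\tau}$ is $B$ stopped at $\tau$. $\mathsf{r}:\Omega_0\to\Omega_0$,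 $\mathsf{r}(\omega)(t):=\omega(-t)$, is the reflection of time. Null sets of $\tilde{\mathsf{W}}$ are immaterial (measurability of events such as $\{\tau_{\mathsf{e}}\in M'\}$ is understood relative to the completion). $\dagger\notin\mathbb{R}$ is a coffin state; $\mathbb{R}^\dagger:=\mathbb{R}\cup\{\dagger\}$ with the $\sigma$-field generated by the Borel sets of $\mathbb{R}$ and $\{\dagger\}$; $u\pm\dagger:=\dagger$, $-\dagger:=\dagger$. For a sequence $s=(s_i)_{i\in\mathbb{N}}$ in $\mathbb{R}^\dagger$, $[s]:=\{s_i:i\in\mathbb{N}\}\setminus\{\dagger\}$. For a sub-$\sigma$-field $\mathcal{A}$ of $\mathcal{G}$, an $\mathcal{A}$-measurable enumeration of a map $M:\Omega_0\to2^{\mathbb{R}}$ is a sequence $S$ of $\mathcal{A}$-measurable $\mathbb{R}^\dagger$-valued random variables with $M=[S]$ $\mathsf{W}$-a.s. $M$ is a random countable set if it has a $\mathcal{G}$-measurable enumeration; it is then local if for all extended-real $s<t$ the set $M\cap(s,t)$ has an $\mathcal{F}_{s,t}$-measurable enumeration, and stationary if for every $u\in\mathbb{R}$, $M=u+M(\Delta_u)$ $\mathsf{W}$-a.s. An honest indexation for a random set $M:\Omega_0\to2^{\mathbb{R}}$ is a family $\tau=(\tau_{s,t})_{(s,t)\in\mathbb{R}^2,s<t}$ of $\mathcal{F}_{-\infty,\infty}$-measurable $\mathbb{R}^\dagger$-valued maps such that: (inclusion) $\tau_{s,t}\in M$ a.s. for all real $s<t$; (exhaustion) $M=\{\tau_{s,t}:(s,t)\in\mathbb{Q}^2,s<t\}$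 a.s.; (locality) $\tau_{s,t}$ is a.s. valued in $(s,t)$ and is $\mathcal{F}_{s,t}$-measurable for all real $s<t$; (stationarity) $\tau_{s+h,t+h}=h+\tau_{s,t}(\Delta_h)$ a.s. for all real $h$ and $s<t$; (nestedness) $\tau_{s,t}=\tau_{u,v}$ a.s. on $\{\tau_{s,t}\in(u,v)\}$ for all real $s\le u<v\le t$. Its dual $\hat\tau$ is defined by $\hat\tau_{s,t}:=-\tau_{-t,-s}\circ\mathsf{r}$ for real $s<t$. *)

theory Defs
  imports "HOL-Probability.Probability"
begin

text \<open>Path spaces with the locally uniform topology\<close>

text \<open>For \<open>T = UNIV\<close> this is the space of the two-sided paths, for \<open>T = {0..}\<close> that of the
  one-sided ones; outside \<open>T\<close> a path has the conventional value \<open>undefined\<close>.\<close>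

definition paths :: "real set \<Rightarrow> (real \<Rightarrow> real) set" where
  "paths T = {w \<in> extensional T. continuous_on T w \<and> w 0 = 0}"

definition path_topology :: "real set \<Rightarrow> (real \<Rightarrow> real) topology" where
  "path_topology T = topology_generated_by
     {{w' \<in> paths T. \<forall>t\<in>K. \<bar>w' t - w t\<bar> < \<epsilon>} | w K \<epsilon>.
        w \<in> paths T \<and> compact K \<and> K \<subseteq> T \<and> (0::real) < \<epsilon>}"

definition path_borel :: "real set \<Rightarrow> (real \<Rightarrow> real) measure" where
  "path_borel T = sigma (paths T) {U. openin (path_topology T) U}"


text \<open>Two-sided Wiener measure\<close>

definition standard_brownian_motion :: "'a measure \<Rightarrow> (real \<Rightarrow> 'a \<Rightarrow> real) \<Rightarrow> bool" where
  "standard_brownian_motion P X \<longleftrightarrow>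
     (\<forall>t\<ge>0. X t \<in> borel_measurable P) \<and>
     (AE x in P. X 0 x = 0) \<and>
     (AE x in P. continuous_on {0..} (\<lambda>t. X t x)) \<and>
     (\<forall>(t :: nat \<Rightarrow> real) n. 0 \<le> t 0 \<and> (\<forall>i<n. t i < t (Suc i)) \<longrightarrow>
        prob_space.indep_vars P (\<lambda>_. borel) (\<lambda>i x. X (t (Suc i)) x - X (t i) x) {..<n}) \<and>
     (\<forall>s t. 0 \<le> s \<and> s < t \<longrightarrow>
        distributed P lborel (\<lambda>x. X t x - X s x) (normal_density 0 (sqrt (t - s))))"

definition two_sided_wiener :: "(real \<Rightarrow> real) measure \<Rightarrow> bool" where
  "two_sided_wiener P \<longleftrightarrow>
     prob_space P \<and> space P = paths UNIV \<and> sets P = sets (path_borel UNIV) \<and>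
     standard_brownian_motion P (\<lambda>t w. w t) \<and>
     standard_brownian_motion P (\<lambda>t w. w (- t)) \<and>
     prob_space.indep_var P
       (PiM {0..} (\<lambda>_. borel)) (\<lambda>w. \<lambda>t\<in>{0..}. w t)
       (PiM {0..} (\<lambda>_. borel)) (\<lambda>w. \<lambda>t\<in>{0..}. w (- t))"

definition completed_wiener :: "(real \<Rightarrow> real) measure \<Rightarrow> bool" where
  "completed_wiener W \<longleftrightarrow> (\<exists>P. two_sided_wiener P \<and> W = completion P)"

text \<open>Sub-\<open>\<sigma>\<close>-fields are represented by measure spaces, of which only \<open>space\<close> and \<open>sets\<close> matter.\<close>

definition incr_field :: "(real \<Rightarrow> real) measure \<Rightarrow> ereal \<Rightarrow> ereal \<Rightarrow> (real \<Rightarrow> real) measure" where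
  "incr_field W s t = sigma (space W)
     ({(\<lambda>w. w v - w u) -` A \<inter> space W | u v A.
         s \<le> ereal u \<and> u \<le> v \<and> ereal v \<le> t \<and> A \<in> sets borel} \<union>
      {A \<in> sets W. emeasure W A = 0 \<or> emeasure W A = 1})"

definition levy_shift :: "real \<Rightarrow> (real \<Rightarrow> real) \<Rightarrow> real \<Rightarrow> real" where
  "levy_shift u w = (\<lambda>t. w (u + t) - w u)"

definition time_refl :: "(real \<Rightarrow> real) \<Rightarrow> real \<Rightarrow> real" where
  "time_refl w = (\<lambda>t. w (- t))"

definition stopped :: "real \<Rightarrow> (real \<Rightarrow> real) \<Rightarrow> real \<Rightarrow> real" where
  "stopped u w = (\<lambda>t. w (min t u))"


text \<open>Random countable sets. The coffin state is \<open>None\<close>; \<open>map_option\<close> lets it absorb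
  addition and negation.\<close>

definition coffin_borel :: "real option measure" where
  "coffin_borel = sigma UNIV (insert {None} ((`) Some ` sets borel))"

definition measurable_enumeration ::
  "(real \<Rightarrow> real) measure \<Rightarrow> (real \<Rightarrow> real) measure \<Rightarrow> ((real \<Rightarrow> real) \<Rightarrow> real set) \<Rightarrow>
   (nat \<Rightarrow> (real \<Rightarrow> real) \<Rightarrow> real option) \<Rightarrow> bool" where
  "measurable_enumeration W A M S \<longleftrightarrow>
     (\<forall>i. S i \<in> A \<rightarrow>\<^sub>M coffin_borel) \<and> (AE w in W. M w = {x. \<exists>i. S i w = Some x})"

definition random_countable_set ::
  "(real \<Rightarrow> real) measure \<Rightarrow> ((real \<Rightarrow> real) \<Rightarrow> real set) \<Rightarrow> bool" where
  "random_countable_set W M \<longleftrightarrow> (\<exists>S. measurable_enumeration W W M S)"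

definition local_set ::
  "(real \<Rightarrow> real) measure \<Rightarrow> ((real \<Rightarrow> real) \<Rightarrow> real set) \<Rightarrow> bool" where
  "local_set W M \<longleftrightarrow> (\<forall>s t :: ereal. s < t \<longrightarrow>
     (\<exists>S. measurable_enumeration W (incr_field W s t)
            (\<lambda>w. M w \<inter> {x. s < ereal x \<and> ereal x < t}) S))"

definition stationary_set ::
  "(real \<Rightarrow> real) measure \<Rightarrow> ((real \<Rightarrow> real) \<Rightarrow> real set) \<Rightarrow> bool" where
  "stationary_set W M \<longleftrightarrow> (\<forall>u. AE w in W. M w = (\<lambda>x. u + x) ` M (levy_shift u w))"

definition stationary_local_rcs ::
  "(real \<Rightarrow> real) measure \<Rightarrow> ((real \<Rightarrow> real) \<Rightarrow> real set) \<Rightarrow> bool" where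
  "stationary_local_rcs W M \<longleftrightarrow>
     random_countable_set W M \<and> local_set W M \<and> stationary_set W M"


text \<open>Honest indexations. Only the values \<open>\<tau> s t\<close> with \<open>s < t\<close> matter.\<close>

definition honest_indexation ::
  "(real \<Rightarrow> real) measure \<Rightarrow> ((real \<Rightarrow> real) \<Rightarrow> real set) \<Rightarrow>
   (real \<Rightarrow> real \<Rightarrow> (real \<Rightarrow> real) \<Rightarrow> real option) \<Rightarrow> bool" where
  "honest_indexation W M \<tau> \<longleftrightarrow>
     (\<forall>s t. s < t \<longrightarrow> \<tau> s t \<in> incr_field W (-\<infinity>) \<infinity> \<rightarrow>\<^sub>M coffin_borel) \<and>
     (\<forall>s t. s < t \<longrightarrow> (AE w in W. \<tau> s t w \<in> Some ` M w)) \<and>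
     (AE w in W. Some ` M w = {\<tau> s t w | s t. s \<in> \<rat> \<and> t \<in> \<rat> \<and> s < t}) \<and>
     (\<forall>s t. s < t \<longrightarrow> (AE w in W. \<tau> s t w \<in> Some ` {s<..<t}) \<and>
        \<tau> s t \<in> incr_field W (ereal s) (ereal t) \<rightarrow>\<^sub>M coffin_borel) \<and>
     (\<forall>h s t. s < t \<longrightarrow>
        (AE w in W. \<tau> (s + h) (t + h) w = map_option (\<lambda>x. h + x) (\<tau> s t (levy_shift h w)))) \<and>
     (\<forall>s u v t. s \<le> u \<and> u < v \<and> v \<le> t \<longrightarrow>
        (AE w in W. \<tau> s t w \<in> Some ` {u<..<v} \<longrightarrow> \<tau> s t w = \<tau> u v w))"

definition dual_indexation ::
  "(real \<Rightarrow> real \<Rightarrow> (real \<Rightarrow> real) \<Rightarrow> real option) \<Rightarrow>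
   real \<Rightarrow> real \<Rightarrow> (real \<Rightarrow> real) \<Rightarrow> real option" where
  "dual_indexation \<tau> s t w = map_option uminus (\<tau> (- t) (- s) (time_refl w))"

text \<open>The pointwise constraint on the values rules out the coffin state on the relevant domain, so
  that \<open>the\<close> is harmless here and in \<open>at_exp\<close>.\<close>

definition regular_indexation ::
  "(real \<Rightarrow> real) measure \<Rightarrow> (real \<Rightarrow> real \<Rightarrow> (real \<Rightarrow> real) \<Rightarrow> real option) \<Rightarrow> bool" where
  "regular_indexation W \<tau> \<longleftrightarrow>
     (\<forall>t>0. \<forall>w\<in>space W. \<tau> 0 t w \<in> Some ` {0..t}) \<and>
     (\<lambda>(t, w). the (\<tau> 0 t w)) \<in>
       (restrict_space borel {0<..} \<Otimes>\<^sub>M W) \<rightarrow>\<^sub>M restrict_space borel {0..}"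


text \<open>The independent exponential time\<close>

definition exp_law :: "real \<Rightarrow> real measure" where
  "exp_law l = restrict_space (density lborel (\<lambda>x. ennreal (exponential_density l x))) {0<..}"

definition with_exp :: "(real \<Rightarrow> real) measure \<Rightarrow> real \<Rightarrow> ((real \<Rightarrow> real) \<times> real) measure" where
  "with_exp W l = W \<Otimes>\<^sub>M exp_law l"

definition at_exp ::
  "(real \<Rightarrow> real \<Rightarrow> (real \<Rightarrow> real) \<Rightarrow> real option) \<Rightarrow> (real \<Rightarrow> real) \<times> real \<Rightarrow> real" where
  "at_exp \<tau> = (\<lambda>(w, e). the (\<tau> 0 e w))"

definition bounded_left_continuous_adapted ::
  "(real \<Rightarrow> real) measure \<Rightarrow> (real \<Rightarrow> (real \<Rightarrow> real) \<Rightarrow> real) \<Rightarrow> bool" where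
  "bounded_left_continuous_adapted W Z \<longleftrightarrow>
     (\<exists>C. \<forall>t\<ge>0. \<forall>w\<in>space W. \<bar>Z t w\<bar> \<le> C) \<and>
     (\<forall>w\<in>space W. \<forall>t>0. continuous (at_left t) (\<lambda>s. Z s w)) \<and>
     (\<forall>t\<ge>0. Z t \<in> borel_measurable (incr_field W (-\<infinity>) (ereal t)))"

definition past_field ::
  "(real \<Rightarrow> real) measure \<Rightarrow> real \<Rightarrow> (real \<Rightarrow> real \<Rightarrow> (real \<Rightarrow> real) \<Rightarrow> real option) \<Rightarrow>
   ((real \<Rightarrow> real) \<times> real) measure" where
  "past_field W l \<tau> = sigma (space (with_exp W l))
     {(\<lambda>(w, e). Z (at_exp \<tau> (w, e)) w) -` A \<inter> space (with_exp W l) | Z A.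
        bounded_left_continuous_adapted W Z \<and> A \<in> sets borel}"

definition past_pair ::
  "(real \<Rightarrow> real \<Rightarrow> (real \<Rightarrow> real) \<Rightarrow> real option) \<Rightarrow>
   (real \<Rightarrow> real) \<times> real \<Rightarrow> real \<times> (real \<Rightarrow> real)" where
  "past_pair \<tau> = (\<lambda>(w, e). (at_exp \<tau> (w, e), stopped (at_exp \<tau> (w, e)) w))"

definition future_pair ::
  "(real \<Rightarrow> real \<Rightarrow> (real \<Rightarrow> real) \<Rightarrow> real option) \<Rightarrow>
   (real \<Rightarrow> real) \<times> real \<Rightarrow> real \<times> (real \<Rightarrow> real)" where
  "future_pair \<tau> = (\<lambda>(w, e).
     (e - at_exp \<tau> (w, e), restrict (levy_shift (at_exp \<tau> (w, e)) w) {0..}))"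

definition reversed_past_pair ::
  "(real \<Rightarrow> real \<Rightarrow> (real \<Rightarrow> real) \<Rightarrow> real option) \<Rightarrow>
   (real \<Rightarrow> real) \<times> real \<Rightarrow> real \<times> (real \<Rightarrow> real)" where
  "reversed_past_pair \<tau> = (\<lambda>(w, e).
     (at_exp \<tau> (w, e), restrict (time_refl (levy_shift (at_exp \<tau> (w, e)) w)) {0..}))"

definition future_space :: "(real \<times> (real \<Rightarrow> real)) measure" where
  "future_space = borel \<Otimes>\<^sub>M path_borel {0..}"

end

theory Submission
  imports Defs
begin

text \<open>For a nested indexation the time \<open>T t = \<tau> 0 t\<close> moves beyond a level \<open>u\<close> at a stopping time \<open>D\<close>, and
  from \<open>D\<close> on the value of \<open>T\<close> at the exponential time is found from the path after \<open>D\<close> alone. By the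
  strong Markov property and the lack of memory of the exponential law, everything computed from
  the path after \<open>T\<close> is therefore independent of the past at \<open>u\<close> on the event that \<open>T\<close> exceeds \<open>u\<close>.
  The delicate point is that \<open>T\<close> does not take the value \<open>D\<close> itself. Brownian martingales being
  continuous, \<open>D\<close> is predictable; were \<open>T = D\<close>, then \<open>T\<close> would follow immediately upon a stopping time
  announcing \<open>D\<close>, which is unlikely, again by the strong Markov property. Reversing time at the
  exponential time exchanges \<open>\<tau>\<close> with its dual, whence the identity of laws. It also shows that the
  event that \<open>T\<close> lies in \<open>M'\<close> is independent of the past and future at \<open>T\<close> jointly, hence of itself.\<close>

section \<open>Path spaces\<close>

text \<open>The time \<open>D\<close> is never formed. Each property of an indexation holds almost
  surely for fixed times only, with an exceptional set depending on those times; so crossings of a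
  level are observed on dyadic grids, and statements about the exponential time are obtained by
  integrating over its value. The price is that \<open>T x\<close> might lie in the very cell of the
  crossing, before the restart at the end of that cell. That the probability of this vanishes is
  where predictability enters, in an elementary form: the conditional mean of a functional given the
  path up to time s is an integral over glued paths, defined at every path and continuous in s for a
  class of functionals that approximates every event in the mean. A crossing event is replaced by
  such a functional, and the first grid time at which its conditional mean exceeds 1/2 plays the
  role of the announcing time. As all fields contain the null events, events of the past and of the
  future are replaced by Borel ones that look at one side of the path only; independence then
  amounts to the fact that a path glued from two independent copies is again Brownian.\<close>

lemma space_path_borel [simp]: "space (path_borel T) = paths T"
  by (simp add: path_borel_def space_measure_of_conv)

lemma openin_path_topology_subset: "openin (path_topology T) U \<Longrightarrow> U \<subseteq> paths T"
  using openin_subset[of "path_topology T" U] by (auto simp: path_topology_def)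

lemma sets_path_borel: "sets (path_borel T) = sigma_sets (paths T) {U. openin (path_topology T) U}"
  unfolding path_borel_def by (rule sets_measure_of) (use openin_path_topology_subset in blast)

lemma pathsD:
  assumes "w \<in> paths T"
  shows "continuous_on T w" "w 0 = 0" "w \<in> extensional T"
  using assms by (auto simp: paths_def)

lemma paths_UNIV_iff: "w \<in> paths UNIV \<longleftrightarrow> continuous_on UNIV w \<and> w 0 = 0"
  by (auto simp: paths_def)

text \<open>Balls over the one-point compact set {t} suffice: around a path whose value at t is
  below y, the ball of radius \<open>y - w t\<close> stays below y.\<close>

lemma measurable_path_eval [measurable]:
  assumes t: "t \<in> T"
  shows "(\<lambda>w. w t) \<in> borel_measurable (path_borel T)"
proof (rule borel_measurable_iff_less[THEN iffD2], rule allI)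
  fix y :: real
  let ?B = "\<lambda>w. {w' \<in> paths T. \<forall>s\<in>{t}. \<bar>w' s - w s\<bar> < y - w t}"
  have "openin (path_topology T) (\<Union> (?B ` {w \<in> paths T. w t < y}))"
    unfolding path_topology_def
  proof (intro openin_Union ballI)
    fix U assume "U \<in> ?B ` {w \<in> paths T. w t < y}"
    then obtain w where w: "w \<in> paths T" "w t < y" "U = ?B w" by auto
    show "openin (topology_generated_by {{w' \<in> paths T. \<forall>t\<in>K. \<bar>w' t - w t\<bar> < \<epsilon>} |w K \<epsilon>. w \<in> paths T \<and> compact K \<and> K \<subseteq> T \<and> 0 < \<epsilon>}) U"
      unfolding w(3) using w t
      by (intro topology_generated_by_Basis CollectI exI[of _ w] exI[of _ "{t}"] exI[of _ "y - w t"]) auto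
  qed
  moreover have "\<Union> (?B ` {w \<in> paths T. w t < y}) = {w \<in> space (path_borel T). w t < y}"
    by (force simp: abs_less_iff)
  ultimately show "{w \<in> space (path_borel T). w t < y} \<in> sets (path_borel T)"
    by (auto simp: sets_path_borel)
qed

text \<open>Each quadruple (a, b, c, d) confines the path to {c..d} on {a..b}. There are countably
  many finite sets of rational quadruples, and their boxes stand in for a countable base of the
  topology; being given by closed conditions, they can be tested on a dense set of times.\<close>

definition path_box :: "real set \<Rightarrow> (real \<times> real \<times> real \<times> real) set \<Rightarrow> (real \<Rightarrow> real) set" where
  "path_box T F = {w \<in> paths T. \<forall>(a, b, c, d)\<in>F. \<forall>t\<in>T \<inter> {a..b}. c \<le> w t \<and> w t \<le> d}"

text \<open>By compactness: around each time of \<open>K\<close> there is a rational interval on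
  which the path stays between two rational levels less than \<epsilon> apart, and finitely many of
  these intervals cover \<open>K\<close>. Every path of the box is confined to the same
  strips.\<close>

lemma path_box_neighbourhood:
  assumes T: "closed T" and w: "w \<in> paths T" and \<epsilon>: "0 < \<epsilon>"
  obtains F where "finite F" "F \<subseteq> \<rat> \<times> \<rat> \<times> \<rat> \<times> \<rat>" "w \<in> path_box T F"
    "\<And>w' t. w' \<in> path_box T F \<Longrightarrow> t \<in> T \<Longrightarrow> \<bar>t\<bar> \<le> r \<Longrightarrow> \<bar>w' t - w t\<bar> < \<epsilon>"
proof -
  define K where "K = T \<inter> {-r..r}"
  have K: "compact K" unfolding K_def using T by (simp add: closed_Int_compact)
  have ex: "\<exists>q. fst q \<in> \<rat> \<and> fst (snd q) \<in> \<rat> \<and> fst (snd (snd q)) \<in> \<rat> \<and> snd (snd (snd q)) \<in> \<rat> \<and>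
      t \<in> {fst q<..<fst (snd q)} \<and> snd (snd (snd q)) - fst (snd (snd q)) < \<epsilon> \<and> w \<in> path_box T {q}"
    if t: "t \<in> K" for t
  proof -
    obtain c where c: "c \<in> \<rat>" "w t - \<epsilon>/2 < c" "c < w t" using Rats_dense_in_real[of "w t - \<epsilon>/2" "w t"] \<epsilon> by auto
    obtain d where d: "d \<in> \<rat>" "w t < d" "d < w t + \<epsilon>/2" using Rats_dense_in_real[of "w t" "w t + \<epsilon>/2"] \<epsilon> by auto
    define e where "e = min (w t - c) (d - w t)"
    have e: "0 < e" using c d by (auto simp: e_def)
    have "continuous_on T w" "t \<in> T" using pathsD(1)[OF w] t by (auto simp: K_def)
    then obtain \<eta> where \<eta>: "0 < \<eta>" "\<And>s. s \<in> T \<Longrightarrow> dist s t < \<eta> \<Longrightarrow> dist (w s) (w t) < e"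
      unfolding continuous_on_iff using e by metis
    obtain a where a: "a \<in> \<rat>" "t - \<eta> < a" "a < t" using Rats_dense_in_real[of "t - \<eta>" t] \<eta> by auto
    obtain b where b: "b \<in> \<rat>" "t < b" "b < t + \<eta>" using Rats_dense_in_real[of t "t + \<eta>"] \<eta> by auto
    have "c \<le> w s \<and> w s \<le> d" if "s \<in> T" "s \<in> {a..b}" for s
    proof -
      have "dist s t < \<eta>" using that a b by (auto simp: dist_real_def)
      from \<eta>(2)[OF that(1) this] show ?thesis by (auto simp: dist_real_def e_def abs_if split: if_splits)
    qed
    then show ?thesis
      using a b c d w by (intro exI[of _ "(a,b,c,d)"]) (auto simp: path_box_def)
  qed
  define q where "q t = (SOME q. fst q \<in> \<rat> \<and> fst (snd q) \<in> \<rat> \<and> fst (snd (snd q)) \<in> \<rat> \<and> snd (snd (snd q)) \<in> \<rat> \<and>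
      t \<in> {fst q<..<fst (snd q)} \<and> snd (snd (snd q)) - fst (snd (snd q)) < \<epsilon> \<and> w \<in> path_box T {q})" for t
  have q: "fst (q t) \<in> \<rat> \<and> fst (snd (q t)) \<in> \<rat> \<and> fst (snd (snd (q t))) \<in> \<rat> \<and> snd (snd (snd (q t))) \<in> \<rat> \<and>
      t \<in> {fst (q t)<..<fst (snd (q t))} \<and> snd (snd (snd (q t))) - fst (snd (snd (q t))) < \<epsilon> \<and> w \<in> path_box T {q t}"
    if "t \<in> K" for t
    unfolding q_def by (rule someI_ex[OF ex[OF that]])
  obtain D where D: "D \<subseteq> K" "finite D" "K \<subseteq> (\<Union>t\<in>D. {fst (q t)<..<fst (snd (q t))})"
    using compactE_image[OF K, of K "\<lambda>t. {fst (q t)<..<fst (snd (q t))}"] q by (metis (no_types, lifting) UN_iff open_greaterThanLessThan subsetI)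
  show thesis
  proof (rule that[of "q ` D"])
    show "finite (q ` D)" using D by simp
    show "q ` D \<subseteq> \<rat> \<times> \<rat> \<times> \<rat> \<times> \<rat>" 
      by (intro image_subsetI) (use q D(1) in \<open>auto simp: mem_Times_iff\<close>)
    show wq: "w \<in> path_box T (q ` D)" using q D(1) w by (fastforce simp: path_box_def)
    fix w' t assume w': "w' \<in> path_box T (q ` D)" and t: "t \<in> T" "\<bar>t\<bar> \<le> r"
    then have "t \<in> K" by (auto simp: K_def)
    then obtain s where s: "s \<in> D" "t \<in> {fst (q s)<..<fst (snd (q s))}" using D by blast
    obtain a b c d where abcd: "q s = (a,b,c,d)" by (metis prod.exhaust)
    have "c \<le> w' t \<and> w' t \<le> d" "c \<le> w t \<and> w t \<le> d"
      using w' wq s t unfolding path_box_def by (force simp: abcd)+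
    moreover have "d - c < \<epsilon>" using q[of s] s D by (auto simp: abcd)
    ultimately show "\<bar>w' t - w t\<bar> < \<epsilon>" by linarith
  qed
qed

text \<open>Induction over the generation of the topology. For a generating ball, the distance of
  \<open>w\<close> from the centre stays below some m < e on the compact set, and e - m is the room
  left around \<open>w\<close>.\<close>

lemma path_open_contains_ball:
  assumes "openin (path_topology T) U" "w \<in> U"
  shows "\<exists>r \<epsilon>. 0 < \<epsilon> \<and> {w' \<in> paths T. \<forall>t\<in>T. \<bar>t\<bar> \<le> r \<longrightarrow> \<bar>w' t - w t\<bar> < \<epsilon>} \<subseteq> U"
proof -
  have "generate_topology_on {{w' \<in> paths T. \<forall>t\<in>K. \<bar>w' t - w t\<bar> < \<epsilon>} |w K \<epsilon>.
      w \<in> paths T \<and> compact K \<and> K \<subseteq> T \<and> (0::real) < \<epsilon>} U"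
    using assms(1) by (simp add: path_topology_def openin_topology_generated_by)
  then show ?thesis using assms(2)
  proof (induction arbitrary: w)
    case (Int A B)
    obtain r e where 1: "0 < e" "{w' \<in> paths T. \<forall>t\<in>T. \<bar>t\<bar> \<le> r \<longrightarrow> \<bar>w' t - w t\<bar> < e} \<subseteq> A" using Int by blast
    obtain r' e' where 2: "0 < e'" "{w' \<in> paths T. \<forall>t\<in>T. \<bar>t\<bar> \<le> r' \<longrightarrow> \<bar>w' t - w t\<bar> < e'} \<subseteq> B" using Int by blast
    have "{w' \<in> paths T. \<forall>t\<in>T. \<bar>t\<bar> \<le> max r r' \<longrightarrow> \<bar>w' t - w t\<bar> < min e e'} \<subseteq>
      {w' \<in> paths T. \<forall>t\<in>T. \<bar>t\<bar> \<le> r \<longrightarrow> \<bar>w' t - w t\<bar> < e} \<inter> {w' \<in> paths T. \<forall>t\<in>T. \<bar>t\<bar> \<le> r' \<longrightarrow> \<bar>w' t - w t\<bar> < e'}"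
      by (auto simp: le_max_iff_disj)
    then show ?case using 1 2 by (intro exI[of _ "max r r'"] exI[of _ "min e e'"]) auto
  next
    case (UN \<K>) then show ?case by (meson UnionE Union_upper subset_trans)
  next
    case (Basis S)
    then obtain v K e where S: "S = {w' \<in> paths T. \<forall>t\<in>K. \<bar>w' t - v t\<bar> < e}"
      "v \<in> paths T" "compact K" "K \<subseteq> T" "0 < e" by blast
    have w: "w \<in> paths T" "\<forall>t\<in>K. \<bar>w t - v t\<bar> < e" using Basis S by auto
    obtain r where r: "\<And>t. t \<in> K \<Longrightarrow> \<bar>t\<bar> \<le> r" using compact_imp_bounded[OF S(3)] by (auto simp: bounded_real)
    have "\<exists>m<e. \<forall>t\<in>K. \<bar>w t - v t\<bar> \<le> m"
    proof (cases "K = {}")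
      case True then show ?thesis using S(5) by auto
    next
      case False
      have "continuous_on K (\<lambda>t. \<bar>w t - v t\<bar>)"
        by (intro continuous_intros continuous_on_subset[OF pathsD(1)[OF w(1)] S(4)] continuous_on_subset[OF pathsD(1)[OF S(2)] S(4)])
      from continuous_attains_sup[OF S(3) False this] show ?thesis using w(2) by blast
    qed
    then obtain m where m: "m < e" "\<forall>t\<in>K. \<bar>w t - v t\<bar> \<le> m" by blast
    have "{w' \<in> paths T. \<forall>t\<in>T. \<bar>t\<bar> \<le> r \<longrightarrow> \<bar>w' t - w t\<bar> < e - m} \<subseteq> S"
      unfolding S(1) using m(2) r S(4) by (smt (verit, ccfv_threshold) Collect_mono subsetD)
    then show ?case using m(1) by (intro exI[of _ r] exI[of _ "e - m"]) auto
  qed simp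
qed

text \<open>The Borel field is generated by the evaluations: an open set is the union of the
  countably many rational boxes inside it, and by continuity membership in a box is decided on a
  countable dense set of times.\<close>

lemma measurable_path_borelI:
  assumes T: "closed T" and f: "\<And>x. x \<in> space M \<Longrightarrow> f x \<in> paths T"
    and ev: "\<And>t. t \<in> T \<Longrightarrow> (\<lambda>x. f x t) \<in> borel_measurable M"
  shows "f \<in> M \<rightarrow>\<^sub>M path_borel T"
  unfolding path_borel_def
proof (rule measurable_sigma_sets[OF sets_measure_of])
  show "{U. openin (path_topology T) U} \<subseteq> Pow (paths T)" using openin_path_topology_subset by blast
  then show "{U. openin (path_topology T) U} \<subseteq> Pow (paths T)" .
  show "f \<in> space M \<rightarrow> paths T" using f by auto
  have box: "f -` path_box T {q} \<inter> space M \<in> sets M" for q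
  proof -
    obtain a b c d where q: "q = (a,b,c,d)" by (metis prod.exhaust)
    obtain D where D: "countable D" "D \<subseteq> T \<inter> {a..b}" "T \<inter> {a..b} \<subseteq> closure D"
      using separable[of "T \<inter> {a..b}"] by blast
    have "f -` path_box T {q} \<inter> space M = {x\<in>space M. \<forall>t\<in>D. c \<le> f x t \<and> f x t \<le> d}" (is "?L = ?R")
    proof
      show "?L \<subseteq> ?R" using D(2) by (auto simp: path_box_def q)
      show "?R \<subseteq> ?L"
      proof
        fix x assume x: "x \<in> ?R"
        have cl: "closure D \<subseteq> T \<inter> {a..b}" by (rule closure_minimal[OF D(2)]) (use T in auto)
        have "continuous_on (closure D) (f x)"
          by (rule continuous_on_subset[OF pathsD(1)[OF f]]) (use cl x in auto)
        then have "f x t \<in> {c..d}" if "t \<in> closure D" for t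
          using image_closure_subset[of D "f x" "{c..d}"] that x by (simp add: image_subset_iff)
        then show "x \<in> ?L" using x D f by (auto simp: path_box_def q)
      qed
    qed
    also have "\<dots> \<in> sets M"
    proof -
      have "{x\<in>space M. \<forall>t\<in>D. c \<le> f x t \<and> f x t \<le> d} = {x\<in>space M. \<forall>t\<in>D. x \<in> {x\<in>space M. c \<le> f x t \<and> f x t \<le> d}}" by auto
      also have "\<dots> \<in> sets M"
      proof (rule sets.sets_Collect_countable_All'[OF _ D(1)])
        fix t assume "t \<in> D"
        then have [measurable]: "(\<lambda>x. f x t) \<in> borel_measurable M" using ev D(2) by auto
        show "{x \<in> space M. x \<in> {x\<in>space M. c \<le> f x t \<and> f x t \<le> d}} \<in> sets M" by measurable
      qed
      finally show ?thesis .
    qed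
    finally show ?thesis .
  qed
  fix U assume "U \<in> {U. openin (path_topology T) U}"
  then have U: "openin (path_topology T) U" by simp
  define C where "C = {F. finite F \<and> F \<subseteq> \<rat> \<times> \<rat> \<times> \<rat> \<times> (\<rat>::real set) \<and> path_box T F \<subseteq> U}"
  have "countable C"
    by (rule countable_subset[OF _ countable_Collect_finite_subset[of "\<rat> \<times> \<rat> \<times> \<rat> \<times> (\<rat>::real set)"]])
      (auto simp: C_def intro!: countable_SIGMA countable_rat)
  have "U = (\<Union>F\<in>C. path_box T F)"
  proof
    show "U \<subseteq> (\<Union>F\<in>C. path_box T F)"
    proof
      fix w assume w: "w \<in> U"
      then have wp: "w \<in> paths T" using openin_path_topology_subset[OF U] by auto
      obtain r e where re: "0 < e" "{w' \<in> paths T. \<forall>t\<in>T. \<bar>t\<bar> \<le> r \<longrightarrow> \<bar>w' t - w t\<bar> < e} \<subseteq> U"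
        using path_open_contains_ball[OF U w] by blast
      from path_box_neighbourhood[OF T wp re(1), of r] obtain F where F: "finite F" "F \<subseteq> \<rat> \<times> \<rat> \<times> \<rat> \<times> \<rat>" "w \<in> path_box T F"
        "\<And>w' t. w' \<in> path_box T F \<Longrightarrow> t \<in> T \<Longrightarrow> \<bar>t\<bar> \<le> r \<Longrightarrow> \<bar>w' t - w t\<bar> < e" by metis
      have "path_box T F \<subseteq> U" using F(4) re(2) by (force simp: path_box_def)
      then show "w \<in> (\<Union>F\<in>C. path_box T F)" using F by (auto simp: C_def)
    qed
  qed (auto simp: C_def)
  then have "f -` U \<inter> space M = (\<Union>F\<in>C. f -` path_box T F \<inter> space M)" by auto
  also have "\<dots> \<in> sets M"
  proof (rule sets.countable_UN''[OF \<open>countable C\<close>])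
    fix F assume "F \<in> C"
    then have "finite F" by (simp add: C_def)
    have "f -` path_box T F \<inter> space M = {x\<in>space M. \<forall>q\<in>F. x \<in> f -` path_box T {q} \<inter> space M}"
      using f by (auto simp: path_box_def)
    also have "\<dots> \<in> sets M"
    proof (rule sets.sets_Collect_finite_All[OF _ \<open>finite F\<close>])
      fix q
      have "{x \<in> space M. x \<in> f -` path_box T {q} \<inter> space M} = f -` path_box T {q} \<inter> space M" by blast
      then show "{x \<in> space M. x \<in> f -` path_box T {q} \<inter> space M} \<in> sets M" using box by simp
    qed
    finally show "f -` path_box T F \<inter> space M \<in> sets M" .
  qed
  finally show "f -` U \<inter> space M \<in> sets M" .
qed

section \<open>Cylinder sets and evaluation of a path at a random time\<close>

abbreviation path_cyl :: "(real \<times> real) set \<Rightarrow> (real \<Rightarrow> real) set" where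
  "path_cyl K \<equiv> {w \<in> paths UNIV. \<forall>(t, y)\<in>K. w t \<le> y}"

lemma Int_stable_path_cyl: "Int_stable {path_cyl K | K. finite K}"
proof (rule Int_stableI)
  fix a b assume "a \<in> {path_cyl K | K. finite K}" "b \<in> {path_cyl K | K. finite K}"
  then obtain K L where "a = path_cyl K" "b = path_cyl L" "finite K" "finite L" by blast
  then show "a \<inter> b \<in> {path_cyl K | K. finite K}"
    by (intro CollectI exI[of _ "K \<union> L"]) auto
qed

lemma sets_path_borel_UNIV: "sets (path_borel UNIV) = sigma_sets (paths UNIV) {path_cyl K | K. finite K}"
proof (intro equalityI)
  let ?G = "{path_cyl K | K. finite K}"
  have G: "?G \<subseteq> Pow (paths UNIV)" by auto
  have "(\<lambda>w. w) \<in> sigma (paths UNIV) ?G \<rightarrow>\<^sub>M path_borel UNIV"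
  proof (rule measurable_path_borelI)
    fix t :: real
    show "(\<lambda>w. w t) \<in> borel_measurable (sigma (paths UNIV) ?G)"
    proof (rule borel_measurable_iff_le[THEN iffD2], rule allI)
      fix y
      have "{w \<in> space (sigma (paths UNIV) ?G). w t \<le> y} = path_cyl {(t,y)}"
        by (auto simp: space_measure_of_conv)
      then show "{w \<in> space (sigma (paths UNIV) ?G). w t \<le> y} \<in> sets (sigma (paths UNIV) ?G)"
        unfolding sets_measure_of[OF G] by (intro sigma_sets.Basic) blast
    qed
  qed (auto simp: space_measure_of_conv)
  then show "sets (path_borel UNIV) \<subseteq> sigma_sets (paths UNIV) ?G"
  proof (intro subsetI)
    fix A assume id: "(\<lambda>w. w) \<in> sigma (paths UNIV) ?G \<rightarrow>\<^sub>M path_borel UNIV" and A: "A \<in> sets (path_borel UNIV)"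
    have "A \<subseteq> paths UNIV" using sets.sets_into_space[OF A] by simp
    then show "A \<in> sigma_sets (paths UNIV) ?G"
      using measurable_sets[OF id A] G by (simp add: space_measure_of_conv sets_measure_of Int_absorb2)
  qed
  show "sigma_sets (paths UNIV) ?G \<subseteq> sets (path_borel UNIV)"
  proof -
    have "path_cyl K \<in> sets (path_borel UNIV)" if "finite K" for K
    proof -
      have "path_cyl K = {w\<in>space (path_borel UNIV). \<forall>p\<in>K. w (fst p) \<le> snd p}" by auto
      also have "\<dots> \<in> sets (path_borel UNIV)" using that by measurable
      finally show ?thesis .
    qed
    then show ?thesis using sets.sigma_sets_subset[of ?G "path_borel UNIV"] by auto
  qed
qed

lemma path_cyl_sets: "finite K \<Longrightarrow> path_cyl K \<in> sets (path_borel UNIV)"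
  unfolding sets_path_borel_UNIV by (intro sigma_sets.Basic) blast

lemma path_measure_eqI:
  assumes "prob_space P" "sets P = sets (path_borel UNIV)" "sets Q = sets (path_borel UNIV)"
    and "\<And>K. finite K \<Longrightarrow> emeasure P (path_cyl K) = emeasure Q (path_cyl K)"
  shows "P = Q"
proof (rule measure_eqI_generator_eq[OF Int_stable_path_cyl, where \<Omega>="paths UNIV" and A="\<lambda>_. paths UNIV"])
  interpret P: prob_space P by fact
  have "space P = paths UNIV" using sets_eq_imp_space_eq[OF assms(2)] by simp
  then show "emeasure P (paths UNIV) \<noteq> \<infinity>" for i :: nat using P.emeasure_finite by simp
  show "range (\<lambda>_::nat. paths UNIV) \<subseteq> {path_cyl K |K. finite K}"
    by (auto intro!: exI[of _ "{}"])
qed (use assms sets_path_borel_UNIV in auto)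

lemma grid_below_tendsto:
  fixes x :: real
  shows "(\<lambda>n. real_of_int (\<lceil>x * real (Suc n)\<rceil> - 1) / real (Suc n)) \<longlonglongrightarrow> x"
proof (rule tendsto_sandwich[where f="\<lambda>n. x - 1 / real (Suc n)" and h="\<lambda>n. x"])
  show "(\<lambda>n. x - 1 / real (Suc n)) \<longlonglongrightarrow> x"
    using tendsto_diff[OF tendsto_const[of x] LIMSEQ_inverse_real_of_nat] by (simp add: inverse_eq_divide)
  show "\<forall>\<^sub>F n in sequentially. x - 1 / real (Suc n) \<le> real_of_int (\<lceil>x * real (Suc n)\<rceil> - 1) / real (Suc n)"
  proof (intro always_eventually allI)
    fix n
    have "x * real (Suc n) \<le> real_of_int \<lceil>x * real (Suc n)\<rceil>" by (rule le_of_int_ceiling)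
    then have "(x * real (Suc n) - 1) / real (Suc n) \<le> real_of_int (\<lceil>x * real (Suc n)\<rceil> - 1) / real (Suc n)"
      by (intro divide_right_mono) auto
    then show "x - 1 / real (Suc n) \<le> real_of_int (\<lceil>x * real (Suc n)\<rceil> - 1) / real (Suc n)"
      by (simp add: diff_divide_distrib)
  qed
  show "\<forall>\<^sub>F n in sequentially. real_of_int (\<lceil>x * real (Suc n)\<rceil> - 1) / real (Suc n) \<le> x"
  proof (intro always_eventually allI)
    fix n
    have "real_of_int \<lceil>x * real (Suc n)\<rceil> - 1 < x * real (Suc n)" by linarith
    then show "real_of_int (\<lceil>x * real (Suc n)\<rceil> - 1) / real (Suc n) \<le> x" by (simp add: field_simps)
  qed
qed simp

text \<open>Rounded to a grid, the time takes countably many values, for each of which evaluation is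
  measurable; continuity of the path gives the limit.\<close>

lemma measurable_path_eval_pair:
  "(\<lambda>(w, x). w x) \<in> borel_measurable (path_borel UNIV \<Otimes>\<^sub>M borel)"
proof -
  have "(\<lambda>p. fst p (snd p)) \<in> borel_measurable (path_borel UNIV \<Otimes>\<^sub>M borel)"
  proof (rule borel_measurable_LIMSEQ_real)
    fix p :: "(real \<Rightarrow> real) \<times> real" assume "p \<in> space (path_borel UNIV \<Otimes>\<^sub>M borel)"
    then have "isCont (fst p) (snd p)" by (auto simp: space_pair_measure paths_UNIV_iff continuous_on_eq_continuous_at)
    then show "(\<lambda>n. fst p (real_of_int (\<lceil>snd p * real (Suc n)\<rceil> - 1) / real (Suc n))) \<longlonglongrightarrow> fst p (snd p)"
      by (rule isCont_tendsto_compose[OF _ grid_below_tendsto])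
  next
    fix n
    show "(\<lambda>p. fst p (real_of_int (\<lceil>snd p * real (Suc n)\<rceil> - 1) / real (Suc n))) \<in> borel_measurable (path_borel UNIV \<Otimes>\<^sub>M borel)"
    proof (rule measurable_compose_countable[where f="\<lambda>k p. fst p (real_of_int (k - 1) / real (Suc n))" and g="\<lambda>p. \<lceil>snd p * real (Suc n)\<rceil>"])
      fix k :: int show "(\<lambda>p. fst p (real_of_int (k - 1) / real (Suc n))) \<in> borel_measurable (path_borel UNIV \<Otimes>\<^sub>M borel)"
        by (rule measurable_compose[OF measurable_fst measurable_path_eval]) simp
    qed measurable
  qed
  then show ?thesis by (simp add: case_prod_beta')
qed

lemma borel_measurable_path_at:
  assumes "f \<in> N \<rightarrow>\<^sub>M path_borel UNIV" "g \<in> borel_measurable N"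
  shows "(\<lambda>x. f x (g x)) \<in> borel_measurable N"
  using measurable_compose[OF measurable_Pair[OF assms] measurable_path_eval_pair] by simp

section \<open>Two-sided Wiener measure\<close>

abbreviation increment :: "(nat \<Rightarrow> real) \<Rightarrow> (real \<Rightarrow> real) \<Rightarrow> nat \<Rightarrow> real" where
  "increment t w i \<equiv> w (t (Suc i)) - w (t i)"

abbreviation gauss :: "real \<Rightarrow> real measure" where
  "gauss d \<equiv> density lborel (normal_density 0 (sqrt d))"

text \<open>For negative times, where an increment of the path is an increment of the reversed
  motion with the opposite sign.\<close>

lemma gauss_uminus:
  assumes A: "A \<in> sets borel"
  shows "measure (gauss d) (uminus -` A) = measure (gauss d) A"
proof -
  have A': "uminus -` A \<in> sets borel"
    using measurable_sets[OF borel_measurable_uminus[OF measurable_ident_sets[OF refl]] A] by simp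
  have "emeasure (gauss d) A = (\<integral>\<^sup>+x. ennreal (normal_density 0 (sqrt d) x) * indicator A x \<partial>distr lborel borel uminus)"
    using A by (simp add: emeasure_density lborel_distr_uminus)
  also have "\<dots> = (\<integral>\<^sup>+x. ennreal (normal_density 0 (sqrt d) (-x)) * indicator A (-x) \<partial>lborel)"
    using A by (subst nn_integral_distr) auto
  also have "\<dots> = emeasure (gauss d) (uminus -` A)"
    using A' by (subst emeasure_density) (auto simp: normal_density_def indicator_def intro!: nn_integral_cong)
  finally show ?thesis by (simp add: measure_def)
qed

lemma measure_gauss_UNIV: "0 < d \<Longrightarrow> measure (gauss d) UNIV = 1"
  using prob_space.prob_space[OF prob_space_normal_density[of "sqrt d" 0]] by simp

lemma brownian_increments:
  assumes "prob_space P" and X: "standard_brownian_motion P X"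
    and t: "0 \<le> t 0" "\<And>i. i < n \<Longrightarrow> t i < t (Suc i)" and A: "\<And>i. A i \<in> sets borel"
  shows "measure P {x \<in> space P. \<forall>i<n. X (t (Suc i)) x - X (t i) x \<in> A i} =
    (\<Prod>i<n. measure (gauss (t (Suc i) - t i)) (A i))"
proof (cases "n = 0")
  case True
  interpret prob_space P by fact
  show ?thesis using True by (simp add: prob_space)
next
  case False
  interpret prob_space P by fact
  have ge: "0 \<le> t i" if "i \<le> n" for i
    using that
  proof (induction i)
    case (Suc i) then show ?case using t(2)[of i] by auto
  qed (use t in simp)
  have ind: "indep_vars (\<lambda>_. borel) (\<lambda>i x. X (t (Suc i)) x - X (t i) x) {..<n}"
    using X t unfolding standard_brownian_motion_def by blast
  have "{x \<in> space P. \<forall>i<n. X (t (Suc i)) x - X (t i) x \<in> A i} =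
      (\<Inter>i\<in>{..<n}. (\<lambda>x. X (t (Suc i)) x - X (t i) x) -` A i \<inter> space P)" using False by auto
  then have "measure P {x \<in> space P. \<forall>i<n. X (t (Suc i)) x - X (t i) x \<in> A i} =
      (\<Prod>i<n. prob ((\<lambda>x. X (t (Suc i)) x - X (t i) x) -` A i \<inter> space P))"
    using indep_varsD_finite[OF ind, of A] False A by auto
  also have "\<dots> = (\<Prod>i<n. measure (gauss (t (Suc i) - t i)) (A i))"
  proof (rule prod.cong[OF refl])
    fix i assume "i \<in> {..<n}"
    then have "distributed P lborel (\<lambda>x. X (t (Suc i)) x - X (t i) x) (normal_density 0 (sqrt (t (Suc i) - t i)))"
      using X t ge[of i] unfolding standard_brownian_motion_def by auto
    then have m: "(\<lambda>x. X (t (Suc i)) x - X (t i) x) \<in> P \<rightarrow>\<^sub>M lborel"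
      and d: "distr P lborel (\<lambda>x. X (t (Suc i)) x - X (t i) x) = gauss (t (Suc i) - t i)"
      by (simp_all add: distributed_def)
    show "prob ((\<lambda>x. X (t (Suc i)) x - X (t i) x) -` A i \<inter> space P) = measure (gauss (t (Suc i) - t i)) (A i)"
      unfolding d[symmetric] by (rule measure_distr[symmetric]) (use m A in auto)
  qed
  finally show ?thesis .
qed

lemma prod_split_nat:
  fixes f :: "nat \<Rightarrow> real"
  assumes "m \<le> n" shows "(\<Prod>i<n. f i) = (\<Prod>i<m. f i) * (\<Prod>i<n-m. f (m + i))"
proof -
  have "(\<Prod>i<n. f i) = (\<Prod>i<m. f i) * (\<Prod>i=m..<n. f i)"
    using assms by (metis atLeast0LessThan le0 prod.atLeastLessThan_concat)
  also have "(\<Prod>i=m..<n. f i) = (\<Prod>i<n-m. f (m + i))"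
    using prod.shift_bounds_nat_ivl[of f 0 m "n - m"] assms by (simp add: atLeast0LessThan add.commute)
  finally show ?thesis .
qed

lemma less_mono_chain:
  fixes t :: "nat \<Rightarrow> real"
  assumes "\<And>i. i < n \<Longrightarrow> t i < t (Suc i)" "i \<le> j" "j \<le> n"
  shows "t i \<le> t j"
  using assms(2,3)
proof (induction j rule: dec_induct)
  case (step k) then show ?case using assms(1)[of k] by auto
qed simp

lemma increment_set_PiM:
  assumes s: "\<And>i. i \<le> n \<Longrightarrow> s i \<in> T" and A: "\<And>i. A i \<in> sets borel"
  shows "{x \<in> space (PiM T (\<lambda>_. borel)). \<forall>i<n. x (s (Suc i)) - x (s i) \<in> (A i :: real set)} \<in> sets (PiM T (\<lambda>_. borel))"
proof -
  have "{x \<in> space (PiM T (\<lambda>_. borel)). \<forall>i\<in>{..<n}. x (s (Suc i)) - x (s i) \<in> A i} \<in> sets (PiM T (\<lambda>_. borel))"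
  proof (rule sets.sets_Collect_finite_All)
    fix i assume "i \<in> {..<n}"
    then have [measurable]: "(\<lambda>x. x (s i)) \<in> borel_measurable (PiM T (\<lambda>_. borel))"
      "(\<lambda>x. x (s (Suc i))) \<in> borel_measurable (PiM T (\<lambda>_. borel))"
      using s by (auto intro!: measurable_component_singleton)
    have [measurable]: "A i \<in> sets borel" by (rule A)
    show "{x \<in> space (PiM T (\<lambda>_. borel)). x (s (Suc i)) - x (s i) \<in> A i} \<in> sets (PiM T (\<lambda>_. borel))"
      by measurable
  qed simp
  moreover have "(\<forall>i\<in>{..<n}. Q i) = (\<forall>i<n. Q i)" for Q :: "nat \<Rightarrow> bool" by auto
  ultimately show ?thesis by (simp only:)
qed

locale wiener_space = prob_space P for P :: "(real \<Rightarrow> real) measure" +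
  assumes space_P: "space P = paths UNIV"
    and sets_P: "sets P = sets (path_borel UNIV)"
    and forward: "standard_brownian_motion P (\<lambda>t w. w t)"
    and backward: "standard_brownian_motion P (\<lambda>t w. w (- t))"
    and sides_indep: "indep_var (PiM {0..} (\<lambda>_. borel)) (\<lambda>w. \<lambda>t\<in>{0..}. w t)
       (PiM {0..} (\<lambda>_. borel)) (\<lambda>w. \<lambda>t\<in>{0..}. w (- t))"

lemma two_sided_wiener_iff: "two_sided_wiener P \<longleftrightarrow> wiener_space P"
  by (auto simp: two_sided_wiener_def wiener_space_def wiener_space_axioms_def)

context wiener_space
begin

lemma measurable_eval_P [measurable]: "(\<lambda>w. w t) \<in> borel_measurable P"
  by (simp add: measurable_cong_sets[OF sets_P refl] measurable_path_eval)

lemma measurable_increment_set: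
  assumes "\<And>i. A i \<in> sets borel"
  shows "{w \<in> space P. \<forall>i<n. increment t w i \<in> A i} \<in> sets P"
  using assms by measurable

text \<open>The time 0 has to be among the times because the two independent motions meet there. The
  increments to its left are read off the reversed motion at the times \<open>s i\<close>, which run
  away from 0, with sign and order reversed.\<close>

lemma increment_law:
  assumes t: "\<And>i. i < n \<Longrightarrow> t i < t (Suc i)" and m: "m \<le> n" "t m = 0"
    and A: "\<And>i. A i \<in> sets borel"
  shows "prob {w \<in> space P. \<forall>i<n. increment t w i \<in> A i} =
    (\<Prod>i<n. measure (gauss (t (Suc i) - t i)) (A i))"
proof -
  define s where "s i = - t (m - i)" for i
  let ?B = "\<lambda>i. uminus -` A (m - Suc i)"
  have B: "?B i \<in> sets borel" for i
    using measurable_sets[OF borel_measurable_uminus[OF measurable_ident_sets[OF refl]] A] by simp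
  let ?R = "{x \<in> space (PiM {0..} (\<lambda>_. borel)). \<forall>i<n-m. x (t (m + Suc i)) - x (t (m + i)) \<in> A (m + i)}"
  let ?L = "{x \<in> space (PiM {0..} (\<lambda>_. borel)). \<forall>i<m. x (s (Suc i)) - x (s i) \<in> ?B i}"
  have tpos: "0 \<le> t (m + i)" if "i \<le> n - m" for i
    using less_mono_chain[where t=t and n=n, OF t, of m "m + i"] that m by auto
  have spos: "0 \<le> s i" if "i \<le> m" for i
    using less_mono_chain[where t=t and n=n, OF t, of "m - i" m] that m by (auto simp: s_def)
  have R: "?R \<in> sets (PiM {0..} (\<lambda>_. borel))"
    by (rule increment_set_PiM[of "n - m" "\<lambda>i. t (m + i)" "{0..}" "\<lambda>i. A (m + i)"]) (use tpos A in auto)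
  have L: "?L \<in> sets (PiM {0..} (\<lambda>_. borel))"
    by (rule increment_set_PiM[of m s "{0..}" ?B]) (use spos B in auto)
  have sm: "s (Suc i) = - t (m - Suc i)" "s i = - t (Suc (m - Suc i))" if "i < m" for i
    using that by (simp_all add: s_def Suc_diff_Suc)
  have tp: "0 \<le> t (m + i) \<and> 0 \<le> t (m + Suc i)" if "i < n - m" for i
    using tpos[of i] tpos[of "Suc i"] that by auto
  have sp: "0 \<le> s i \<and> 0 \<le> s (Suc i)" if "i < m" for i
    using spos[of i] spos[of "Suc i"] that by auto
  have Req: "(\<lambda>w. \<lambda>t\<in>{0..}. w t) -` ?R \<inter> space P =
      {w \<in> space P. \<forall>i<n-m. w (t (m + Suc i)) - w (t (m + i)) \<in> A (m + i)}"
    using tp by (simp add: space_PiM vimage_def Int_def conj_commute cong: conj_cong)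
  have Leq: "(\<lambda>w. \<lambda>t\<in>{0..}. w (-t)) -` ?L \<inter> space P =
      {w \<in> space P. \<forall>i<m. w (- s (Suc i)) - w (- s i) \<in> ?B i}"
    using sp by (simp add: space_PiM vimage_def Int_def conj_commute cong: conj_cong)
  have split: "{w \<in> space P. \<forall>i<n. increment t w i \<in> A i} =
      (\<lambda>w. (\<lambda>t\<in>{0..}. w t, \<lambda>t\<in>{0..}. w (-t))) -` (?R \<times> ?L) \<inter> space P" (is "?l = ?r")
  proof -
    have "(\<forall>i<n. increment t w i \<in> A i) \<longleftrightarrow>
      (\<forall>i<n-m. w (t (m + Suc i)) - w (t (m + i)) \<in> A (m + i)) \<and>
      (\<forall>i<m. w (- s (Suc i)) - w (- s i) \<in> ?B i)" for w :: "real \<Rightarrow> real"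
    proof -
      have "(\<forall>i<m. w (- s (Suc i)) - w (- s i) \<in> ?B i) \<longleftrightarrow> (\<forall>i<m. increment t w (m - Suc i) \<in> A (m - Suc i))"
        by (intro all_cong) (simp add: sm)
      also have "\<dots> \<longleftrightarrow> (\<forall>i<m. increment t w i \<in> A i)"
      proof (intro iffI allI impI)
        fix i assume *: "\<forall>i<m. increment t w (m - Suc i) \<in> A (m - Suc i)" and i: "i < m"
        show "increment t w i \<in> A i" using *[rule_format, of "m - Suc i"] i by (simp add: Suc_diff_Suc)
      qed simp
      finally have *: "(\<forall>i<m. w (- s (Suc i)) - w (- s i) \<in> ?B i) \<longleftrightarrow> (\<forall>i<m. increment t w i \<in> A i)" .
      have "(\<forall>i<n. increment t w i \<in> A i) \<longleftrightarrow> (\<forall>i<n-m. increment t w (m + i) \<in> A (m + i)) \<and> (\<forall>i<m. increment t w i \<in> A i)"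
      proof (intro iffI conjI allI impI)
        fix i assume *: "(\<forall>i<n-m. increment t w (m + i) \<in> A (m + i)) \<and> (\<forall>i<m. increment t w i \<in> A i)" and i: "i < n"
        show "increment t w i \<in> A i"
        proof (cases "i < m")
          case False then show ?thesis using *[THEN conjunct1, rule_format, of "i - m"] i by simp
        qed (use * in simp)
      qed (use m in auto)
      then show ?thesis unfolding * by simp
    qed
    then have "?l = ((\<lambda>w. \<lambda>t\<in>{0..}. w t) -` ?R \<inter> space P) \<inter> ((\<lambda>w. \<lambda>t\<in>{0..}. w (-t)) -` ?L \<inter> space P)"
      unfolding Req Leq by blast
    moreover have "(\<lambda>w. (f w, g w)) -` (X \<times> Y) \<inter> Z = (f -` X \<inter> Z) \<inter> (g -` Y \<inter> Z)" for f :: "(real \<Rightarrow> real) \<Rightarrow> real \<Rightarrow> real" and g :: "(real \<Rightarrow> real) \<Rightarrow> real \<Rightarrow> real" and X Y Z by blast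
    ultimately show ?thesis by (simp only:)
  qed
  have "prob ?l = prob ((\<lambda>w. \<lambda>t\<in>{0..}. w t) -` ?R \<inter> space P) * prob ((\<lambda>w. \<lambda>t\<in>{0..}. w (-t)) -` ?L \<inter> space P)"
    unfolding split by (rule indep_varD[OF sides_indep R L])
  also have "prob ((\<lambda>w. \<lambda>t\<in>{0..}. w t) -` ?R \<inter> space P) = (\<Prod>i<n-m. measure (gauss (t (Suc (m + i)) - t (m + i))) (A (m + i)))"
    unfolding Req
    using brownian_increments[OF prob_space_axioms forward, of "\<lambda>i. t (m + i)" "n - m" "\<lambda>i. A (m + i)"] t m A by simp
  also have "prob ((\<lambda>w. \<lambda>t\<in>{0..}. w (-t)) -` ?L \<inter> space P) = (\<Prod>i<m. measure (gauss (s (Suc i) - s i)) (?B i))"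
    unfolding Leq
    by (rule brownian_increments[OF prob_space_axioms backward]) (use spos[of 0] sm t m B in auto)
  also have "\<dots> = (\<Prod>i<m. measure (gauss (t (Suc (m - Suc i)) - t (m - Suc i))) (A (m - Suc i)))"
    by (intro prod.cong refl) (use A in \<open>simp add: sm gauss_uminus\<close>)
  also have "\<dots> = (\<Prod>i<m. measure (gauss (t (Suc i) - t i)) (A i))"
    by (rule prod.nat_diff_reindex)
  finally show ?thesis using prod_split_nat[OF m(1)] by (simp add: mult.commute)
qed

end

section \<open>Invariance of Wiener measure under shift, reflection and concatenation\<close>

lemma increasing_enumeration:
  assumes "finite J" "J \<noteq> {}"
  obtains n :: nat and t :: "nat \<Rightarrow> real" where "\<And>i. i < n \<Longrightarrow> t i < t (Suc i)" "J = t ` {..n}"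
proof -
  let ?xs = "sorted_list_of_set J"
  have l: "length ?xs > 0" using assms by (simp add: card_gt_0_iff)
  show thesis
  proof (rule that[of "length ?xs - 1" "(!) ?xs"])
    fix i assume "i < length ?xs - 1"
    then show "?xs ! i < ?xs ! Suc i"
      using strict_sorted_list_of_set[of J] by (auto simp: sorted_wrt_iff_nth_less)
  next
    show "J = (!) ?xs ` {..length ?xs - 1}"
    proof -
      have "{..length ?xs - 1} = {..<length ?xs}" using l by auto
      moreover have "set ?xs = (!) ?xs ` {..<length ?xs}" by (auto simp: set_conv_nth)
      ultimately show ?thesis using assms by simp
    qed
  qed
qed

text \<open>Any finite set of times can be enlarged by \<open>R\<close> before it is sorted, so it
  is enough to compare increments along chains through \<open>R\<close>; critical times of a
  transformation may thus be assumed to be members of the chain. Values of the path are recovered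
  from the increments because paths vanish at 0.\<close>

lemma increment_law_unique:
  assumes P: "prob_space P" "sets P = sets (path_borel UNIV)"
    and Q: "prob_space Q" "sets Q = sets (path_borel UNIV)"
    and R: "finite R" "0 \<in> R"
    and eq: "\<And>n t A. (\<And>i. i < n \<Longrightarrow> t i < t (Suc i)) \<Longrightarrow> R \<subseteq> t ` {..n} \<Longrightarrow> (\<And>i. A i \<in> sets borel) \<Longrightarrow>
      measure P {w \<in> paths UNIV. \<forall>i<n. increment t w i \<in> A i} = measure Q {w \<in> paths UNIV. \<forall>i<n. increment t w i \<in> A i}"
  shows "P = Q"
proof (rule path_measure_eqI[OF P Q(2)])
  interpret P: prob_space P by fact
  interpret Q: prob_space Q by fact
  have sp: "space P = paths UNIV" "space Q = paths UNIV"
    using sets_eq_imp_space_eq[OF P(2)] sets_eq_imp_space_eq[OF Q(2)] by auto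
  fix K :: "(real \<times> real) set" assume K: "finite K"
  have "finite (fst ` K \<union> R)" "fst ` K \<union> R \<noteq> {}" using K R by auto
  then obtain n t where t: "\<And>i. i < n \<Longrightarrow> t i < t (Suc i)" "fst ` K \<union> R = t ` {..n}"
    using increasing_enumeration by metis
  define idx where "idx u = (SOME i. i \<le> n \<and> t i = u)" for u
  have idx: "idx u \<le> n \<and> t (idx u) = u" if "u \<in> fst ` K \<union> R" for u
    unfolding idx_def by (rule someI_ex) (use that t(2) in auto)
  let ?M = "PiM {..<n} (\<lambda>_. borel :: real measure)"
  let ?X = "\<lambda>w. \<lambda>i\<in>{..<n}. increment t w i"
  have X: "?X \<in> P \<rightarrow>\<^sub>M ?M" "?X \<in> Q \<rightarrow>\<^sub>M ?M"
  proof -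
    have "?X \<in> path_borel UNIV \<rightarrow>\<^sub>M ?M"
      by (intro measurable_restrict borel_measurable_diff measurable_path_eval) auto
    then show "?X \<in> P \<rightarrow>\<^sub>M ?M" "?X \<in> Q \<rightarrow>\<^sub>M ?M"
      by (simp_all add: measurable_cong_sets[OF P(2) refl] measurable_cong_sets[OF Q(2) refl])
  qed
  have "distr P ?M ?X = distr Q ?M ?X"
  proof (rule measure_eqI_PiM_finite[where A="\<lambda>_. space ?M"])
    fix A :: "nat \<Rightarrow> real set" assume A: "\<And>i. i \<in> {..<n} \<Longrightarrow> A i \<in> sets borel"
    define B where "B i = (if i < n then A i else UNIV)" for i
    have B: "B i \<in> sets borel" for i using A by (auto simp: B_def)
    have "?X -` (PiE {..<n} A) \<inter> paths UNIV = {w \<in> paths UNIV. \<forall>i<n. increment t w i \<in> B i}"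
    proof -
      have *: "restrict f {..<n} \<in> PiE {..<n} A \<longleftrightarrow> (\<forall>i<n. f i \<in> B i)" for f
        by (simp add: restrict_PiE_iff B_def Pi_iff Ball_def)
      show ?thesis unfolding vimage_def Int_def mem_Collect_eq * by (rule Collect_cong) (rule conj_commute)
    qed
    moreover have "PiE {..<n} A \<in> sets ?M" using A by (intro sets_PiM_I_finite) auto
    moreover have "R \<subseteq> t ` {..n}" using t(2) by blast
    ultimately show "emeasure (distr P ?M ?X) (PiE {..<n} A) = emeasure (distr Q ?M ?X) (PiE {..<n} A)"
      using X eq[where t=t and n=n and A=B, OF t(1) _ B] by (simp add: emeasure_distr sp P.emeasure_eq_measure Q.emeasure_eq_measure)
  next
    fix i :: nat
    have "prob_space (distr P ?M ?X)" by (rule P.prob_space_distr[OF X(1)])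
    then show "emeasure (distr P ?M ?X) (space ?M) \<noteq> \<infinity>"
      using prob_space.emeasure_space_1 by fastforce
  next
    have "space ?M \<in> prod_algebra {..<n} (\<lambda>_. borel)"
      unfolding space_PiM by (rule prod_algebraI_finite) auto
    then show "range (\<lambda>_. space ?M) \<subseteq> prod_algebra {..<n} (\<lambda>_. borel)" by auto
  qed auto
  \<comment> \<open>Both partial sums are counted from the leftmost time; their difference is the
    increment from 0 to \<open>fst p\<close>, that is, the value at \<open>fst p\<close>.\<close>
  moreover define Y where "Y = {x \<in> space ?M. \<forall>p\<in>K. (\<Sum>i<idx (fst p). x i) - (\<Sum>i<idx 0. x i) \<le> snd p}"
  have Y: "Y \<in> sets ?M"
    unfolding Y_def
  proof (rule sets.sets_Collect_finite_All[OF _ K])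
    fix p assume p: "p \<in> K"
    have [measurable]: "(\<lambda>x. x i) \<in> borel_measurable ?M" if "i < idx u" "u \<in> fst ` K \<union> R" for i u
      by (rule measurable_component_singleton) (use idx[of u] that in auto)
    have [measurable]: "(\<lambda>x. \<Sum>i<idx u. x i) \<in> borel_measurable ?M" if "u \<in> fst ` K \<union> R" for u
      by (rule borel_measurable_sum) (use that in auto)
    have [measurable]: "(\<lambda>x. \<Sum>i<idx (fst p). x i) \<in> borel_measurable ?M" "(\<lambda>x. \<Sum>i<idx 0. x i) \<in> borel_measurable ?M"
      using p R by auto
    show "{x \<in> space ?M. (\<Sum>i<idx (fst p). x i) - (\<Sum>i<idx 0. x i) \<le> snd p} \<in> sets ?M" by measurable
  qed
  have "path_cyl K = ?X -` Y \<inter> paths UNIV"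
  proof -
    have "(\<Sum>i<idx u. ?X w i) - (\<Sum>i<idx 0. ?X w i) = w u" if "u \<in> fst ` K" "w \<in> paths UNIV" for u w
    proof -
      have 1: "(\<Sum>i<idx v. ?X w i) = w v - w (t 0)" if v: "v \<in> fst ` K \<union> R" for v
      proof -
        have "(\<Sum>i<idx v. ?X w i) = (\<Sum>i<idx v. increment t w i)"
          by (rule sum.cong) (use idx[OF v] in auto)
        also have "\<dots> = w v - w (t 0)"
          using sum_lessThan_telescope[of "\<lambda>i. w (t i)" "idx v"] idx[OF v] by simp
        finally show ?thesis .
      qed
      show ?thesis using 1[of u] 1[of 0] that R by (auto simp: paths_UNIV_iff)
    qed
    then have "(\<forall>p\<in>K. (\<Sum>i<idx (fst p). ?X w i) - (\<Sum>i<idx 0. ?X w i) \<le> snd p) \<longleftrightarrow> (\<forall>p\<in>K. w (fst p) \<le> snd p)" if "w \<in> paths UNIV" for w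
      by (intro ball_cong refl) (use that in \<open>simp only: imageI\<close>)
    moreover have "?X w \<in> space ?M" for w by (simp add: space_PiM)
    ultimately have "?X w \<in> Y \<longleftrightarrow> (\<forall>p\<in>K. w (fst p) \<le> snd p)" if "w \<in> paths UNIV" for w
      unfolding Y_def mem_Collect_eq using that by (simp only: simp_thms)
    note * = this
    show ?thesis
    proof (rule set_eqI)
      fix w
      show "w \<in> path_cyl K \<longleftrightarrow> w \<in> ?X -` Y \<inter> paths UNIV"
        using *[of w] by (cases "w \<in> paths UNIV") (simp_all add: case_prod_beta')
    qed
  qed
  ultimately show "emeasure P (path_cyl K) = emeasure Q (path_cyl K)"
    using emeasure_distr[OF X(1) Y] emeasure_distr[OF X(2) Y] by (simp add: sp)
qed

lemma clip_paths:
  assumes "w \<in> paths UNIV" "continuous_on UNIV \<phi>" "\<phi> 0 = 0"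
  shows "(\<lambda>t. w (\<phi> t)) \<in> paths UNIV"
  using assms continuous_on_compose2[of UNIV w UNIV \<phi>] unfolding paths_UNIV_iff by simp

lemma levy_shift_paths:
  assumes "w \<in> paths UNIV" shows "levy_shift u w \<in> paths UNIV"
proof -
  have "continuous_on UNIV (\<lambda>t. w (u + t))"
    by (rule continuous_on_compose2[of UNIV w]) (use assms in \<open>auto simp: paths_UNIV_iff intro: continuous_intros\<close>)
  then show ?thesis unfolding paths_UNIV_iff levy_shift_def by (simp add: continuous_on_diff)
qed

lemma time_refl_paths: "w \<in> paths UNIV \<Longrightarrow> time_refl w \<in> paths UNIV"
  unfolding time_refl_def by (rule clip_paths) (auto intro: continuous_intros)

lemma levy_shift_levy_shift: "levy_shift u (levy_shift v w) = levy_shift (v + u) w"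
  by (simp add: levy_shift_def add.assoc)

lemma levy_shift_time_refl: "levy_shift u (time_refl w) = time_refl (levy_shift (-u) w)"
proof
  fix t
  have "- (u + t) = - u + - t" by simp
  then show "levy_shift u (time_refl w) t = time_refl (levy_shift (-u) w) t"
    by (simp only: levy_shift_def time_refl_def)
qed

lemma time_refl_time_refl [simp]: "time_refl (time_refl w) = w"
  by (simp add: time_refl_def)

text \<open>The path \<open>w\<close> up to time s, continued with the increments of
  \<open>v\<close>. With \<open>v\<close> an independent copy this realises the conditional law
  given the path up to s.\<close>

definition concat_path :: "real \<Rightarrow> (real \<Rightarrow> real) \<Rightarrow> (real \<Rightarrow> real) \<Rightarrow> real \<Rightarrow> real" where
  "concat_path s w v = (\<lambda>t. w (min t s) + (v (max t s) - v s))"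

lemma concat_path_paths:
  assumes "w \<in> paths UNIV" "v \<in> paths UNIV" "0 \<le> s"
  shows "concat_path s w v \<in> paths UNIV"
proof -
  have "continuous_on UNIV (\<lambda>t. w (min t s))" "continuous_on UNIV (\<lambda>t. v (max t s))"
    by (rule continuous_on_compose2[of UNIV w], use assms in \<open>auto simp: paths_UNIV_iff intro: continuous_intros\<close>)
      (rule continuous_on_compose2[of UNIV v], use assms in \<open>auto simp: paths_UNIV_iff intro: continuous_intros\<close>)
  then show ?thesis using assms unfolding paths_UNIV_iff concat_path_def
    by (simp add: continuous_on_add continuous_on_diff)
qed

lemma uminus_vimage_borel:
  fixes A :: "real set"
  assumes "A \<in> sets borel" shows "uminus -` A \<in> sets borel"
  using measurable_sets[OF borel_measurable_uminus[OF measurable_ident_sets[OF refl]] assms] by simp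

context wiener_space
begin

lemma measurable_pathI:
  assumes "\<And>x. x \<in> space N \<Longrightarrow> f x \<in> paths UNIV" "\<And>t. (\<lambda>x. f x t) \<in> borel_measurable N"
  shows "f \<in> N \<rightarrow>\<^sub>M P"
  unfolding measurable_cong_sets[OF refl sets_P]
  by (rule measurable_path_borelI[OF closed_UNIV assms(1) assms(2)])

lemma measurable_levy_shift: "levy_shift u \<in> P \<rightarrow>\<^sub>M P"
proof (rule measurable_pathI)
  show "(\<lambda>w. levy_shift u w t) \<in> borel_measurable P" for t
    unfolding levy_shift_def by (intro borel_measurable_diff measurable_eval_P)
qed (simp add: space_P levy_shift_paths)

lemma measurable_time_refl: "time_refl \<in> P \<rightarrow>\<^sub>M P"
proof (rule measurable_pathI)
  show "(\<lambda>w. time_refl w t) \<in> borel_measurable P" for t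
    unfolding time_refl_def by (rule measurable_eval_P)
qed (simp add: space_P time_refl_paths)

lemma measurable_concat_path:
  assumes "0 \<le> s" shows "(\<lambda>(w, v). concat_path s w v) \<in> P \<Otimes>\<^sub>M P \<rightarrow>\<^sub>M P"
proof (rule measurable_pathI)
  show "(\<lambda>p. (case p of (w, v) \<Rightarrow> concat_path s w v) t) \<in> borel_measurable (P \<Otimes>\<^sub>M P)" for t
    unfolding concat_path_def case_prod_beta
    by (intro borel_measurable_diff borel_measurable_add measurable_compose[OF measurable_fst measurable_eval_P]
        measurable_compose[OF measurable_snd measurable_eval_P])
qed (use assms in \<open>simp add: space_P concat_path_paths space_pair_measure mem_Times_iff split_beta\<close>)

lemma increment_law':
  assumes t: "\<And>i. i < n \<Longrightarrow> t i < t (Suc i)" and m: "0 \<in> t ` {..n}"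
    and A: "\<And>i. A i \<in> sets borel"
  shows "prob {w \<in> paths UNIV. \<forall>i<n. increment t w i \<in> A i} =
    (\<Prod>i<n. measure (gauss (t (Suc i) - t i)) (A i))"
proof -
  obtain m where "m \<le> n" "t m = 0" using m by auto
  from increment_law[where t=t and n=n and A=A, OF t this A] show ?thesis by (simp add: space_P)
qed

lemma path_cyl_incr_sets:
  assumes "\<And>i. A i \<in> sets borel"
  shows "{w \<in> paths UNIV. \<forall>i<n. increment t w i \<in> A i} \<in> sets P"
  by (rule measurable_increment_set[unfolded space_P, OF assms])

lemma distr_levy_shift: "distr P P (levy_shift s) = P"
proof (rule sym, rule increment_law_unique[OF prob_space_axioms sets_P])
  show "prob_space (distr P P (levy_shift s))" by (rule prob_space_distr[OF measurable_levy_shift])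
  show "sets (distr P P (levy_shift s)) = sets (path_borel UNIV)" by (simp add: sets_P)
  \<comment> \<open>The shift moves the time -s to 0, so with both in the chain the increment law
    applies before and after shifting.\<close>
  show "finite {0, -s}" "0 \<in> {0, -s}" by auto
  fix n and t :: "nat \<Rightarrow> real" and A :: "nat \<Rightarrow> real set"
  assume t: "\<And>i. i < n \<Longrightarrow> t i < t (Suc i)" and R: "{0, -s} \<subseteq> t ` {..n}" and A: "\<And>i. A i \<in> sets borel"
  let ?t = "\<lambda>i. s + t i"
  have "0 \<in> ?t ` {..n}" using R by force
  from increment_law'[of n ?t A, OF _ this A] t
  have 1: "prob {w \<in> paths UNIV. \<forall>i<n. increment ?t w i \<in> A i} = (\<Prod>i<n. measure (gauss (t (Suc i) - t i)) (A i))"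
    by simp
  have 2: "prob {w \<in> paths UNIV. \<forall>i<n. increment t w i \<in> A i} = (\<Prod>i<n. measure (gauss (t (Suc i) - t i)) (A i))"
    by (rule increment_law') (use t R A in auto)
  have "levy_shift s -` {w \<in> paths UNIV. \<forall>i<n. increment t w i \<in> A i} \<inter> space P = {w \<in> paths UNIV. \<forall>i<n. increment ?t w i \<in> A i}"
    by (auto simp: space_P levy_shift_paths) (simp_all add: levy_shift_def)
  with measure_distr[OF measurable_levy_shift path_cyl_incr_sets[of A n t, OF A]]
  show "prob {w \<in> paths UNIV. \<forall>i<n. increment t w i \<in> A i} =
      measure (distr P P (levy_shift s)) {w \<in> paths UNIV. \<forall>i<n. increment t w i \<in> A i}"
    using 1 2 by (simp only:)
qed

lemma distr_time_refl: "distr P P time_refl = P"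
proof (rule sym, rule increment_law_unique[OF prob_space_axioms sets_P])
  show "prob_space (distr P P time_refl)" by (rule prob_space_distr[OF measurable_time_refl])
  show "sets (distr P P time_refl) = sets (path_borel UNIV)" by (simp add: sets_P)
  show "finite {0::real}" "0 \<in> {0::real}" by auto
  fix n and t :: "nat \<Rightarrow> real" and A :: "nat \<Rightarrow> real set"
  assume t: "\<And>i. i < n \<Longrightarrow> t i < t (Suc i)" and R: "{0} \<subseteq> t ` {..n}" and A: "\<And>i. A i \<in> sets borel"
  \<comment> \<open>Reflection reverses the order of the times and the sign of each increment; the
    symmetry of the normal law absorbs the sign.\<close>
  let ?t = "\<lambda>i. - t (n - i)"
  let ?A = "\<lambda>i. uminus -` A (n - Suc i)"
  have B: "?A i \<in> sets borel" for i
    by (rule uminus_vimage_borel[OF A])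
  have "0 \<in> t ` {..n}" using R by simp
  then obtain m where m: "m \<le> n" "t m = 0" by (elim imageE) simp
  have "0 \<in> ?t ` {..n}" using m by (intro image_eqI[of _ _ "n - m"]) auto
  moreover have "?t i < ?t (Suc i)" if "i < n" for i
    using t[of "n - Suc i"] that by (simp add: Suc_diff_Suc)
  ultimately have "prob {w \<in> paths UNIV. \<forall>i<n. increment ?t w i \<in> ?A i} = (\<Prod>i<n. measure (gauss (?t (Suc i) - ?t i)) (?A i))"
    by (intro increment_law' B) auto
  also have "\<dots> = (\<Prod>i<n. measure (gauss (t (Suc (n - Suc i)) - t (n - Suc i))) (A (n - Suc i)))"
    using A by (intro prod.cong refl) (simp add: gauss_uminus Suc_diff_Suc)
  also have "\<dots> = (\<Prod>i<n. measure (gauss (t (Suc i) - t i)) (A i))"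
    by (rule prod.nat_diff_reindex)
  finally have 1: "prob {w \<in> paths UNIV. \<forall>i<n. increment ?t w i \<in> ?A i} = \<dots>" .
  have 2: "prob {w \<in> paths UNIV. \<forall>i<n. increment t w i \<in> A i} = (\<Prod>i<n. measure (gauss (t (Suc i) - t i)) (A i))"
    by (rule increment_law') (use t R A in auto)
  have "(\<forall>i<n. increment ?t w i \<in> ?A i) \<longleftrightarrow> (\<forall>i<n. increment t (time_refl w) i \<in> A i)" for w
  proof -
    have "(\<forall>i<n. increment ?t w i \<in> ?A i) \<longleftrightarrow> (\<forall>i<n. increment t (time_refl w) (n - Suc i) \<in> A (n - Suc i))"
      by (intro all_cong) (simp add: time_refl_def Suc_diff_Suc)
    also have "\<dots> \<longleftrightarrow> (\<forall>i<n. increment t (time_refl w) i \<in> A i)"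
    proof (intro iffI allI impI)
      fix i assume *: "\<forall>i<n. increment t (time_refl w) (n - Suc i) \<in> A (n - Suc i)" and i: "i < n"
      show "increment t (time_refl w) i \<in> A i" using *[rule_format, of "n - Suc i"] i by (simp add: Suc_diff_Suc)
    qed simp
    finally show ?thesis .
  qed
  then have "time_refl -` {w \<in> paths UNIV. \<forall>i<n. increment t w i \<in> A i} \<inter> space P = {w \<in> paths UNIV. \<forall>i<n. increment ?t w i \<in> ?A i}"
    by (auto simp: space_P time_refl_paths)
  with measure_distr[OF measurable_time_refl path_cyl_incr_sets[of A n t, OF A]]
  show "prob {w \<in> paths UNIV. \<forall>i<n. increment t w i \<in> A i} =
      measure (distr P P time_refl) {w \<in> paths UNIV. \<forall>i<n. increment t w i \<in> A i}"
    using 1 2 by (simp only:)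
qed

text \<open>With s among the times no increment straddles it: those before s come from
  \<open>w\<close>, those after s from \<open>v\<close>, and the event becomes a rectangle.
  \<open>B\<close> and \<open>C\<close> carry \<open>UNIV\<close> where the other path is
  responsible, which contributes a factor 1.\<close>

lemma distr_concat_path:
  assumes s: "0 \<le> s"
  shows "distr (P \<Otimes>\<^sub>M P) P (\<lambda>(w, v). concat_path s w v) = P"
proof (rule sym, rule increment_law_unique[OF prob_space_axioms sets_P])
  interpret PP: pair_prob_space P P ..
  show "prob_space (distr (P \<Otimes>\<^sub>M P) P (\<lambda>(w, v). concat_path s w v))"
    by (rule PP.prob_space_distr[OF measurable_concat_path[OF s]])
  show "sets (distr (P \<Otimes>\<^sub>M P) P (\<lambda>(w, v). concat_path s w v)) = sets (path_borel UNIV)" by (simp add: sets_P)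
  show "finite {0, s}" "0 \<in> {0, s}" by auto
  fix n and t :: "nat \<Rightarrow> real" and A :: "nat \<Rightarrow> real set"
  assume t: "\<And>i. i < n \<Longrightarrow> t i < t (Suc i)" and R: "{0, s} \<subseteq> t ` {..n}" and A: "\<And>i. A i \<in> sets borel"
  obtain q where q: "q \<le> n" "t q = s" using R by force
  define B where "B i = (if i < q then A i else UNIV)" for i
  define C where "C i = (if i < q then UNIV else A i)" for i
  have BC: "B i \<in> sets borel" "C i \<in> sets borel" for i using A by (auto simp: B_def C_def)
  let ?E = "\<lambda>A. {w \<in> paths UNIV. \<forall>i<n. increment t w i \<in> A i}"
  have law: "prob (?E A) = (\<Prod>i<n. measure (gauss (t (Suc i) - t i)) (A i))" if "\<And>i. A i \<in> sets borel" for A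
    by (rule increment_law') (use t R that in auto)
  have "increment t (concat_path s w v) i = (if i < q then increment t w i else increment t v i)" if i: "i < n" for w v i
  proof (cases "i < q")
    case True
    then have "t (Suc i) \<le> s" "t i \<le> s"
      using less_mono_chain[where t=t and n=n, OF t, of "Suc i" q] less_mono_chain[where t=t and n=n, OF t, of i q] q by auto
    then show ?thesis using True by (simp add: concat_path_def min_absorb1 max_absorb2)
  next
    case False
    then have "s \<le> t (Suc i)" "s \<le> t i"
      using less_mono_chain[where t=t and n=n, OF t, of q "Suc i"] less_mono_chain[where t=t and n=n, OF t, of q i] q i by auto
    then show ?thesis using False by (simp add: concat_path_def min_absorb2 max_absorb1)
  qed
  then have "(\<forall>i<n. increment t (concat_path s w v) i \<in> A i) \<longleftrightarrow> (\<forall>i<n. increment t w i \<in> B i) \<and> (\<forall>i<n. increment t v i \<in> C i)" for w v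
    by (auto simp: B_def C_def)
  then have "(\<lambda>(w, v). concat_path s w v) -` ?E A \<inter> space (P \<Otimes>\<^sub>M P) = ?E B \<times> ?E C"
  proof (intro set_eqI)
    fix p assume e: "\<And>w v. (\<forall>i<n. increment t (concat_path s w v) i \<in> A i) \<longleftrightarrow> (\<forall>i<n. increment t w i \<in> B i) \<and> (\<forall>i<n. increment t v i \<in> C i)"
    show "p \<in> (\<lambda>(w, v). concat_path s w v) -` ?E A \<inter> space (P \<Otimes>\<^sub>M P) \<longleftrightarrow> p \<in> ?E B \<times> ?E C"
      using s by (cases p) (simp add: space_P space_pair_measure concat_path_paths e conj_ac cong: conj_cong)
  qed
  then have "measure (distr (P \<Otimes>\<^sub>M P) P (\<lambda>(w, v). concat_path s w v)) (?E A) = measure (P \<Otimes>\<^sub>M P) (?E B \<times> ?E C)"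
    using measure_distr[OF measurable_concat_path[OF s] path_cyl_incr_sets[of A n t, OF A]] by (simp only:)
  also have "\<dots> = prob (?E B) * prob (?E C)"
    using emeasure_pair_measure_Times[OF path_cyl_incr_sets[of B n t, OF BC(1)] path_cyl_incr_sets[of C n t, OF BC(2)]]
    by (simp only: measure_def enn2real_mult)
  also have "\<dots> = (\<Prod>i<n. measure (gauss (t (Suc i) - t i)) (B i) * measure (gauss (t (Suc i) - t i)) (C i))"
    unfolding law[OF BC(1)] law[OF BC(2)] prod.distrib ..
  also have "\<dots> = (\<Prod>i<n. measure (gauss (t (Suc i) - t i)) (A i))"
    by (rule prod.cong) (use t in \<open>auto simp: B_def C_def measure_gauss_UNIV\<close>)
  also have "\<dots> = prob (?E A)" using law[OF A] ..
  finally show "prob (?E A) = measure (distr (P \<Otimes>\<^sub>M P) P (\<lambda>(w, v). concat_path s w v)) (?E A)" ..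
qed

end

section \<open>The increment fields\<close>

text \<open>Preimages of null sets are null because the measure is preserved, so measurability
  survives completion.\<close>

lemma measurable_completion_preserving:
  assumes f: "f \<in> P \<rightarrow>\<^sub>M P" and d: "distr P P f = P"
  shows "f \<in> completion P \<rightarrow>\<^sub>M completion P"
proof (rule completion.measurable_completion2[OF measurable_completion[OF f]])
  show "null_sets P \<subseteq> null_sets (distr (completion P) P f)" unfolding distr_completion[OF f] d ..
qed

lemma AE_completion_preserving:
  assumes f: "f \<in> P \<rightarrow>\<^sub>M P" and d: "distr P P f = P" and Q: "AE x in completion P. Q x"
  shows "AE x in completion P. Q (f x)"
proof -
  have "AE x in distr P P f. Q x" using Q unfolding d AE_completion_iff .
  then have "AE x in P. Q (f x)" by (rule AE_distrD[OF f])
  then show ?thesis by (rule AE_completion)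
qed

lemma distr_completion_preserving:
  assumes f: "f \<in> P \<rightarrow>\<^sub>M P" and d: "distr P P f = P"
  shows "distr (completion P) (completion P) f = completion P"
proof -
  have "distr (completion P) P f = P" using distr_completion[OF f] d by simp
  then show ?thesis using completion.completion_distr_eq[of f P P] measurable_completion[OF f] by simp
qed

lemma sets_incr_field:
  "sets (incr_field W s t) = sigma_sets (space W)
     ({(\<lambda>w. w v - w u) -` A \<inter> space W | u v A.
         s \<le> ereal u \<and> u \<le> v \<and> ereal v \<le> t \<and> A \<in> sets borel} \<union>
      {A \<in> sets W. emeasure W A = 0 \<or> emeasure W A = 1})"
  unfolding incr_field_def by (rule sets_measure_of) (auto dest: sets.sets_into_space)

lemma space_incr_field [simp]: "space (incr_field W s t) = space W"
  by (simp add: incr_field_def space_measure_of_conv)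

lemma incr_field_mono:
  assumes "s' \<le> s" "t \<le> t'"
  shows "sets (incr_field W s t) \<subseteq> sets (incr_field W s' t')"
  unfolding sets_incr_field
  by (rule sigma_sets_mono') (use assms in \<open>blast intro: order_trans\<close>)

lemma incr_field_trivial:
  assumes "A \<in> sets W" "emeasure W A = 0 \<or> emeasure W A = 1"
  shows "A \<in> sets (incr_field W s t)"
  unfolding sets_incr_field by (rule sigma_sets.Basic) (use assms in blast)

lemma measurable_incr_field_increment:
  assumes "s \<le> ereal u" "ereal u \<le> t" "s \<le> ereal v" "ereal v \<le> t"
  shows "(\<lambda>w. w v - w u) \<in> borel_measurable (incr_field W s t)"
proof -
  have *: "(\<lambda>w. w b - w a) \<in> borel_measurable (incr_field W s t)" if ab: "a \<le> b" "s \<le> ereal a" "ereal b \<le> t" for a b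
  proof (rule measurableI)
    fix A :: "real set" assume "A \<in> sets borel"
    then show "(\<lambda>w. w b - w a) -` A \<inter> space (incr_field W s t) \<in> sets (incr_field W s t)"
      unfolding sets_incr_field space_incr_field by (intro sigma_sets.Basic) (use ab in blast)
  qed simp
  show ?thesis
  proof (cases "u \<le> v")
    case True then show ?thesis using assms by (intro *) auto
  next
    case False
    then have "(\<lambda>w. - (w u - w v)) \<in> borel_measurable (incr_field W s t)"
      using assms by (intro borel_measurable_uminus *) auto
    then show ?thesis by simp
  qed
qed

section \<open>Events of the past and of the future of a fixed time\<close>

context wiener_space
begin

abbreviation W :: "(real \<Rightarrow> real) measure" where "W \<equiv> completion P"

lemma space_W: "space W = paths UNIV"
  by (simp add: space_P)

lemma prob_space_W: "prob_space W"
  by (rule prob_space_completion)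

lemma measurable_eval_W [measurable]: "(\<lambda>w. w t) \<in> borel_measurable W"
  by (rule measurable_completion[OF measurable_eval_P])

lemma levy_shift_W [measurable]: "levy_shift s \<in> W \<rightarrow>\<^sub>M W"
  by (rule measurable_completion_preserving[OF measurable_levy_shift distr_levy_shift])

lemma time_refl_W [measurable]: "time_refl \<in> W \<rightarrow>\<^sub>M W"
  by (rule measurable_completion_preserving[OF measurable_time_refl distr_time_refl])

lemma AE_levy_shift: "AE w in W. Q w \<Longrightarrow> AE w in W. Q (levy_shift s w)"
  by (rule AE_completion_preserving[OF measurable_levy_shift distr_levy_shift])

lemma AE_time_refl: "AE w in W. Q w \<Longrightarrow> AE w in W. Q (time_refl w)"
  by (rule AE_completion_preserving[OF measurable_time_refl distr_time_refl])

lemma emeasure_levy_shift: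
  assumes "A \<in> sets W" shows "emeasure W (levy_shift s -` A \<inter> space W) = emeasure W A"
  using emeasure_distr[OF levy_shift_W[of s] assms] distr_completion_preserving[OF measurable_levy_shift distr_levy_shift] by simp

lemma emeasure_time_refl:
  assumes "A \<in> sets W" shows "emeasure W (time_refl -` A \<inter> space W) = emeasure W A"
  using emeasure_distr[OF time_refl_W assms] distr_completion_preserving[OF measurable_time_refl distr_time_refl] by simp

lemma sets_incr_field_subset: "sets (incr_field W s t) \<subseteq> sets W"
proof -
  have "(\<lambda>w. w v - w u) -` A \<inter> space W \<in> sets W" if "A \<in> sets borel" for u v and A :: "real set"
    by (rule measurable_sets[OF borel_measurable_diff[OF measurable_eval_W measurable_eval_W] that])
  then show ?thesis unfolding sets_incr_field by (intro sets.sigma_sets_subset) blast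
qed

lemma incr_field_measurableD: "f \<in> incr_field W s t \<rightarrow>\<^sub>M N \<Longrightarrow> f \<in> W \<rightarrow>\<^sub>M N"
  by (rule measurable_from_subalg[OF subalgebra_def[THEN iffD2]]) (simp_all add: sets_incr_field_subset)

lemma incr_field_measurable_mono:
  "f \<in> incr_field W s t \<rightarrow>\<^sub>M N \<Longrightarrow> s' \<le> s \<Longrightarrow> t \<le> t' \<Longrightarrow> f \<in> incr_field W s' t' \<rightarrow>\<^sub>M N"
  by (rule measurable_from_subalg[OF subalgebra_def[THEN iffD2]]) (simp_all add: incr_field_mono)

text \<open>Null events belong to every increment field, hence so does each modification of a member
  on a null set; completeness makes the modification measurable in the first place.\<close>

lemma incr_field_AE_sets:
  assumes A: "A \<in> sets (incr_field W s t)" and B: "B \<subseteq> space W" and ae: "AE w in W. w \<in> A \<longleftrightarrow> w \<in> B"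
  shows "B \<in> sets (incr_field W s t)"
proof -
  have AW: "A \<in> sets W" using A sets_incr_field_subset by blast
  have BW: "B \<in> sets W" by (rule completion.in_sets_AE[OF ae AW B])
  have "B - A \<in> sets (incr_field W s t)" "A - B \<in> sets (incr_field W s t)"
  proof (safe intro!: incr_field_trivial)
    show "B - A \<in> sets W" "A - B \<in> sets W" using AW BW by auto
    have "AE w in W. w \<notin> B - A" "AE w in W. w \<notin> A - B"
      using ae by (eventually_elim, blast)+
    then have "B - A \<in> null_sets W" "A - B \<in> null_sets W"
      using AE_iff_null_sets[of "B - A" W] AE_iff_null_sets[of "A - B" W] AW BW by blast+
    then have "emeasure W (B - A) = 0" "emeasure W (A - B) = 0" using null_setsD1 by blast+
    then show "emeasure W (B - A) \<noteq> 1 \<Longrightarrow> emeasure W (B - A) = 0" "emeasure W (A - B) \<noteq> 1 \<Longrightarrow> emeasure W (A - B) = 0" by simp_all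
  qed
  then have "(A \<union> (B - A)) - (A - B) \<in> sets (incr_field W s t)" using A by blast
  moreover have "(A \<union> (B - A)) - (A - B) = B" by blast
  ultimately show ?thesis by simp
qed

text \<open>Induction over the generated field. An increment within [a, b] does not notice a change
  of time \<phi> that fixes [a, b], and a generator of probability 0 or 1 is replaced by the empty
  set or the whole space. Invariance under \<phi> expresses that the representative looks at the
  path only at times attained by \<phi>; clipping at s or at 0 is the case of interest.\<close>

lemma incr_field_representative:
  assumes A: "A \<in> sets (incr_field W a b)"
    and \<phi>: "\<And>u. a \<le> ereal u \<Longrightarrow> ereal u \<le> b \<Longrightarrow> \<phi> u = u" "continuous_on UNIV \<phi>" "\<phi> 0 = 0"
  shows "\<exists>A'\<in>sets P. (AE w in W. w \<in> A \<longleftrightarrow> w \<in> A') \<and> (\<forall>w\<in>paths UNIV. (\<lambda>t. w (\<phi> t)) \<in> A' \<longleftrightarrow> w \<in> A')"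
  using A unfolding sets_incr_field
proof (induction rule: sigma_sets.induct)
  case (Basic A)
  then show ?case
  proof
    assume "A \<in> {(\<lambda>w. w v - w u) -` A \<inter> space W | u v A. a \<le> ereal u \<and> u \<le> v \<and> ereal v \<le> b \<and> A \<in> sets borel}"
    then obtain u v X where A: "A = (\<lambda>w. w v - w u) -` X \<inter> space W" "a \<le> ereal u" "u \<le> v" "ereal v \<le> b" "X \<in> sets borel" by blast
    have "a \<le> ereal v" "ereal u \<le> b" using A(2-4) by (meson ereal_less_eq(3) order_trans)+
    then have uv: "\<phi> u = u" "\<phi> v = v" using \<phi>(1) A by auto
    have "A \<in> sets P"
      using measurable_sets[OF borel_measurable_diff[OF measurable_eval_P measurable_eval_P] A(5), of v u] unfolding A(1) by simp
    moreover have "(\<lambda>t. w (\<phi> t)) \<in> A \<longleftrightarrow> w \<in> A" if "w \<in> paths UNIV" for w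
      using that uv clip_paths[OF that \<phi>(2,3)] unfolding A(1) space_W by simp
    ultimately show ?case by (intro bexI[of _ A]) auto
  next
    assume "A \<in> {A \<in> sets W. emeasure W A = 0 \<or> emeasure W A = 1}"
    then have A: "A \<in> sets W" and d: "emeasure W A = 0 \<or> emeasure W A = 1" by auto
    interpret W: prob_space W by (rule prob_space_W)
    from d show ?case
    proof
      assume "emeasure W A = 0"
      then have "AE w in W. w \<notin> A" using A by (intro AE_not_in) (auto simp: null_sets_def)
      then show ?case by (intro bexI[of _ "{}"]) auto
    next
      assume "emeasure W A = 1"
      then have "AE w in W. w \<in> A" using A by (simp add: W.prob_eq_1 W.emeasure_eq_measure)
      with AE_space[of W] have "AE w in W. w \<in> A \<longleftrightarrow> w \<in> space P" by eventually_elim simp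
      moreover have "\<forall>w\<in>paths UNIV. (\<lambda>t. w (\<phi> t)) \<in> space P \<longleftrightarrow> w \<in> space P"
        unfolding space_P using clip_paths[OF _ \<phi>(2,3)] by blast
      ultimately show ?case by (intro bexI[of _ "space P"] conjI sets.top)
    qed
  qed
next
  case Empty then show ?case by (intro bexI[of _ "{}"]) auto
next
  case (Compl A)
  then obtain A' where A': "A' \<in> sets P" "AE w in W. w \<in> A \<longleftrightarrow> w \<in> A'" "\<forall>w\<in>paths UNIV. (\<lambda>t. w (\<phi> t)) \<in> A' \<longleftrightarrow> w \<in> A'" by blast
  have "AE w in W. w \<in> space W - A \<longleftrightarrow> w \<in> space P - A'" using A'(2) by eventually_elim (simp add: space_P)
  moreover have "\<forall>w\<in>paths UNIV. (\<lambda>t. w (\<phi> t)) \<in> space P - A' \<longleftrightarrow> w \<in> space P - A'"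
    unfolding space_P using clip_paths[OF _ \<phi>(2,3)] A'(3) by blast
  ultimately show ?case by (intro bexI[of _ "space P - A'"] conjI sets.compl_sets A'(1))
next
  case (Union A)
  then have "\<forall>i. \<exists>A'. A' \<in> sets P \<and> (AE w in W. w \<in> A i \<longleftrightarrow> w \<in> A') \<and> (\<forall>w\<in>paths UNIV. (\<lambda>t. w (\<phi> t)) \<in> A' \<longleftrightarrow> w \<in> A')" by blast
  from choice[OF this] obtain A' where A'0: "\<forall>i. A' i \<in> sets P \<and> (AE w in W. w \<in> A i \<longleftrightarrow> w \<in> A' i) \<and> (\<forall>w\<in>paths UNIV. (\<lambda>t. w (\<phi> t)) \<in> A' i \<longleftrightarrow> w \<in> A' i)" ..
  have A': "\<And>i. A' i \<in> sets P" "\<And>i. AE w in W. w \<in> A i \<longleftrightarrow> w \<in> A' i"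
    "\<And>i. \<forall>w\<in>paths UNIV. (\<lambda>t. w (\<phi> t)) \<in> A' i \<longleftrightarrow> w \<in> A' i" using A'0 by blast+
  have "AE w in W. \<forall>i. w \<in> A i \<longleftrightarrow> w \<in> A' i" unfolding AE_all_countable using A'(2) by blast
  then have "AE w in W. w \<in> (\<Union>i. A i) \<longleftrightarrow> w \<in> (\<Union>i. A' i)" by eventually_elim simp
  moreover have "\<forall>w\<in>paths UNIV. (\<lambda>t. w (\<phi> t)) \<in> (\<Union>i. A' i) \<longleftrightarrow> w \<in> (\<Union>i. A' i)"
    using A'(3) by blast
  moreover have "(\<Union>i. A' i) \<in> sets P" using A'(1) by blast
  ultimately show ?case by (intro bexI[of _ "\<Union>i. A' i"] conjI)
qed

lemma min_clip:
  assumes "0 \<le> s"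
  shows "continuous_on UNIV (\<lambda>t::real. min t s)" "min 0 s = 0"
  using assms by (simp_all add: continuous_on_min continuous_on_id continuous_on_const)

lemma max_clip: "continuous_on UNIV (\<lambda>t::real. max t 0)"
  by (simp add: continuous_on_max continuous_on_id continuous_on_const)

text \<open>Clipping at s forgets what comes after s, and gluing at s leaves the clipped path
  unchanged, so the representative cannot see the second path.\<close>

lemma past_representative:
  assumes "A \<in> sets (incr_field W (-\<infinity>) (ereal s))" "0 \<le> s"
  obtains A' where "A' \<in> sets P" "AE w in W. w \<in> A \<longleftrightarrow> w \<in> A'"
    "\<And>w v. w \<in> paths UNIV \<Longrightarrow> v \<in> paths UNIV \<Longrightarrow> concat_path s w v \<in> A' \<longleftrightarrow> w \<in> A'"
proof -
  obtain A' where A': "A' \<in> sets P" "AE w in W. w \<in> A \<longleftrightarrow> w \<in> A'" "\<forall>w\<in>paths UNIV. (\<lambda>t. w (min t s)) \<in> A' \<longleftrightarrow> w \<in> A'"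
    using incr_field_representative[OF assms(1), of "\<lambda>t. min t s"] min_clip[OF assms(2)] by auto
  have "concat_path s w v \<in> A' \<longleftrightarrow> w \<in> A'" if "w \<in> paths UNIV" "v \<in> paths UNIV" for w v
  proof -
    have "(\<lambda>t. concat_path s w v (min t s)) = (\<lambda>t. w (min t s))" by (simp add: concat_path_def)
    then show ?thesis using A'(3) that concat_path_paths[OF that assms(2)] by metis
  qed
  then show thesis using A' that by blast
qed

text \<open>Replace the path by two independent copies glued at s. The representative of
  \<open>A\<close> then depends on the first copy alone, that of the shifted \<open>B\<close> on the
  second alone, and the event becomes a rectangle.\<close>

lemma independent_increments:
  assumes A: "A \<in> sets (incr_field W (-\<infinity>) (ereal s))" and s: "0 \<le> s"
    and B: "B \<in> sets (incr_field W 0 \<infinity>)"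
  shows "emeasure W (A \<inter> (levy_shift s -` B \<inter> space W)) = emeasure W A * emeasure W B"
proof -
  obtain A' where A': "A' \<in> sets P" "AE w in W. w \<in> A \<longleftrightarrow> w \<in> A'"
    "\<And>w v. w \<in> paths UNIV \<Longrightarrow> v \<in> paths UNIV \<Longrightarrow> concat_path s w v \<in> A' \<longleftrightarrow> w \<in> A'"
    using past_representative[OF A s] by blast
  obtain B' where B': "B' \<in> sets P" "AE w in W. w \<in> B \<longleftrightarrow> w \<in> B'" "\<forall>w\<in>paths UNIV. (\<lambda>t. w (max t 0)) \<in> B' \<longleftrightarrow> w \<in> B'"
    using incr_field_representative[OF B, of "\<lambda>t. max t 0"] max_clip by (auto simp: zero_ereal_def)
  have AW: "A \<in> sets W" and BW: "B \<in> sets W" using A B sets_incr_field_subset by blast+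
  have conB: "levy_shift s (concat_path s w v) \<in> B' \<longleftrightarrow> levy_shift s v \<in> B'" if "w \<in> paths UNIV" "v \<in> paths UNIV" for w v
  proof -
    have "(\<lambda>t. levy_shift s (concat_path s w v) (max t 0)) = (\<lambda>t. levy_shift s v (max t 0))"
      by (rule ext) (simp add: concat_path_def levy_shift_def min_absorb2 max_absorb1)
    then show ?thesis using B'(3) levy_shift_paths[OF concat_path_paths[OF that s]] levy_shift_paths[OF that(2)] by metis
  qed
  let ?C = "\<lambda>(w, v). concat_path s w v"
  let ?D = "levy_shift s -` B' \<inter> space P"
  have D: "?D \<in> sets P" by (rule measurable_sets[OF measurable_levy_shift B'(1)])
  have "AE w in W. levy_shift s w \<in> B \<longleftrightarrow> levy_shift s w \<in> B'" by (rule AE_levy_shift[OF B'(2)])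
  then have "AE w in W. w \<in> A \<inter> (levy_shift s -` B \<inter> space W) \<longleftrightarrow> w \<in> A' \<inter> ?D"
    using A'(2) by eventually_elim simp
  then have "emeasure W (A \<inter> (levy_shift s -` B \<inter> space W)) = emeasure W (A' \<inter> ?D)"
    by (rule emeasure_eq_AE) (use AW measurable_sets[OF levy_shift_W BW] A'(1) D in auto)
  also have "\<dots> = emeasure P (A' \<inter> ?D)" using A'(1) D by simp
  also have "\<dots> = emeasure (distr (P \<Otimes>\<^sub>M P) P ?C) (A' \<inter> ?D)" unfolding distr_concat_path[OF s] ..
  also have "\<dots> = emeasure (P \<Otimes>\<^sub>M P) (?C -` (A' \<inter> ?D) \<inter> space (P \<Otimes>\<^sub>M P))"
    by (rule emeasure_distr[OF measurable_concat_path[OF s]]) (use A'(1) D in auto)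
  also have "?C -` (A' \<inter> ?D) \<inter> space (P \<Otimes>\<^sub>M P) = A' \<times> ?D"
    using A'(3) conB concat_path_paths[OF _ _ s] sets.sets_into_space[OF A'(1)] by (auto simp: space_pair_measure space_P)
  also have "emeasure (P \<Otimes>\<^sub>M P) (A' \<times> ?D) = emeasure P A' * emeasure P ?D"
    by (rule emeasure_pair_measure_Times[OF A'(1) D])
  also have "emeasure P A' = emeasure W A'" using A'(1) by simp
  also have "emeasure W A' = emeasure W A" by (rule emeasure_eq_AE) (use A' AW in \<open>auto elim: eventually_mono\<close>)
  also have "emeasure P ?D = emeasure (distr P P (levy_shift s)) B'" by (rule emeasure_distr[symmetric, OF measurable_levy_shift B'(1)])
  also have "\<dots> = emeasure W B'" using B'(1) by (simp add: distr_levy_shift)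
  also have "emeasure W B' = emeasure W B" by (rule emeasure_eq_AE) (use B' BW in \<open>auto elim: eventually_mono\<close>)
  finally show ?thesis .
qed

lemma measurable_clip:
  assumes \<phi>: "continuous_on UNIV \<phi>" "\<phi> 0 = 0" "\<And>t. a \<le> ereal (\<phi> t) \<and> ereal (\<phi> t) \<le> b"
  shows "(\<lambda>w t. w (\<phi> t)) \<in> incr_field W a b \<rightarrow>\<^sub>M path_borel UNIV"
proof (rule measurable_path_borelI)
  show "(\<lambda>t. w (\<phi> t)) \<in> paths UNIV" if "w \<in> space (incr_field W a b)" for w
    using clip_paths[OF _ \<phi>(1,2)] that by (simp add: space_P)
  fix t
  have "(\<lambda>w. w (\<phi> t) - w 0) \<in> borel_measurable (incr_field W a b)"
    using \<phi>(3)[of t] \<phi>(3)[of 0] \<phi>(2) by (intro measurable_incr_field_increment) auto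
  then show "(\<lambda>w. w (\<phi> t)) \<in> borel_measurable (incr_field W a b)"
    by (rule measurable_cong[THEN iffD1, rotated]) (auto simp: space_P paths_UNIV_iff)
qed simp

lemma measurable_stopped:
  "0 \<le> s \<Longrightarrow> stopped s \<in> incr_field W (-\<infinity>) (ereal s) \<rightarrow>\<^sub>M path_borel UNIV"
  unfolding stopped_def[abs_def] by (rule measurable_clip[OF min_clip]) simp_all

lemma measurable_future_clip:
  "(\<lambda>w t. w (max t 0)) \<in> incr_field W 0 \<infinity> \<rightarrow>\<^sub>M path_borel UNIV"
  by (rule measurable_clip[OF max_clip]) (simp_all add: zero_ereal_def)

lemma measurable_time_refl_incr_field:
  "time_refl \<in> incr_field W s t \<rightarrow>\<^sub>M incr_field W (-t) (-s)"
proof -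
  have *: "time_refl -` A \<inter> space W \<in> sets (incr_field W s t)" if A: "A \<in> sets (incr_field W (-t) (-s))" for A
    using A unfolding sets_incr_field[of _ "-t" "-s"]
  proof (induction rule: sigma_sets.induct)
    case (Basic A)
    then show ?case
    proof
      assume "A \<in> {(\<lambda>w. w v - w u) -` A \<inter> space W | u v A. -t \<le> ereal u \<and> u \<le> v \<and> ereal v \<le> -s \<and> A \<in> sets borel}"
      then obtain u v X where A: "A = (\<lambda>w. w v - w u) -` X \<inter> space W" "-t \<le> ereal u" "u \<le> v" "ereal v \<le> -s" "X \<in> sets borel" by blast
      have uv: "s \<le> ereal (-v)" "ereal (-u) \<le> t" using A(2,4) by (metis ereal_minus_le_minus ereal_uminus_uminus uminus_ereal.simps(1))+
      have "ereal (-v) \<le> ereal (-u)" using A(3) by simp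
      then have "s \<le> ereal (-u)" "ereal (-v) \<le> t" using uv by (meson order_trans)+
      then have "(\<lambda>w. w (-v) - w (-u)) -` X \<inter> space W \<in> sets (incr_field W s t)"
        using measurable_sets[OF measurable_incr_field_increment A(5), of s "-u" t "-v" W] uv by simp
      moreover have "time_refl -` A \<inter> space W = (\<lambda>w. w (-v) - w (-u)) -` X \<inter> space W"
        unfolding A(1) using time_refl_paths by (auto simp: space_P time_refl_def)
      ultimately show ?case by (simp only:)
    next
      assume "A \<in> {A \<in> sets W. emeasure W A = 0 \<or> emeasure W A = 1}"
      then have A: "A \<in> sets W" "emeasure W A = 0 \<or> emeasure W A = 1" by blast+
      show ?case
        by (rule incr_field_trivial[OF measurable_sets[OF time_refl_W A(1)]]) (use A(2) emeasure_time_refl[OF A(1)] in \<open>simp only:\<close>)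
    qed
  next
    case Empty then show ?case by simp
  next
    case (Compl A)
    have "time_refl -` (space W - A) \<inter> space W = space (incr_field W s t) - (time_refl -` A \<inter> space W)"
      using time_refl_paths by (auto simp: space_P)
    then show ?case using Compl.IH by (simp only: sets.compl_sets)
  next
    case (Union A)
    have "time_refl -` (\<Union>i. A i) \<inter> space W = (\<Union>i. time_refl -` A i \<inter> space W)" by blast
    then show ?case using Union.IH by (simp only: sets.countable_nat_UN image_subset_iff) blast
  qed
  show ?thesis by (rule measurableI) (use * time_refl_paths in \<open>auto simp: space_P\<close>)
qed

text \<open>An everywhere defined version of the conditional expectation of \<open>g\<close> given the path up to time \<open>s\<close>.\<close>

definition past_mean :: "real \<Rightarrow> ((real \<Rightarrow> real) \<Rightarrow> real) \<Rightarrow> (real \<Rightarrow> real) \<Rightarrow> real" where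
  "past_mean s g w = (\<integral>v. g (concat_path s w v) \<partial>P)"

lemma measurable_concat_path_snd:
  assumes "0 \<le> s" "w \<in> paths UNIV" shows "concat_path s w \<in> P \<rightarrow>\<^sub>M P"
proof -
  have "w \<in> space P" using assms(2) by (simp only: space_P)
  from measurable_compose[OF measurable_Pair1'[OF this] measurable_concat_path[OF assms(1)]]
  show ?thesis by (simp only: prod.case)
qed

lemma measurable_past_mean_P:
  assumes g: "g \<in> borel_measurable P" and s: "0 \<le> s"
  shows "past_mean s g \<in> borel_measurable P"
proof -
  have "(\<lambda>p. g (case p of (w, v) \<Rightarrow> concat_path s w v)) \<in> borel_measurable (P \<Otimes>\<^sub>M P)"
    by (rule measurable_compose[OF measurable_concat_path[OF s] g])
  then have "(\<lambda>(w, v). g (concat_path s w v)) \<in> borel_measurable (P \<Otimes>\<^sub>M P)" by (simp only: split_def)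
  then show ?thesis unfolding past_mean_def[abs_def] by (rule borel_measurable_lebesgue_integral)
qed

text \<open>The glued path uses \<open>w\<close> only before s, so the integral factors through the
  stopped path.\<close>

lemma measurable_past_mean:
  assumes g: "g \<in> borel_measurable P" and s: "0 \<le> s"
  shows "past_mean s g \<in> borel_measurable (incr_field W (-\<infinity>) (ereal s))"
proof -
  have "past_mean s g \<in> borel_measurable (path_borel UNIV)"
    using measurable_past_mean_P[OF g s] unfolding measurable_cong_sets[OF sets_P refl] .
  from measurable_compose[OF measurable_stopped[OF s] this]
  have "(\<lambda>w. past_mean s g (stopped s w)) \<in> borel_measurable (incr_field W (-\<infinity>) (ereal s))" .
  moreover have "concat_path s (stopped s w) v = concat_path s w v" for w v
    by (simp add: concat_path_def stopped_def)
  ultimately show ?thesis by (simp add: past_mean_def[abs_def])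
qed

lemma past_mean_bounds:
  assumes g: "g \<in> borel_measurable P" "\<And>w. 0 \<le> g w \<and> g w \<le> 1" and s: "0 \<le> s" "w \<in> paths UNIV"
  shows "0 \<le> past_mean s g w \<and> past_mean s g w \<le> 1"
proof
  have "integrable P (\<lambda>v. g (concat_path s w v))"
    by (rule integrable_const_bound[where B=1])
      (use g(2) measurable_compose[OF measurable_concat_path_snd[OF s] g(1)] in auto)
  then show "past_mean s g w \<le> 1"
    unfolding past_mean_def by (rule integral_le_const) (use g(2) in auto)
  show "0 \<le> past_mean s g w" unfolding past_mean_def by (rule integral_nonneg_AE) (use g(2) in auto)
qed

text \<open>The defining property of a conditional expectation. The glued path has law
  \<open>P\<close>, and the representative of \<open>A\<close> is decided by its first component, so
  Fubini takes the indicator out of the inner integral.\<close>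

lemma integral_past_mean:
  assumes A: "A \<in> sets (incr_field W (-\<infinity>) (ereal s))" and s: "0 \<le> s"
    and g: "g \<in> borel_measurable P" "\<And>w. 0 \<le> g w \<and> g w \<le> 1"
  shows "(\<integral>w. indicator A w * g w \<partial>W) = (\<integral>w. indicator A w * past_mean s g w \<partial>W)"
proof -
  interpret PP: pair_prob_space P P ..
  obtain A' where A': "A' \<in> sets P" "AE w in W. w \<in> A \<longleftrightarrow> w \<in> A'"
    "\<And>w v. w \<in> paths UNIV \<Longrightarrow> v \<in> paths UNIV \<Longrightarrow> concat_path s w v \<in> A' \<longleftrightarrow> w \<in> A'"
    using past_representative[OF A s] by blast
  have AW: "A \<in> sets W" using A sets_incr_field_subset by blast
  have *: "(\<integral>w. indicator A w * f w \<partial>W) = (\<integral>w. indicator A' w * f w \<partial>P)" if f: "f \<in> borel_measurable P" for f :: "(real \<Rightarrow> real) \<Rightarrow> real"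
  proof -
    have "(\<integral>w. indicator A w * f w \<partial>W) = (\<integral>w. indicator A' w * f w \<partial>W)"
    proof (rule integral_cong_AE)
      show "AE w in W. indicator A w * f w = indicator A' w * f w"
        using A'(2) by eventually_elim (simp add: indicator_def)
      show "(\<lambda>w. indicator A w * f w) \<in> borel_measurable W"
        by (intro borel_measurable_times borel_measurable_indicator measurable_completion[OF f] AW)
      show "(\<lambda>w. indicator A' w * f w) \<in> borel_measurable W"
        by (intro borel_measurable_times borel_measurable_indicator measurable_completion[OF f] sets_completionI_sets[OF A'(1)])
    qed
    also have "\<dots> = (\<integral>w. indicator A' w * f w \<partial>P)"
      by (rule integral_completion) (use A'(1) f in \<open>auto intro!: borel_measurable_times borel_measurable_indicator\<close>)
    finally show ?thesis .
  qed
  have f: "(\<lambda>w. indicator A' w * g w) \<in> borel_measurable P"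
    using A'(1) g(1) by (intro borel_measurable_times borel_measurable_indicator)
  let ?C = "\<lambda>p. case p of (w, v) \<Rightarrow> concat_path s w v"
  have "(\<integral>w. indicator A' w * g w \<partial>P) = (\<integral>w. indicator A' w * g w \<partial>distr (P \<Otimes>\<^sub>M P) P ?C)"
    unfolding distr_concat_path[OF s] ..
  also have "\<dots> = (\<integral>p. indicator A' (?C p) * g (?C p) \<partial>(P \<Otimes>\<^sub>M P))"
    by (rule integral_distr[OF measurable_concat_path[OF s] f])
  also have "\<dots> = (\<integral>w. (\<integral>v. indicator A' (concat_path s w v) * g (concat_path s w v) \<partial>P) \<partial>P)"
  proof -
    have "integrable (P \<Otimes>\<^sub>M P) (\<lambda>p. indicator A' (?C p) * g (?C p))"
      by (rule PP.integrable_const_bound[where B=1])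
        (use g(2) measurable_compose[OF measurable_concat_path[OF s] f] in \<open>auto simp: indicator_def\<close>)
    from PP.integral_fst'[OF this] show ?thesis by simp
  qed
  also have "\<dots> = (\<integral>w. indicator A' w * past_mean s g w \<partial>P)"
  proof (rule Bochner_Integration.integral_cong[OF refl])
    fix w assume w: "w \<in> space P"
    have "(\<integral>v. indicator A' (concat_path s w v) * g (concat_path s w v) \<partial>P) = (\<integral>v. indicator A' w * g (concat_path s w v) \<partial>P)"
      by (rule Bochner_Integration.integral_cong[OF refl]) (use A'(3) w in \<open>auto simp: space_P indicator_def\<close>)
    then show "(\<integral>v. indicator A' (concat_path s w v) * g (concat_path s w v) \<partial>P) = indicator A' w * past_mean s g w"
      by (simp add: past_mean_def)
  qed
  finally show ?thesis using *[OF g(1)] *[OF measurable_past_mean_P[OF g(1) s]] by simp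
qed

end

section \<open>Continuity of Brownian martingales\<close>

text \<open>Bounded convergence for the indicators. All bad events below are shown to vanish in this
  way.\<close>

lemma (in finite_measure) measure_eventually_notin:
  assumes A: "\<And>n. A n \<in> sets M" and ae: "AE x in M. \<forall>\<^sub>F n in sequentially. x \<notin> A n"
  shows "(\<lambda>n. measure M (A n)) \<longlonglongrightarrow> 0"
proof -
  have "(\<lambda>n. \<integral>x. indicat_real (A n) x \<partial>M) \<longlonglongrightarrow> (\<integral>x. 0 \<partial>M)"
  proof (rule integral_dominated_convergence[where w="\<lambda>_. 1"])
    show "AE x in M. (\<lambda>n. indicat_real (A n) x) \<longlonglongrightarrow> 0"
      using ae
    proof eventually_elim
      case (elim x)
      then have "\<forall>\<^sub>F n in sequentially. indicat_real (A n) x = 0" by (rule eventually_mono) simp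
      then show ?case by (rule tendsto_eventually)
    qed
    show "indicat_real (A n) \<in> borel_measurable M" for n by (rule borel_measurable_indicator[OF A])
    show "AE x in M. norm (indicat_real (A n) x) \<le> 1" for n by (simp add: indicator_def)
  qed simp_all
  then show ?thesis using A by simp
qed

lemma AE_all_imp:
  fixes Q :: "'i::countable \<Rightarrow> bool"
  assumes "\<And>i. Q i \<Longrightarrow> AE x in M. R i x" shows "AE x in M. \<forall>i. Q i \<longrightarrow> R i x"
proof -
  have "AE x in M. Q i \<longrightarrow> R i x" for i using assms[of i] by (cases "Q i") auto
  then show ?thesis unfolding AE_all_countable by blast
qed

lemma inverse_power_tendsto: "(\<lambda>n. 1 / 2^n :: real) \<longlonglongrightarrow> 0"
  using LIMSEQ_power_zero[of "1/2::real"] by (simp add: power_one_over)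

context wiener_space
begin

text \<open>Continuity in the gluing time makes conditional means continuous in time at every path,
  without an exceptional set. The range [0, 1] permits bounded convergence and comparison with
  indicators.\<close>

definition splice_continuous :: "((real \<Rightarrow> real) \<Rightarrow> real) \<Rightarrow> bool" where
  "splice_continuous g \<longleftrightarrow> g \<in> borel_measurable P \<and> (\<forall>w. 0 \<le> g w \<and> g w \<le> 1) \<and>
     (\<forall>w\<in>paths UNIV. \<forall>v\<in>paths UNIV. continuous_on {0..} (\<lambda>s. g (concat_path s w v)))"

lemma splice_continuousD:
  assumes "splice_continuous g"
  shows "g \<in> borel_measurable P" "0 \<le> g w" "g w \<le> 1"
    "w \<in> paths UNIV \<Longrightarrow> v \<in> paths UNIV \<Longrightarrow> continuous_on {0..} (\<lambda>s. g (concat_path s w v))"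
  using assms unfolding splice_continuous_def by blast+

lemma splice_continuous_abs_diff_le:
  assumes "splice_continuous g" shows "norm \<bar>indicator A w - g w\<bar> \<le> 1"
  using splice_continuousD(2,3)[OF assms, of w] by (cases "w \<in> A") simp_all

lemma continuous_on_concat_path:
  assumes "w \<in> paths UNIV" "v \<in> paths UNIV"
  shows "continuous_on S (\<lambda>s. concat_path s w v t)"
proof -
  have w: "continuous_on UNIV w" and v: "continuous_on UNIV v" using assms by (simp_all add: paths_UNIV_iff)
  have "continuous_on S (\<lambda>s. w (min t s))"
    by (rule continuous_on_compose2[OF w]) (simp_all add: continuous_on_min continuous_on_const continuous_on_id)
  moreover have "continuous_on S (\<lambda>s. v (max t s))"
    by (rule continuous_on_compose2[OF v]) (simp_all add: continuous_on_max continuous_on_const continuous_on_id)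
  moreover have "continuous_on S v" by (rule continuous_on_subset[OF v]) simp
  ultimately show ?thesis unfolding concat_path_def by (intro continuous_on_add continuous_on_diff)
qed

lemma past_mean_continuous:
  assumes g: "splice_continuous g" and w: "w \<in> paths UNIV"
  shows "continuous_on {0..} (\<lambda>s. past_mean s g w)"
  unfolding continuous_on_sequentially
proof (intro allI ballI impI)
  fix x :: "nat \<Rightarrow> real" and a assume a: "a \<in> {0..}" and x: "(\<forall>n. x n \<in> {0..}) \<and> x \<longlonglongrightarrow> a"
  have "(\<lambda>n. \<integral>v. g (concat_path (x n) w v) \<partial>P) \<longlonglongrightarrow> (\<integral>v. g (concat_path a w v) \<partial>P)"
  proof (rule integral_dominated_convergence[where w="\<lambda>_. 1"])
    show "AE v in P. (\<lambda>n. g (concat_path (x n) w v)) \<longlonglongrightarrow> g (concat_path a w v)"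
    proof (rule AE_I2)
      fix v assume "v \<in> space P"
      then have "continuous_on {0..} (\<lambda>s. g (concat_path s w v))"
        using splice_continuousD(4)[OF g w] by (simp add: space_P)
      then show "(\<lambda>n. g (concat_path (x n) w v)) \<longlonglongrightarrow> g (concat_path a w v)"
        unfolding continuous_on_sequentially comp_def using a x by blast
    qed
    show "(\<lambda>v. g (concat_path (x n) w v)) \<in> borel_measurable P" for n
      by (rule measurable_compose[OF measurable_concat_path_snd splice_continuousD(1)[OF g]]) (use x w in auto)
    show "(\<lambda>v. g (concat_path a w v)) \<in> borel_measurable P"
      by (rule measurable_compose[OF measurable_concat_path_snd splice_continuousD(1)[OF g]]) (use a w in auto)
    show "AE v in P. norm (g (concat_path (x n) w v)) \<le> 1" for n
      using splice_continuousD(2,3)[OF g] by simp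
  qed simp
  then show "((\<lambda>s. past_mean s g w) \<circ> x) \<longlonglongrightarrow> past_mean a g w" by (simp add: comp_def past_mean_def)
qed

text \<open>The threshold 1/4 is the gap between the levels 3/4 and 1/2: if no larger step occurs, a
  conditional mean above 3/4 at the end of a cell was above 1/2 at its start.\<close>

definition large_steps :: "((real \<Rightarrow> real) \<Rightarrow> real) \<Rightarrow> nat \<Rightarrow> nat \<Rightarrow> (real \<Rightarrow> real) set" where
  "large_steps g b n = {w \<in> space W. \<exists>k<b * 2^n.
     \<bar>past_mean (real (Suc k) / 2^n) g w - past_mean (real k / 2^n) g w\<bar> > 1/4}"

lemma large_steps_sets:
  assumes "splice_continuous g" shows "large_steps g b n \<in> sets W"
proof -
  have m: "past_mean (real k / 2^n) g \<in> borel_measurable W" for k :: nat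
    by (rule measurable_completion[OF measurable_past_mean_P[OF splice_continuousD(1)[OF assms]]]) simp
  let ?Q = "\<lambda>k w. \<bar>past_mean (real (Suc k) / 2^n) g w - past_mean (real k / 2^n) g w\<bar> > 1/4"
  have "{w \<in> space W. \<exists>k\<in>{..<b * 2^n}. ?Q k w} \<in> sets W"
  proof (rule sets.sets_Collect_finite_Ex)
    fix k :: nat
    have [measurable]: "past_mean (real k / 2^n) g \<in> borel_measurable W" "past_mean (real (Suc k) / 2^n) g \<in> borel_measurable W"
      by (rule m)+
    show "{w \<in> space W. ?Q k w} \<in> sets W" by measurable
  qed simp
  then show ?thesis unfolding large_steps_def by (simp only: Bex_def lessThan_iff)
qed

text \<open>Along each path the conditional mean is uniformly continuous on [0, b], so large steps
  disappear once the mesh is fine.\<close>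

lemma large_steps_tendsto:
  assumes g: "splice_continuous g"
  shows "(\<lambda>n. measure W (large_steps g b n)) \<longlonglongrightarrow> 0"
proof -
  interpret W: prob_space W by (rule prob_space_W)
  show ?thesis
  proof (rule W.measure_eventually_notin[OF large_steps_sets[OF g]], rule AE_I2)
    fix w assume "w \<in> space W"
    then have "continuous_on {0..real b} (\<lambda>s. past_mean s g w)"
      by (intro continuous_on_subset[OF past_mean_continuous[OF g]]) (auto simp: space_P)
    then have "uniformly_continuous_on {0..real b} (\<lambda>s. past_mean s g w)"
      by (intro compact_uniformly_continuous) auto
    then obtain d where d: "0 < d" "\<And>s t. s \<in> {0..real b} \<Longrightarrow> t \<in> {0..real b} \<Longrightarrow> dist t s < d \<Longrightarrow> dist (past_mean t g w) (past_mean s g w) < 1/4"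
      unfolding uniformly_continuous_on_def by (metis zero_less_divide_1_iff zero_less_numeral)
    have "\<forall>\<^sub>F n in sequentially. 1 / 2^n < d" by (rule order_tendstoD(2)[OF inverse_power_tendsto d(1)])
    then show "\<forall>\<^sub>F n in sequentially. w \<notin> large_steps g b n"
    proof (rule eventually_mono)
      fix n :: nat assume n: "1 / 2^n < d"
      have "\<bar>past_mean (real (Suc k) / 2^n) g w - past_mean (real k / 2^n) g w\<bar> < 1/4" if k: "k < b * 2^n" for k
      proof -
        have "real (Suc k) \<le> real (b * 2^n)" using k by (simp only: of_nat_le_iff Suc_le_eq)
        then have le: "real (Suc k) / 2^n \<le> real b" by (simp add: divide_le_eq)
        moreover have "real k / 2^n \<le> real (Suc k) / 2^n" by (rule divide_right_mono) auto
        ultimately have "real k / 2^n \<in> {0..real b}" "real (Suc k) / 2^n \<in> {0..real b}" by auto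
        moreover have "real (Suc k) / 2^n - real k / 2^n = 1 / 2^n" by (simp add: field_simps)
        ultimately show ?thesis using d(2)[of "real k / 2^n" "real (Suc k) / 2^n"] n by (simp only: dist_real_def) simp
      qed
      then show "w \<notin> large_steps g b n" unfolding large_steps_def by fastforce
    qed
  qed
qed

lemma splice_continuous_const: "0 \<le> c \<Longrightarrow> c \<le> 1 \<Longrightarrow> splice_continuous (\<lambda>_. c)"
  by (simp add: splice_continuous_def)

lemma splice_continuous_diff:
  assumes "splice_continuous g" shows "splice_continuous (\<lambda>w. 1 - g w)"
  using assms unfolding splice_continuous_def
  by (simp add: borel_measurable_diff continuous_on_diff)

lemma splice_continuous_min_sum:
  assumes "finite I" "\<And>i. i \<in> I \<Longrightarrow> splice_continuous (g i)"
  shows "splice_continuous (\<lambda>w. min 1 (\<Sum>i\<in>I. g i w))"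
  unfolding splice_continuous_def
proof (intro conjI allI ballI)
  show "(\<lambda>w. min 1 (\<Sum>i\<in>I. g i w)) \<in> borel_measurable P"
    by (intro borel_measurable_min borel_measurable_sum) (use splice_continuousD(1)[OF assms(2)] in auto)
  show "0 \<le> min 1 (\<Sum>i\<in>I. g i w)" for w
    using sum_nonneg[of I "\<lambda>i. g i w"] splice_continuousD(2)[OF assms(2)] by simp
  show "continuous_on {0..} (\<lambda>s. min 1 (\<Sum>i\<in>I. g i (concat_path s w v)))" if "w \<in> paths UNIV" "v \<in> paths UNIV" for w v
    by (intro continuous_on_min continuous_on_const continuous_on_sum splice_continuousD(4)[OF assms(2)] that)
qed simp

text \<open>A piecewise linear version of the indicator of \<open>path_cyl K\<close>: it equals 1
  there and, for m > 0, vanishes as soon as some value exceeds its bound by 1/m.\<close>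

definition cyl_approx :: "nat \<Rightarrow> (real \<times> real) set \<Rightarrow> (real \<Rightarrow> real) \<Rightarrow> real" where
  "cyl_approx m K w = (\<Prod>p\<in>K. max 0 (1 - real m * max 0 (w (fst p) - snd p)))"

lemma splice_continuous_cyl_approx: "splice_continuous (cyl_approx m K)"
  unfolding splice_continuous_def
proof (intro conjI allI ballI)
  show "cyl_approx m K \<in> borel_measurable P"
    unfolding cyl_approx_def[abs_def]
    by (intro borel_measurable_prod borel_measurable_max borel_measurable_diff borel_measurable_times borel_measurable_const measurable_eval_P)
  show "0 \<le> cyl_approx m K w" for w unfolding cyl_approx_def by (rule prod_nonneg) simp
  show "cyl_approx m K w \<le> 1" for w unfolding cyl_approx_def by (rule prod_le_1) simp
  show "continuous_on {0..} (\<lambda>s. cyl_approx m K (concat_path s w v))" if "w \<in> paths UNIV" "v \<in> paths UNIV" for w v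
    unfolding cyl_approx_def
    by (intro continuous_on_prod continuous_on_max continuous_on_diff continuous_on_mult continuous_on_const continuous_on_concat_path that)
qed

lemma cyl_approx_tendsto:
  assumes K: "finite K" and w: "w \<in> paths UNIV"
  shows "(\<lambda>m. cyl_approx m K w) \<longlonglongrightarrow> indicator (path_cyl K) w"
proof (cases "w \<in> path_cyl K")
  case True
  then have "\<forall>p\<in>K. w (fst p) \<le> snd p" by auto
  then have "cyl_approx m K w = 1" for m
    unfolding cyl_approx_def by (intro prod.neutral ballI) (simp add: max_absorb1)
  then show ?thesis using True by simp
next
  case False
  then obtain p where p: "p \<in> K" "snd p < w (fst p)" using w by fastforce
  obtain N :: nat where N: "1 / (w (fst p) - snd p) < real N" using reals_Archimedean2 by blast
  have "cyl_approx m K w = 0" if m: "N \<le> m" for m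
  proof -
    have "real N \<le> real m" using m by simp
    then have "1 / (w (fst p) - snd p) \<le> real m" using N by linarith
    then have "1 \<le> real m * (w (fst p) - snd p)" using p(2) by (simp add: divide_le_eq)
    then have "max 0 (1 - real m * max 0 (w (fst p) - snd p)) = 0" using p(2) by (simp add: max_absorb1 max_absorb2)
    then show ?thesis unfolding cyl_approx_def using K p(1) by (intro prod_zero) auto
  qed
  then have "\<forall>\<^sub>F m in sequentially. cyl_approx m K w = 0" by (rule eventually_sequentiallyI)
  then have "(\<lambda>m. cyl_approx m K w) \<longlonglongrightarrow> 0" by (rule tendsto_eventually)
  then show ?thesis using False by simp
qed

lemma integrable_indicator_diff:
  assumes "A \<in> sets P" "splice_continuous g"
  shows "integrable P (\<lambda>w. \<bar>indicator A w - g w\<bar>)"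
proof (rule integrable_const_bound[where B=1])
  show "(\<lambda>w. \<bar>indicator A w - g w\<bar>) \<in> borel_measurable P"
    by (intro borel_measurable_abs borel_measurable_diff borel_measurable_indicator assms(1) splice_continuousD(1)[OF assms(2)])
  show "AE w in P. norm \<bar>indicator A w - g w\<bar> \<le> 1"
    using splice_continuous_abs_diff_le[OF assms(2)] by (intro AE_I2)
qed

text \<open>The events that can be approximated form a Dynkin system containing the cylinders.
  Complements pass to 1 - g; for a disjoint union the tail takes one half of \<eta>, and the first N
  members share the other half.\<close>

lemma splice_continuous_approx_P:
  assumes "A \<in> sets P" "0 < \<eta>"
  shows "\<exists>g. splice_continuous g \<and> (\<integral>w. \<bar>indicator A w - g w\<bar> \<partial>P) < \<eta>"
  using assms(2)
proof (induction arbitrary: \<eta> rule: sigma_sets_induct_disjoint[OF Int_stable_path_cyl, of "paths UNIV", consumes 0, case_names subset A basic empty compl union])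
  case subset show ?case by auto
next
  case A show ?case using assms(1) unfolding sets_P sets_path_borel_UNIV .
next
  case (basic A)
  then obtain K where K: "finite K" "A = path_cyl K" by blast
  have "(\<lambda>m. \<integral>w. \<bar>indicator A w - cyl_approx m K w\<bar> \<partial>P) \<longlonglongrightarrow> (\<integral>w. 0 \<partial>P)"
  proof (rule integral_dominated_convergence[where w="\<lambda>_. 1"])
    have "A \<in> sets P" using path_cyl_sets[OF K(1)] K(2) sets_P by simp
    then have i: "integrable P (\<lambda>w. \<bar>indicator A w - cyl_approx m K w\<bar>)" for m
      by (rule integrable_indicator_diff[OF _ splice_continuous_cyl_approx])
    then show "(\<lambda>w. \<bar>indicator A w - cyl_approx m K w\<bar>) \<in> borel_measurable P" for m by (rule borel_measurable_integrable)
    show "AE w in P. (\<lambda>m. \<bar>indicator A w - cyl_approx m K w\<bar>) \<longlonglongrightarrow> 0"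
    proof (rule AE_I2)
      fix w assume "w \<in> space P"
      then have "(\<lambda>m. cyl_approx m K w) \<longlonglongrightarrow> indicator A w" using cyl_approx_tendsto[OF K(1)] K(2) by (simp add: space_P)
      then have "(\<lambda>m. \<bar>indicator A w - cyl_approx m K w\<bar>) \<longlonglongrightarrow> \<bar>indicator A w - indicator A w\<bar>"
        by (intro tendsto_rabs tendsto_diff tendsto_const)
      then show "(\<lambda>m. \<bar>indicator A w - cyl_approx m K w\<bar>) \<longlonglongrightarrow> 0" by simp
    qed
    show "AE w in P. norm \<bar>indicator A w - cyl_approx m K w\<bar> \<le> 1" for m
      using splice_continuous_abs_diff_le[OF splice_continuous_cyl_approx] by (intro AE_I2)
  qed simp_all
  then have "\<forall>\<^sub>F m in sequentially. (\<integral>w. \<bar>indicator A w - cyl_approx m K w\<bar> \<partial>P) < \<eta>"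
    using order_tendstoD(2)[where a=\<eta>] basic.prems by fastforce
  then obtain m where "(\<integral>w. \<bar>indicator A w - cyl_approx m K w\<bar> \<partial>P) < \<eta>" by (auto simp: eventually_sequentially)
  then show ?case using splice_continuous_cyl_approx by blast
next
  case empty
  then show ?case using splice_continuous_const[of 0] by (intro exI[of _ "\<lambda>_. 0"]) simp
next
  case (compl A)
  then obtain g where g: "splice_continuous g" "(\<integral>w. \<bar>indicator A w - g w\<bar> \<partial>P) < \<eta>" by blast
  have "(\<integral>w. \<bar>indicator (paths UNIV - A) w - (1 - g w)\<bar> \<partial>P) = (\<integral>w. \<bar>indicator A w - g w\<bar> \<partial>P)"
    by (rule Bochner_Integration.integral_cong[OF refl]) (auto simp: space_P indicator_def)
  then show ?case using splice_continuous_diff[OF g(1)] g(2) by (intro exI[of _ "\<lambda>w. 1 - g w"]) simp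
next
  case (union A)
  have AP: "A i \<in> sets P" for i using union.hyps(2) unfolding sets_P sets_path_borel_UNIV by (simp add: image_subset_iff)
  have tail: "(\<lambda>N. prob ((\<Union>i. A i) - (\<Union>i<N. A i))) \<longlonglongrightarrow> 0"
  proof (rule measure_eventually_notin)
    show "(\<Union>i. A i) - (\<Union>i<N. A i) \<in> sets P" for N
      using AP by (intro sets.Diff sets.countable_UN sets.finite_UN) auto
    show "AE w in P. \<forall>\<^sub>F N in sequentially. w \<notin> (\<Union>i. A i) - (\<Union>i<N. A i)"
    proof (rule AE_I2)
      fix w
      show "\<forall>\<^sub>F N in sequentially. w \<notin> (\<Union>i. A i) - (\<Union>i<N. A i)"
      proof (cases "\<exists>i. w \<in> A i")
        case True
        then obtain i where "w \<in> A i" by blast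
        then show ?thesis by (intro eventually_sequentiallyI[of "Suc i"]) auto
      qed simp
    qed
  qed
  then have "\<forall>\<^sub>F N in sequentially. prob ((\<Union>i. A i) - (\<Union>i<N. A i)) < \<eta> / 2"
    by (rule order_tendstoD) (use union.prems in simp)
  then obtain N where N: "prob ((\<Union>i. A i) - (\<Union>i<N. A i)) < \<eta> / 2" by (auto simp: eventually_sequentially)
  \<comment> \<open>\<open>Suc N\<close> in the denominator keeps the tolerance positive when N =
    0.\<close>
  have "\<forall>i. \<exists>g. splice_continuous g \<and> (\<integral>w. \<bar>indicator (A i) w - g w\<bar> \<partial>P) < \<eta> / (2 * real (Suc N))"
    using union.IH union.prems by (intro allI) simp
  then obtain g where g: "\<And>i. splice_continuous (g i)" "\<And>i. (\<integral>w. \<bar>indicator (A i) w - g i w\<bar> \<partial>P) < \<eta> / (2 * real (Suc N))"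
    by metis
  \<comment> \<open>Truncation at 1 restores the range [0, 1] and never increases the distance from
    an indicator.\<close>
  let ?G = "\<lambda>w. min 1 (\<Sum>i<N. g i w)"
  let ?R = "(\<Union>i. A i) - (\<Union>i<N. A i)"
  have G: "splice_continuous ?G" by (rule splice_continuous_min_sum) (use g in auto)
  have UP: "(\<Union>i. A i) \<in> sets P" "(\<Union>i<N. A i) \<in> sets P"
    using AP by (auto intro!: sets.countable_UN sets.finite_UN)
  then have RP: "?R \<in> sets P" "(\<Union>i. A i) \<in> sets P" by (simp_all only: sets.Diff)
  have "(\<integral>w. \<bar>indicator (\<Union>i. A i) w - ?G w\<bar> \<partial>P) \<le> (\<integral>w. indicator ?R w + (\<Sum>i<N. \<bar>indicator (A i) w - g i w\<bar>) \<partial>P)"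
  proof (rule integral_mono)
    show "integrable P (\<lambda>w. \<bar>indicator (\<Union>i. A i) w - ?G w\<bar>)" by (rule integrable_indicator_diff[OF RP(2) G])
    show "integrable P (\<lambda>w. indicator ?R w + (\<Sum>i<N. \<bar>indicator (A i) w - g i w\<bar>))"
      using RP AP g(1) by (intro Bochner_Integration.integrable_add Bochner_Integration.integrable_sum integrable_indicator_diff integrable_real_indicator) (auto simp: emeasure_eq_measure)
    fix w assume "w \<in> space P"
    have 1: "indicat_real (\<Union>i<N. A i) w = (\<Sum>i<N. indicator (A i) w)"
      by (rule indicator_UN_disjoint) (use union.hyps(1) in \<open>auto intro: disjoint_family_on_mono\<close>)
    have 2: "indicat_real (\<Union>i. A i) w = indicator ?R w + indicator (\<Union>i<N. A i) w" by (auto simp: indicator_def)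
    have "\<bar>indicat_real (\<Union>i<N. A i) w - ?G w\<bar> \<le> \<bar>indicat_real (\<Union>i<N. A i) w - (\<Sum>i<N. g i w)\<bar>"
      by (auto simp: indicator_def min_def abs_if)
    also have "\<dots> = \<bar>\<Sum>i<N. indicator (A i) w - g i w\<bar>" unfolding 1 by (simp add: sum_subtractf)
    also have "\<dots> \<le> (\<Sum>i<N. \<bar>indicator (A i) w - g i w\<bar>)" by (rule sum_abs)
    finally have 3: "\<bar>indicat_real (\<Union>i<N. A i) w - ?G w\<bar> \<le> (\<Sum>i<N. \<bar>indicator (A i) w - g i w\<bar>)" .
    have "0 \<le> indicat_real ?R w" by simp
    then show "\<bar>indicator (\<Union>i. A i) w - ?G w\<bar> \<le> indicator ?R w + (\<Sum>i<N. \<bar>indicator (A i) w - g i w\<bar>)"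
      unfolding 2 using 3 by linarith
  qed
  also have "\<dots> = prob ?R + (\<Sum>i<N. \<integral>w. \<bar>indicator (A i) w - g i w\<bar> \<partial>P)"
  proof -
    have i: "integrable P (\<lambda>w. \<bar>indicator (A i) w - g i w\<bar>)" for i
      by (rule integrable_indicator_diff[OF AP g(1)])
    have r: "integrable P (indicat_real ?R)" using RP by (intro integrable_real_indicator) (auto simp: emeasure_eq_measure)
    have "(\<integral>w. indicator ?R w + (\<Sum>i<N. \<bar>indicator (A i) w - g i w\<bar>) \<partial>P) =
        (\<integral>w. indicat_real ?R w \<partial>P) + (\<integral>w. (\<Sum>i<N. \<bar>indicator (A i) w - g i w\<bar>) \<partial>P)"
      by (rule Bochner_Integration.integral_add[OF r Bochner_Integration.integrable_sum[OF i]])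
    also have "(\<integral>w. (\<Sum>i<N. \<bar>indicator (A i) w - g i w\<bar>) \<partial>P) = (\<Sum>i<N. \<integral>w. \<bar>indicator (A i) w - g i w\<bar> \<partial>P)"
      by (rule Bochner_Integration.integral_sum) (rule i)
    also have "(\<integral>w. indicat_real ?R w \<partial>P) = prob ?R" using RP(1) by simp
    finally show ?thesis .
  qed
  also have "(\<Sum>i<N. \<integral>w. \<bar>indicator (A i) w - g i w\<bar> \<partial>P) \<le> (\<Sum>i<N. \<eta> / (2 * real (Suc N)))"
    by (rule sum_mono) (use g(2) in \<open>simp add: less_imp_le\<close>)
  also have "\<dots> = (real N / real (Suc N)) * (\<eta> / 2)" by simp
  also have "\<dots> \<le> 1 * (\<eta> / 2)" by (rule mult_right_mono) (use union.prems in auto)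
  finally show ?case using N G by (intro exI[of _ ?G]) auto
qed

lemma splice_continuous_approx:
  assumes A: "A \<in> sets W" and \<eta>: "0 < \<eta>"
  obtains g where "splice_continuous g" "(\<integral>w. \<bar>indicator A w - g w\<bar> \<partial>W) < \<eta>"
proof -
  obtain A' where A': "A' \<in> sets P" "AE w in W. w \<in> A \<longleftrightarrow> w \<in> A'"
  proof
    show "main_part P A \<in> sets P" by (rule main_part_sets[OF A])
    show "AE w in W. w \<in> A \<longleftrightarrow> w \<in> main_part P A"
      using AE_in_main_part[OF A] unfolding AE_completion_iff by (auto elim: eventually_mono)
  qed
  obtain g where g: "splice_continuous g" "(\<integral>w. \<bar>indicator A' w - g w\<bar> \<partial>P) < \<eta>"
    using splice_continuous_approx_P[OF A'(1) \<eta>] by blast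
  have "(\<integral>w. \<bar>indicator A w - g w\<bar> \<partial>W) = (\<integral>w. \<bar>indicator A' w - g w\<bar> \<partial>W)"
  proof (rule integral_cong_AE)
    show "(\<lambda>w. \<bar>indicator A w - g w\<bar>) \<in> borel_measurable W"
      by (intro borel_measurable_abs borel_measurable_diff borel_measurable_indicator A measurable_completion[OF splice_continuousD(1)[OF g(1)]])
    show "(\<lambda>w. \<bar>indicator A' w - g w\<bar>) \<in> borel_measurable W"
      by (rule measurable_completion[OF borel_measurable_integrable[OF integrable_indicator_diff[OF A'(1) g(1)]]])
    show "AE w in W. \<bar>indicator A w - g w\<bar> = \<bar>indicator A' w - g w\<bar>"
      using A'(2) by eventually_elim (simp add: indicator_def)
  qed
  also have "\<dots> = (\<integral>w. \<bar>indicator A' w - g w\<bar> \<partial>P)"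
    by (rule integral_completion[OF borel_measurable_integrable[OF integrable_indicator_diff[OF A'(1) g(1)]]])
  finally show thesis using that g by simp
qed

end

section \<open>Splitting times\<close>

text \<open>\<open>T t\<close> abstracts the value of an indexation on (0, t).
  \<open>T_nested\<close> joins nestedness and stationarity: a value in the window (s, s + r) is the
  one that the path restarted at s yields for the length r. The setting is met by \<tau> and by its
  dual alike.\<close>

locale splitting_time = wiener_space P for P :: "(real \<Rightarrow> real) measure" +
  fixes T :: "real \<Rightarrow> (real \<Rightarrow> real) \<Rightarrow> real"
  assumes T_range: "0 < t \<Longrightarrow> AE w in completion P. 0 < T t w \<and> T t w < t"
    and T_adapted: "0 < t \<Longrightarrow> T t \<in> borel_measurable (incr_field (completion P) 0 (ereal t))"
    and T_nested: "0 \<le> s \<Longrightarrow> 0 < r \<Longrightarrow> s + r \<le> t \<Longrightarrow>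
      AE w in completion P. s < T t w \<and> T t w < s + r \<longrightarrow> T t w = s + T r (levy_shift s w)"
begin

lemma T_prefix:
  assumes "0 < r" "r \<le> t"
  shows "AE w in W. T t w < r \<longrightarrow> T t w = T r w"
proof -
  have "AE w in W. 0 < T t w \<and> T t w < 0 + r \<longrightarrow> T t w = 0 + T r (levy_shift 0 w)"
    by (rule T_nested) (use assms in auto)
  moreover have "AE w in W. 0 < T t w \<and> T t w < t" by (rule T_range) (use assms in auto)
  ultimately show ?thesis using AE_space[of W]
  proof eventually_elim
    case (elim w)
    then have "levy_shift 0 w = w" by (simp add: space_P paths_UNIV_iff levy_shift_def)
    then show ?case using elim by simp
  qed
qed

lemma T_past_measurable: "0 < t \<Longrightarrow> T t \<in> borel_measurable (incr_field W (-\<infinity>) (ereal t))"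
  by (rule incr_field_measurable_mono[OF T_adapted]) simp_all

lemma T_future_measurable: "0 < t \<Longrightarrow> T t \<in> borel_measurable (incr_field W 0 \<infinity>)"
  by (rule incr_field_measurable_mono[OF T_adapted]) simp_all

lemma T_measurable_W: "0 < t \<Longrightarrow> T t \<in> borel_measurable W"
  by (rule incr_field_measurableD[OF T_adapted])

text \<open>An atom of \<open>T x\<close> at \<open>y\<close> would, by stationarity and nestedness, give \<open>T (x - \<epsilon>)\<close> after time
  \<open>\<epsilon>\<close> an atom of the same size at each of uncountably many points.\<close>

lemma T_no_atom:
  assumes y: "0 < y" "y < x"
  shows "AE w in W. T x w \<noteq> y"
proof -
  interpret W: prob_space W by (rule prob_space_W)
  \<comment> \<open>Half the distance of y from the ends of (0, x), so that y remains interior when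
    an end is moved by e.\<close>
  define e where "e = min y (x - y) / 2"
  have e: "0 < e" "e < y" "y + e < x" using y by (auto simp: e_def min_def field_simps)
  define A where "A = T x -` {y} \<inter> space W"
  have A: "A \<in> sets W" unfolding A_def by (rule measurable_sets[OF T_measurable_W]) (use y in auto)
  define Y where "Y w = T (x - e) (levy_shift e w)" for w
  have Y: "Y \<in> borel_measurable W" unfolding Y_def[abs_def]
    by (rule measurable_compose[OF levy_shift_W T_measurable_W]) (use e in auto)
  \<comment> \<open>Seen from time z, the event \<open>A\<close> has the same probability for every
    z; nestedness restarts it at the common time e, where it reads
    \<open>Y = y + z - e\<close>.\<close>
  have ge: "W.prob A \<le> measure (distr W borel Y) {y + z - e}" if z: "z \<in> {0<..<e}" for z
  proof -
    have "AE w in W. e - z < T x w \<and> T x w < e - z + (x - e) \<longrightarrow> T x w = e - z + T (x - e) (levy_shift (e - z) w)"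
      by (rule T_nested) (use z e in auto)
    then have "AE w in W. e - z < T x (levy_shift z w) \<and> T x (levy_shift z w) < e - z + (x - e) \<longrightarrow> T x (levy_shift z w) = e - z + T (x - e) (levy_shift (e - z) (levy_shift z w))"
      by (rule AE_levy_shift)
    then have "AE w in W. w \<in> levy_shift z -` A \<inter> space W \<longrightarrow> w \<in> Y -` {y + z - e} \<inter> space W"
    proof eventually_elim
      case (elim w)
      show ?case
      proof
        assume w: "w \<in> levy_shift z -` A \<inter> space W"
        then have "T x (levy_shift z w) = y" by (simp add: A_def)
        then have "y = e - z + Y w" using elim e z by (simp add: levy_shift_levy_shift Y_def)
        then show "w \<in> Y -` {y + z - e} \<inter> space W" using w by simp
      qed
    qed
    then have "W.prob (levy_shift z -` A \<inter> space W) \<le> W.prob (Y -` {y + z - e} \<inter> space W)"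
      by (rule W.finite_measure_mono_AE) (rule measurable_sets[OF Y], simp)
    moreover have "W.prob (levy_shift z -` A \<inter> space W) = W.prob A"
      using emeasure_levy_shift[OF A] by (simp only: measure_def)
    ultimately show ?thesis using measure_distr[OF Y, of "{y + z - e}"] by simp
  qed
  interpret D: prob_space "distr W borel Y" by (rule W.prob_space_distr[OF Y])
  have "W.prob A = 0"
  proof (rule ccontr)
    assume "W.prob A \<noteq> 0"
    then have "0 < W.prob A" by (simp add: zero_less_measure_iff)
    then have "(\<lambda>z. y + z - e) ` {0<..<e} \<subseteq> {c. measure (distr W borel Y) {c} \<noteq> 0}"
      using ge by fastforce
    then have "countable ((\<lambda>z. y + z - e) ` {0<..<e})"
      using D.countable_support countable_subset by blast
    moreover have "inj_on (\<lambda>z. y + z - e) {0<..<e}" by (auto intro: inj_onI)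
    ultimately have "countable {0<..<e}" by (rule countable_image_inj_on)
    then show False using uncountable_open_interval[of 0 e] e(1) by simp
  qed
  then have "A \<in> null_sets W" using A by (simp add: W.emeasure_eq_measure null_sets_def)
  then have "AE w in W. w \<notin> A" by (rule AE_not_in)
  then show ?thesis using AE_space[of W] by eventually_elim (simp add: A_def)
qed

section \<open>Crossings of a level, observed on dyadic grids\<close>

definition crossed :: "real \<Rightarrow> real \<Rightarrow> (real \<Rightarrow> real) set" where
  "crossed u t = {w \<in> space W. u < t \<and> u < T t w}"

lemma crossed_past:
  assumes "0 \<le> u" shows "crossed u t \<in> sets (incr_field W (-\<infinity>) (ereal t))"
proof (cases "u < t")
  case True
  have "T t -` {u<..} \<inter> space (incr_field W (-\<infinity>) (ereal t)) \<in> sets (incr_field W (-\<infinity>) (ereal t))"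
    by (rule measurable_sets[OF T_past_measurable]) (use True assms in auto)
  moreover have "T t -` {u<..} \<inter> space (incr_field W (-\<infinity>) (ereal t)) = crossed u t"
    using True by (auto simp: crossed_def)
  ultimately show ?thesis by (simp only:)
next
  case False
  then have "crossed u t = {}" by (auto simp: crossed_def)
  then show ?thesis by simp
qed

lemma crossed_sets: "0 \<le> u \<Longrightarrow> crossed u t \<in> sets W"
  using crossed_past sets_incr_field_subset by blast

text \<open>If \<open>T t\<close> is below s, nestedness makes it equal to \<open>T s\<close>, which
  is beyond u; otherwise it is at least s, and s is beyond u. So a crossing is never undone, and
  \<open>crossed u t\<close> says that it has happened by time t. The clause \<open>u < t\<close> in
  the definition rules out t = 0, where \<open>T\<close> is not controlled.\<close>

lemma crossed_mono:
  assumes u: "0 \<le> u" and st: "0 \<le> s" "s \<le> t"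
  shows "AE w in W. w \<in> crossed u s \<longrightarrow> w \<in> crossed u t"
proof (cases "u < s")
  case True
  have "AE w in W. T t w < s \<longrightarrow> T t w = T s w" by (rule T_prefix) (use True u st in auto)
  then show ?thesis
    by eventually_elim (use True st in \<open>auto simp: crossed_def\<close>)
qed (simp add: crossed_def)

text \<open>A value below s would already be the value of \<open>T s\<close>; so when the crossing
  happens between s and t, the new value is at least s.\<close>

lemma crossed_jump:
  assumes u: "0 \<le> u" and st: "0 \<le> s" "s \<le> t"
  shows "AE w in W. w \<in> crossed u t \<and> w \<notin> crossed u s \<longrightarrow> s \<le> T t w"
proof (cases "u < s")
  case True
  have "AE w in W. T t w < s \<longrightarrow> T t w = T s w" by (rule T_prefix) (use True u st in auto)
  then show ?thesis
    by eventually_elim (use True st in \<open>auto simp: crossed_def\<close>)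
qed (auto simp: crossed_def)

abbreviation grid :: "nat \<Rightarrow> nat \<Rightarrow> real" where "grid n k \<equiv> real k / 2 ^ n"

lemma grid_refine: "p \<le> n \<Longrightarrow> grid n (k * 2^(n-p)) = grid p k"
proof -
  assume "p \<le> n"
  then have "(2::real)^n = 2^(n-p) * 2^p" by (simp add: power_add[symmetric])
  then have "grid n (k * 2^(n-p)) = (2^(n-p) * real k) / (2^(n-p) * 2^p)" by (simp only: of_nat_mult of_nat_power of_nat_numeral mult.commute)
  then show ?thesis by simp
qed

lemma crossed_grid_mono:
  assumes "0 \<le> u"
  shows "AE w in W. \<forall>i j. i \<le> j \<longrightarrow> w \<in> crossed u (grid n i) \<longrightarrow> w \<in> crossed u (grid n j)"
proof -
  have "AE w in W. i \<le> j \<longrightarrow> w \<in> crossed u (grid n i) \<longrightarrow> w \<in> crossed u (grid n j)" for i j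
  proof (cases "i \<le> j")
    case True
    then have "AE w in W. w \<in> crossed u (grid n i) \<longrightarrow> w \<in> crossed u (grid n j)"
      by (intro crossed_mono assms divide_right_mono) auto
    then show ?thesis by eventually_elim simp
  qed simp
  then show ?thesis unfolding AE_all_countable by blast
qed

definition new_cell :: "real \<Rightarrow> nat \<Rightarrow> nat \<Rightarrow> (real \<Rightarrow> real) set" where
  "new_cell u n k = crossed u (grid n (Suc k)) - crossed u (grid n k)"

lemma new_cell_past:
  assumes "0 \<le> u" shows "new_cell u n k \<in> sets (incr_field W (-\<infinity>) (ereal (grid n (Suc k))))"
proof -
  have "crossed u (grid n k) \<in> sets (incr_field W (-\<infinity>) (ereal (grid n (Suc k))))"
    using crossed_past[OF assms, of "grid n k"] incr_field_mono[of "-\<infinity>" "-\<infinity>" "ereal (grid n k)" "ereal (grid n (Suc k))" W]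
    by (auto simp: divide_right_mono)
  then show ?thesis unfolding new_cell_def using crossed_past[OF assms] by (intro sets.Diff)
qed

lemma new_cell_sets: "0 \<le> u \<Longrightarrow> new_cell u n k \<in> sets W"
  using new_cell_past sets_incr_field_subset by blast

text \<open>The bad event for a restart at the end of the cell of the crossing: \<open>T x\<close>
  has passed by then, and the restarted path cannot find it.\<close>

definition missed :: "real \<Rightarrow> real \<Rightarrow> nat \<Rightarrow> (real \<Rightarrow> real) set" where
  "missed u x n = {w \<in> space W. \<exists>k. grid n (Suc k) < x \<and> w \<in> new_cell u n k \<and> T x w \<le> grid n (Suc k)}"

lemma integrable_splice_W:
  assumes g: "splice_continuous g" and A: "A \<in> sets W"
  shows "integrable W (\<lambda>w. indicat_real A w * g w)"
proof -
  interpret W: prob_space W by (rule prob_space_W)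
  show ?thesis
  proof (rule W.integrable_const_bound[where B=1])
    show "AE w in W. norm (indicat_real A w * g w) \<le> 1"
      using splice_continuousD(2,3)[OF g] by (intro AE_I2) (simp add: indicator_def)
    show "(\<lambda>w. indicat_real A w * g w) \<in> borel_measurable W"
      by (intro borel_measurable_times borel_measurable_indicator A measurable_completion[OF splice_continuousD(1)[OF g]])
  qed
qed

text \<open>A maximal inequality combined with the Markov property. On \<open>S j\<close> the
  conditional mean exceeds 1/2, so the probability of \<open>S j\<close> is at most twice the
  integral of g over \<open>S j\<close>; the path after \<open>s j\<close> is independent of
  \<open>S j\<close>, which yields the factor \<open>measure W Q\<close>; and since the
  \<open>S j\<close> are disjoint, the integrals add up to at most that of g.\<close>

lemma first_passage:
  fixes s :: "nat \<Rightarrow> real"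
  assumes g: "splice_continuous g" and s: "\<And>i. 0 \<le> s i" "mono s"
    and Q: "Q \<in> sets (incr_field W 0 \<infinity>)"
    and S: "\<And>j. S j = {w \<in> space W. past_mean (s j) g w > 1/2 \<and> (\<forall>i\<in>{a..<j}. past_mean (s i) g w \<le> 1/2)}"
  shows "measure W (\<Union>j\<in>{a..<b}. S j \<inter> (levy_shift (s j) -` Q \<inter> space W)) \<le> 2 * measure W Q * (\<integral>w. g w \<partial>W)"
    and "\<And>j. S j \<inter> (levy_shift (s j) -` Q \<inter> space W) \<in> sets W"
proof -
  interpret W: prob_space W by (rule prob_space_W)
  have past: "S j \<in> sets (incr_field W (-\<infinity>) (ereal (s j)))" for j
  proof -
    let ?F = "incr_field W (-\<infinity>) (ereal (s j))"
    have m: "past_mean (s i) g \<in> borel_measurable ?F" if "i \<le> j" for i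
      by (rule incr_field_measurable_mono[OF measurable_past_mean[OF splice_continuousD(1)[OF g] s(1)]])
        (use that s(2) in \<open>auto simp: mono_def\<close>)
    have "{w \<in> space ?F. \<forall>i\<in>{a..<j}. past_mean (s i) g w \<le> 1/2} \<in> sets ?F"
    proof (rule sets.sets_Collect_finite_All)
      fix i assume "i \<in> {a..<j}"
      then have [measurable]: "past_mean (s i) g \<in> borel_measurable ?F" by (intro m) auto
      show "{w \<in> space ?F. past_mean (s i) g w \<le> 1/2} \<in> sets ?F" by measurable
    qed simp
    moreover have "{w \<in> space ?F. past_mean (s j) g w > 1/2} \<in> sets ?F"
      using m[of j] by measurable
    moreover have "S j = {w \<in> space ?F. past_mean (s j) g w > 1/2} \<inter> {w \<in> space ?F. \<forall>i\<in>{a..<j}. past_mean (s i) g w \<le> 1/2}"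
      unfolding S space_incr_field by blast
    ultimately show ?thesis by (simp only: sets.Int)
  qed
  have SW: "S j \<in> sets W" for j using past sets_incr_field_subset by blast
  have QW: "Q \<in> sets W" using Q sets_incr_field_subset by blast
  show SQ: "S j \<inter> (levy_shift (s j) -` Q \<inter> space W) \<in> sets W" for j
    using SW measurable_sets[OF levy_shift_W QW] by (rule sets.Int)
  have half: "W.prob (S j) \<le> 2 * (\<integral>w. indicator (S j) w * g w \<partial>W)" for j
  proof -
    have mean: "past_mean (s j) g \<in> borel_measurable W"
      by (rule measurable_completion[OF measurable_past_mean_P[OF splice_continuousD(1)[OF g] s(1)]])
    have "W.prob (S j) = (\<integral>w. indicat_real (S j) w \<partial>W)"
      using SW[of j] sets.sets_into_space[OF SW[of j]] by (simp add: Int_absorb2)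
    also have "\<dots> \<le> (\<integral>w. 2 * (indicat_real (S j) w * past_mean (s j) g w) \<partial>W)"
    proof (rule integral_mono)
      show "integrable W (indicat_real (S j))" using SW by (intro integrable_real_indicator) (auto simp: W.emeasure_eq_measure)
      show "integrable W (\<lambda>w. 2 * (indicat_real (S j) w * past_mean (s j) g w))"
      proof (rule W.integrable_const_bound[where B=2])
        show "AE w in W. norm (2 * (indicat_real (S j) w * past_mean (s j) g w)) \<le> 2"
          using past_mean_bounds[OF splice_continuousD(1)[OF g] _ s(1)[of j]] splice_continuousD(2,3)[OF g]
          by (intro AE_I2) (simp add: indicator_def space_P)
        show "(\<lambda>w. 2 * (indicat_real (S j) w * past_mean (s j) g w)) \<in> borel_measurable W"
          by (intro borel_measurable_times borel_measurable_const borel_measurable_indicator SW mean)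
      qed
      show "indicat_real (S j) w \<le> 2 * (indicat_real (S j) w * past_mean (s j) g w)" for w
        by (cases "w \<in> S j") (auto simp: S)
    qed
    also have "\<dots> = 2 * (\<integral>w. indicat_real (S j) w * past_mean (s j) g w \<partial>W)" by simp
    also have "(\<integral>w. indicat_real (S j) w * past_mean (s j) g w \<partial>W) = (\<integral>w. indicat_real (S j) w * g w \<partial>W)"
      by (rule integral_past_mean[symmetric, OF past s(1) splice_continuousD(1)[OF g]]) (use splice_continuousD(2,3)[OF g] in auto)
    finally show ?thesis .
  qed
  have disj: "disjoint_family_on S {a..<b}"
    unfolding disjoint_family_on_def
  proof (intro ballI impI)
    fix i j assume ij: "i \<in> {a..<b}" "j \<in> {a..<b}" "i \<noteq> j"
    have "S i \<inter> S j = {}" if "i < j" "i \<in> {a..<b}" for i j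
    proof -
      have "i \<in> {a..<j}" using that by auto
      show ?thesis
      proof (rule equals0I)
        fix w assume w: "w \<in> S i \<inter> S j"
        then have "past_mean (s i) g w > 1/2" "past_mean (s i) g w \<le> 1/2"
          using \<open>i \<in> {a..<j}\<close> unfolding S by blast+
        then show False by linarith
      qed
    qed
    then show "S i \<inter> S j = {}" using ij by (metis Int_commute nat_neq_iff)
  qed
  have "W.prob (\<Union>j\<in>{a..<b}. S j \<inter> (levy_shift (s j) -` Q \<inter> space W)) \<le> (\<Sum>j\<in>{a..<b}. W.prob (S j \<inter> (levy_shift (s j) -` Q \<inter> space W)))"
    by (rule W.finite_measure_subadditive_finite) (use SQ in auto)
  also have "\<dots> = (\<Sum>j\<in>{a..<b}. W.prob (S j) * W.prob Q)"
    using independent_increments[OF past s(1) Q] by (simp add: measure_def enn2real_mult)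
  also have "\<dots> \<le> (\<Sum>j\<in>{a..<b}. 2 * (\<integral>w. indicator (S j) w * g w \<partial>W) * W.prob Q)"
    by (intro sum_mono mult_right_mono half) simp
  also have "\<dots> = 2 * W.prob Q * (\<Sum>j\<in>{a..<b}. (\<integral>w. indicator (S j) w * g w \<partial>W))"
    by (simp add: sum_distrib_left mult_ac)
  also have "(\<Sum>j\<in>{a..<b}. (\<integral>w. indicator (S j) w * g w \<partial>W)) = (\<integral>w. (\<Sum>j\<in>{a..<b}. indicator (S j) w * g w) \<partial>W)"
    by (rule Bochner_Integration.integral_sum[symmetric]) (rule integrable_splice_W[OF g SW])
  also have "2 * W.prob Q * \<dots> \<le> 2 * W.prob Q * (\<integral>w. g w \<partial>W)"
  proof (intro mult_left_mono integral_mono)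
    show "integrable W (\<lambda>w. \<Sum>j\<in>{a..<b}. indicator (S j) w * g w)"
      by (rule Bochner_Integration.integrable_sum) (rule integrable_splice_W[OF g SW])
    show "integrable W g"
    proof (rule W.integrable_const_bound[where B=1])
      show "AE w in W. norm (g w) \<le> 1" using splice_continuousD(2,3)[OF g] by (intro AE_I2) simp
    qed (rule measurable_completion[OF splice_continuousD(1)[OF g]])
    fix w
    have "(\<Sum>j\<in>{a..<b}. indicat_real (S j) w * g w) = indicat_real (\<Union>j\<in>{a..<b}. S j) w * g w"
    proof -
      have "indicat_real (\<Union>j\<in>{a..<b}. S j) w = (\<Sum>j\<in>{a..<b}. indicat_real (S j) w)"
        by (rule indicator_UN_disjoint[OF _ disj]) simp
      then show ?thesis by (simp only: sum_distrib_right)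
    qed
    also have "\<dots> \<le> g w" using splice_continuousD(2)[OF g, of w] by (simp add: indicator_def)
    finally show "(\<Sum>j\<in>{a..<b}. indicat_real (S j) w * g w) \<le> g w" .
  qed simp
  finally show "W.prob (\<Union>j\<in>{a..<b}. S j \<inter> (levy_shift (s j) -` Q \<inter> space W)) \<le> 2 * W.prob Q * (\<integral>w. g w \<partial>W)" .
qed

lemma past_mean_diff:
  assumes g: "splice_continuous g" and s: "0 \<le> s" "w \<in> paths UNIV"
  shows "past_mean s (\<lambda>w. 1 - g w) w = 1 - past_mean s g w"
proof -
  have "integrable P (\<lambda>v. g (concat_path s w v))"
    by (rule integrable_const_bound[where B=1])
      (use splice_continuousD(2,3)[OF g] measurable_compose[OF measurable_concat_path_snd[OF s] splice_continuousD(1)[OF g]] in auto)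
  then show ?thesis unfolding past_mean_def by (simp add: prob_space)
qed

text \<open>On \<open>D k\<close> the crossing has happened, and yet the conditional mean of 1 - g
  is at least 1/4; hence the factor 4. The cells telescope to the crossing within the whole window,
  and there 1 - g is the distance of g from the indicator of \<open>f\<close>.\<close>

lemma low_mean_at_new_cell:
  assumes u: "0 \<le> u" and g: "splice_continuous g" and np: "p \<le> n"
    and f: "f = crossed u (grid p (Suc a)) - crossed u (grid p a)"
    and A: "A = a * 2^(n-p)" "B = Suc a * 2^(n-p)"
    and D: "\<And>k. D k = {w \<in> new_cell u n k. past_mean (grid n (Suc k)) g w \<le> 3/4}"
  shows "measure W (\<Union>k\<in>{A..<B}. D k) \<le> 4 * (\<integral>w. \<bar>indicator f w - g w\<bar> \<partial>W)"
    and "\<And>k. D k \<in> sets W"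
proof -
  interpret W: prob_space W by (rule prob_space_W)
  let ?g = "\<lambda>w. 1 - g w"
  have g': "splice_continuous ?g" by (rule splice_continuous_diff[OF g])
  have gr: "grid n A = grid p a" "grid n B = grid p (Suc a)"
    unfolding A by (rule grid_refine[OF np])+
  have mean: "past_mean (grid n (Suc k)) g \<in> borel_measurable W" for k
    by (rule measurable_completion[OF measurable_past_mean_P[OF splice_continuousD(1)[OF g]]]) simp
  have mean': "past_mean (grid n (Suc k)) ?g \<in> borel_measurable W" for k
    by (rule measurable_completion[OF measurable_past_mean_P[OF splice_continuousD(1)[OF g']]]) simp
  show DW: "D k \<in> sets W" for k
  proof -
    have [measurable]: "past_mean (grid n (Suc k)) g \<in> borel_measurable W" by (rule mean)
    have "{w \<in> space W. past_mean (grid n (Suc k)) g w \<le> 3/4} \<in> sets W" by measurable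
    then have "new_cell u n k \<inter> {w \<in> space W. past_mean (grid n (Suc k)) g w \<le> 3/4} \<in> sets W"
      using new_cell_sets[OF u] by (intro sets.Int)
    moreover have "new_cell u n k \<inter> {w \<in> space W. past_mean (grid n (Suc k)) g w \<le> 3/4} = D k"
      unfolding D new_cell_def crossed_def by blast
    ultimately show ?thesis by (simp only:)
  qed
  have one: "W.prob (D k) \<le> 4 * (\<integral>w. indicator (new_cell u n k) w * ?g w \<partial>W)" for k
  proof -
    have "W.prob (D k) = (\<integral>w. indicat_real (D k) w \<partial>W)"
      using DW[of k] sets.sets_into_space[OF DW[of k]] by (simp add: Int_absorb2)
    also have "\<dots> \<le> (\<integral>w. 4 * (indicat_real (new_cell u n k) w * past_mean (grid n (Suc k)) ?g w) \<partial>W)"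
    proof (rule integral_mono)
      show "integrable W (indicat_real (D k))" using DW by (intro integrable_real_indicator) (auto simp: W.emeasure_eq_measure)
      have bd: "0 \<le> past_mean (grid n (Suc k)) ?g w \<and> past_mean (grid n (Suc k)) ?g w \<le> 1" if "w \<in> paths UNIV" for w
        by (rule past_mean_bounds[OF splice_continuousD(1)[OF g'] _ _ that]) (use splice_continuousD(2,3)[OF g'] in auto)
      show "integrable W (\<lambda>w. 4 * (indicat_real (new_cell u n k) w * past_mean (grid n (Suc k)) ?g w))"
      proof (rule W.integrable_const_bound[where B=4])
        show "AE w in W. norm (4 * (indicat_real (new_cell u n k) w * past_mean (grid n (Suc k)) ?g w)) \<le> 4"
          using bd by (intro AE_I2) (simp add: indicator_def space_P)
        show "(\<lambda>w. 4 * (indicat_real (new_cell u n k) w * past_mean (grid n (Suc k)) ?g w)) \<in> borel_measurable W"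
          by (intro borel_measurable_times borel_measurable_const borel_measurable_indicator new_cell_sets[OF u] mean')
      qed
      fix w assume "w \<in> space W"
      then have w: "w \<in> paths UNIV" by (simp add: space_P)
      show "indicat_real (D k) w \<le> 4 * (indicat_real (new_cell u n k) w * past_mean (grid n (Suc k)) ?g w)"
        using bd[OF w] past_mean_diff[OF g _ w, of "grid n (Suc k)"] by (cases "w \<in> D k") (auto simp: D indicator_def)
    qed
    also have "\<dots> = 4 * (\<integral>w. indicat_real (new_cell u n k) w * past_mean (grid n (Suc k)) ?g w \<partial>W)" by simp
    also have "(\<integral>w. indicat_real (new_cell u n k) w * past_mean (grid n (Suc k)) ?g w \<partial>W) = (\<integral>w. indicat_real (new_cell u n k) w * ?g w \<partial>W)"
      by (rule integral_past_mean[symmetric, OF new_cell_past[OF u] _ splice_continuousD(1)[OF g']])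
        (use splice_continuousD(2,3)[OF g'] in auto)
    finally show ?thesis .
  qed
  have "W.prob (\<Union>k\<in>{A..<B}. D k) \<le> (\<Sum>k\<in>{A..<B}. W.prob (D k))"
    by (rule W.finite_measure_subadditive_finite) (use DW in auto)
  also have "\<dots> \<le> (\<Sum>k\<in>{A..<B}. 4 * (\<integral>w. indicator (new_cell u n k) w * ?g w \<partial>W))"
    by (rule sum_mono[OF one])
  also have "\<dots> = 4 * (\<integral>w. (\<Sum>k\<in>{A..<B}. indicator (new_cell u n k) w * ?g w) \<partial>W)"
    using Bochner_Integration.integral_sum[OF integrable_splice_W[OF g' new_cell_sets[OF u, of n]], of "\<lambda>k. k" "{A..<B}"]
    by (simp add: sum_distrib_left)
  also have "\<dots> \<le> 4 * (\<integral>w. \<bar>indicator f w - g w\<bar> \<partial>W)"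
  proof (intro mult_left_mono integral_mono_AE)
    show "integrable W (\<lambda>w. \<Sum>k\<in>{A..<B}. indicator (new_cell u n k) w * ?g w)"
      by (rule Bochner_Integration.integrable_sum) (rule integrable_splice_W[OF g' new_cell_sets[OF u]])
    have "f \<in> sets W" unfolding f using crossed_sets[OF u] by (intro sets.Diff)
    then show "integrable W (\<lambda>w. \<bar>indicator f w - g w\<bar>)"
      by (intro W.integrable_const_bound[where B=1] AE_I2 splice_continuous_abs_diff_le[OF g] borel_measurable_abs
          borel_measurable_diff borel_measurable_indicator measurable_completion[OF splice_continuousD(1)[OF g]])
    show "AE w in W. (\<Sum>k\<in>{A..<B}. indicator (new_cell u n k) w * ?g w) \<le> \<bar>indicator f w - g w\<bar>"
      using crossed_grid_mono[OF u, of n]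
    proof eventually_elim
      case (elim w)
      have "indicat_real (new_cell u n k) w = indicator (crossed u (grid n (Suc k))) w - indicator (crossed u (grid n k)) w" for k
        using elim[rule_format, of k "Suc k"] by (auto simp: new_cell_def indicator_def)
      then have "(\<Sum>k\<in>{A..<B}. indicat_real (new_cell u n k) w) = indicator (crossed u (grid n B)) w - indicator (crossed u (grid n A)) w"
        using sum_Suc_diff'[of A B "\<lambda>k. indicat_real (crossed u (grid n k)) w"] by (simp add: A)
      also have "\<dots> = indicator f w"
        using elim[rule_format, of A B] unfolding gr f by (auto simp: indicator_def A)
      finally have "(\<Sum>k\<in>{A..<B}. indicat_real (new_cell u n k) w * ?g w) = indicator f w * ?g w"
        by (simp only: sum_distrib_right[symmetric])
      also have "\<dots> \<le> \<bar>indicator f w - g w\<bar>" by (simp add: indicator_def abs_ge_self)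
      finally show ?case .
    qed
  qed simp
  finally show "W.prob (\<Union>k\<in>{A..<B}. D k) \<le> 4 * (\<integral>w. \<bar>indicator f w - g w\<bar> \<partial>W)" .
qed

end

lemma sum_affine:
  fixes A B C d :: real
  shows "(\<Sum>i<m. A + B + C * (f i + d)) = real m * A + real m * B + C * (\<Sum>i<m. f i) + C * (real m * d)"
  by (induction m) (simp_all add: algebra_simps)

context splitting_time
begin

lemma integral_indicator_W:
  assumes "A \<in> sets W" shows "(\<integral>w. indicat_real A w \<partial>W) = measure W A"
  using assms sets.sets_into_space[OF assms] by (simp add: Int_absorb2)

text \<open>Crossings increase along the grid almost surely, so the indicators of the cells
  telescope.\<close>

lemma sum_prob_new_cell:
  assumes "0 \<le> u" shows "(\<Sum>a<m. measure W (new_cell u p a)) \<le> 1"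
proof -
  interpret W: prob_space W by (rule prob_space_W)
  have i: "integrable W (indicat_real (new_cell u p a))" for a
    using new_cell_sets[OF assms] by (intro integrable_real_indicator) (auto simp: W.emeasure_eq_measure)
  have "(\<Sum>a<m. measure W (new_cell u p a)) = (\<Sum>a<m. \<integral>w. indicat_real (new_cell u p a) w \<partial>W)"
    by (simp only: integral_indicator_W[OF new_cell_sets[OF assms]])
  also have "\<dots> = (\<integral>w. (\<Sum>a<m. indicat_real (new_cell u p a) w) \<partial>W)"
    by (rule Bochner_Integration.integral_sum[symmetric]) (rule i)
  also have "\<dots> \<le> (\<integral>w. 1 \<partial>W)"
  proof (rule integral_mono_AE)
    show "integrable W (\<lambda>w. \<Sum>a<m. indicat_real (new_cell u p a) w)"
      by (rule Bochner_Integration.integrable_sum) (rule i)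
    show "AE w in W. (\<Sum>a<m. indicat_real (new_cell u p a) w) \<le> 1"
      using crossed_grid_mono[OF assms, of p]
    proof eventually_elim
      case (elim w)
      have "indicat_real (new_cell u p a) w = indicator (crossed u (grid p (Suc a))) w - indicator (crossed u (grid p a)) w" for a
        using elim[rule_format, of a "Suc a"] by (auto simp: new_cell_def indicator_def)
      then have "(\<Sum>a<m. indicat_real (new_cell u p a) w) = indicator (crossed u (grid p m)) w - indicator (crossed u (grid p 0)) w"
        using sum_lessThan_telescope[of "\<lambda>k. indicat_real (crossed u (grid p k)) w" m] by simp
      then show ?case by (simp add: indicator_def)
    qed
  qed simp
  also have "\<dots> = 1" by (simp only: lebesgue_integral_const W.prob_space scaleR_one)
  finally show ?thesis .
qed

text \<open>The first grid time in the window at which the conditional probability of a crossing exceeds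
  one half announces the crossing: unless the martingale jumps or is badly approximated, it comes
  before the cell of the crossing, and a \<open>T x\<close> in that cell is at most \<open>1 / 2^p\<close> later.\<close>

lemma window_bound:
  assumes u: "0 \<le> u" and g: "splice_continuous g" and np: "p \<le> n" and t: "1 / 2^p \<le> t" "grid p (Suc a) + t \<le> x"
    and \<eta>: "(\<integral>w. \<bar>indicator (new_cell u p a) w - g w\<bar> \<partial>W) < \<eta>"
    and q: "q = measure W {w \<in> space W. T t w < 1 / 2^p}"
  shows "\<exists>R\<in>sets W. measure W R \<le> measure W (large_steps g (Suc a) n) + 4 * \<eta> + 2 * q * (measure W (new_cell u p a) + \<eta>) \<and>
    (AE w in W. \<forall>k\<in>{a * 2^(n-p)..<Suc a * 2^(n-p)}.
       w \<in> new_cell u n k \<and> grid n k < T x w \<and> T x w < grid n (Suc k) \<longrightarrow> w \<in> R)"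
proof -
  interpret W: prob_space W by (rule prob_space_W)
  let ?A = "a * 2^(n-p)" and ?B = "Suc a * 2^(n-p)"
  have tpos: "0 < t" using t(1) by (rule less_le_trans[rotated]) simp
  have gr: "grid n ?B = grid p (Suc a)" "grid n ?A = grid p a" by (rule grid_refine[OF np])+
  \<comment> \<open>The event that a restart of length t finds its value within one coarse mesh. Its
    probability q makes the bound small.\<close>
  define Q where "Q = {w \<in> space W. T t w < 1 / 2^p}"
  have Q: "Q \<in> sets (incr_field W 0 \<infinity>)"
  proof -
    have "T t -` {..<1 / 2^p} \<inter> space (incr_field W 0 \<infinity>) \<in> sets (incr_field W 0 \<infinity>)"
      by (rule measurable_sets[OF T_future_measurable[OF tpos]]) simp
    moreover have "T t -` {..<1 / 2^p} \<inter> space (incr_field W 0 \<infinity>) = Q" by (auto simp: Q_def)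
    ultimately show ?thesis by (simp only:)
  qed
  define S where "S j = {w \<in> space W. past_mean (grid n j) g w > 1/2 \<and> (\<forall>i\<in>{?A..<j}. past_mean (grid n i) g w \<le> 1/2)}" for j
  define D where "D k = {w \<in> new_cell u n k. past_mean (grid n (Suc k)) g w \<le> 3/4}" for k
  have mono: "mono (\<lambda>j. grid n j)" by (auto simp: mono_def divide_right_mono)
  have g0: "0 \<le> grid n j" for j by simp
  note fp = first_passage[OF g g0 mono Q S_def]
  note lm = low_mean_at_new_cell[OF u g np new_cell_def[of u p a] refl refl D_def]
  let ?H = "\<Union>j\<in>{?A..<?B}. S j \<inter> (levy_shift (grid n j) -` Q \<inter> space W)"
  let ?V = "large_steps g (Suc a) n"
  have V: "?V \<in> sets W" by (rule large_steps_sets[OF g])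
  have H: "?H \<in> sets W" using fp(2) by (intro sets.finite_UN) auto
  have L: "(\<Union>k\<in>{?A..<?B}. D k) \<in> sets W" using lm(2) by (intro sets.finite_UN) auto
  \<comment> \<open>The three ways to fail: the conditional mean makes a large step, it is too low
    although the crossing has happened, or a value follows at once upon the first passage.\<close>
  have "W.prob (?V \<union> (\<Union>k\<in>{?A..<?B}. D k) \<union> ?H) \<le> W.prob ?V + W.prob (\<Union>k\<in>{?A..<?B}. D k) + W.prob ?H"
    using measure_Un_le[OF sets.Un[OF V L] H] measure_Un_le[OF V L] by linarith
  moreover have "W.prob (\<Union>k\<in>{?A..<?B}. D k) \<le> 4 * \<eta>" using lm(1) \<eta> by linarith
  moreover have "W.prob ?H \<le> 2 * q * (measure W (new_cell u p a) + \<eta>)"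
  proof -
    have gi: "integrable W g"
    proof (rule W.integrable_const_bound[where B=1])
      show "AE w in W. norm (g w) \<le> 1" using splice_continuousD(2,3)[OF g] by (intro AE_I2) simp
    qed (rule measurable_completion[OF splice_continuousD(1)[OF g]])
    have fi: "integrable W (indicat_real (new_cell u p a))"
      using new_cell_sets[OF u] by (intro integrable_real_indicator) (auto simp: W.emeasure_eq_measure)
    have di: "integrable W (\<lambda>w. \<bar>indicat_real (new_cell u p a) w - g w\<bar>)"
      by (intro integrable_abs Bochner_Integration.integrable_diff gi fi)
    have "(\<integral>w. g w \<partial>W) \<le> (\<integral>w. indicat_real (new_cell u p a) w + \<bar>indicat_real (new_cell u p a) w - g w\<bar> \<partial>W)"
    proof (rule integral_mono[OF gi Bochner_Integration.integrable_add[OF fi di]])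
      fix w
      show "g w \<le> indicat_real (new_cell u p a) w + \<bar>indicat_real (new_cell u p a) w - g w\<bar>" by linarith
    qed
    also have "\<dots> = measure W (new_cell u p a) + (\<integral>w. \<bar>indicat_real (new_cell u p a) w - g w\<bar> \<partial>W)"
      by (simp only: Bochner_Integration.integral_add[OF fi di] integral_indicator_W[OF new_cell_sets[OF u]])
    finally have "(\<integral>w. g w \<partial>W) \<le> measure W (new_cell u p a) + \<eta>" using \<eta> by linarith
    then have "2 * q * (\<integral>w. g w \<partial>W) \<le> 2 * q * (measure W (new_cell u p a) + \<eta>)"
      by (intro mult_left_mono) (simp_all add: q)
    moreover have "W.prob ?H \<le> 2 * W.prob Q * (\<integral>w. g w \<partial>W)" by (rule fp(1))
    moreover have "W.prob Q = q" by (simp only: q Q_def)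
    ultimately show ?thesis by (simp only:)
  qed
  moreover have "AE w in W. \<forall>k\<in>{?A..<?B}. w \<in> new_cell u n k \<and> grid n k < T x w \<and> T x w < grid n (Suc k) \<longrightarrow>
      w \<in> ?V \<union> (\<Union>k\<in>{?A..<?B}. D k) \<union> ?H"
  proof -
    have "AE w in W. \<forall>j. grid n j + t \<le> x \<longrightarrow> (grid n j < T x w \<and> T x w < grid n j + t \<longrightarrow> T x w = grid n j + T t (levy_shift (grid n j) w))"
      by (intro AE_all_imp T_nested) (use tpos in auto)
    then show ?thesis using AE_space[of W]
    proof eventually_elim
      case (elim w)
      show ?case
      proof (intro ballI impI)
        fix k assume k: "k \<in> {?A..<?B}" and w: "w \<in> new_cell u n k \<and> grid n k < T x w \<and> T x w < grid n (Suc k)"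
        let ?N = "\<lambda>j. past_mean (grid n j) g w"
        show "w \<in> ?V \<union> (\<Union>k\<in>{?A..<?B}. D k) \<union> ?H"
        proof (cases "\<bar>?N (Suc k) - ?N k\<bar> > 1/4")
          case True
          have "k < Suc a * 2^(n-p)" using k by simp
          also have "\<dots> \<le> Suc a * 2^n" by (intro mult_le_mono2 power_increasing) auto
          finally have "w \<in> ?V" unfolding large_steps_def using True elim(2) by blast
          then show ?thesis by blast
        next
          case False
          show ?thesis
          proof (cases "?N (Suc k) \<le> 3/4")
            case True
            then have "w \<in> D k" using w by (simp add: D_def)
            then show ?thesis using k by blast
          next
            case nle: False
            \<comment> \<open>The conditional mean is above 3/4 at the end of the cell and makes no
              step larger than 1/4, so it exceeds 1/2 at the start of the cell. Hence the first
              passage index \<open>j\<close> is at most k, and the passage precedes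
              \<open>T x\<close>.\<close>
            then have Nk: "?N k > 1/2" using False by linarith
            define j where "j = (LEAST j. ?A \<le> j \<and> ?N j > 1/2)"
            have j: "?A \<le> j \<and> ?N j > 1/2" unfolding j_def by (rule LeastI[of _ k]) (use k Nk in simp)
            have jk: "j \<le> k" unfolding j_def by (rule Least_le) (use k Nk in simp)
            have "?N i \<le> 1/2" if "i \<in> {?A..<j}" for i
              using not_less_Least[of i "\<lambda>j. ?A \<le> j \<and> ?N j > 1/2"] that unfolding j_def by auto
            then have Sj: "w \<in> S j" unfolding S_def using j elim(2) by blast
            have jB: "j \<in> {?A..<?B}" using j jk k by auto
            have jT: "grid n j < T x w" using w jk by (meson divide_right_mono le_less_trans of_nat_le_iff zero_le_numeral zero_le_power)
            have kB: "grid n (Suc k) \<le> grid p (Suc a)"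
            proof -
              have "real (Suc k) \<le> real ?B" using k by (simp only: of_nat_le_iff) simp
              then have "grid n (Suc k) \<le> grid n ?B" by (rule divide_right_mono) simp
              then show ?thesis by (simp only: gr)
            qed
            have Aj: "grid p a \<le> grid n j"
            proof -
              have "real ?A \<le> real j" using j by (simp only: of_nat_le_iff)
              then have "grid n ?A \<le> grid n j" by (rule divide_right_mono) simp
              then show ?thesis by (simp only: gr)
            qed
            have pa: "grid p (Suc a) = grid p a + 1 / 2^p" by (simp add: add_divide_distrib)
            \<comment> \<open>The passage and \<open>T x\<close> lie in one window of length 1 /
              2^p. As this is at most t, \<open>T x\<close> is found by the restart of length
              t.\<close>
            have lt: "T x w < grid n j + 1 / 2^p" using w kB Aj pa by linarith
            have "j \<le> ?B" using jB by simp
            then have "grid n j \<le> grid n ?B" by (intro divide_right_mono) (simp_all only: of_nat_le_iff, simp)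
            then have "grid n j + t \<le> x" using t(2) unfolding gr by linarith
            then have "T x w = grid n j + T t (levy_shift (grid n j) w)"
              using elim(1) jT lt t(1) by (meson add_left_mono less_le_trans)
            then have "T t (levy_shift (grid n j) w) < 1 / 2^p" using lt by linarith
            then have "levy_shift (grid n j) w \<in> Q"
              unfolding Q_def using levy_shift_paths elim(2) by (simp add: space_P)
            then show ?thesis using Sj jB elim(2) by blast
          qed
        qed
      qed
    qed
  qed
  ultimately show ?thesis
    using V L H by (intro bexI[of _ "?V \<union> (\<Union>k\<in>{?A..<?B}. D k) \<union> ?H"] conjI) (linarith | assumption | (intro sets.Un; assumption))+
qed

text \<open>The order of the choices matters: t, so that \<open>T x\<close> is rarely within 3 * t
  of x; the coarse level p, so that \<open>T t\<close> is rarely below 1 / 2^p; then, the number of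
  windows being fixed, functionals with error below \<eta>; last the fine level n, so that large
  steps are rare. Up to a multiple of \<eta>, the small number q is weighted with the probabilities
  of crossing in the single windows. These sum to at most 1, so the number of windows does not enter
  and p can be chosen first.\<close>

lemma missed_tendsto:
  assumes u: "0 \<le> u" and x: "0 < x"
  shows "(\<lambda>n. measure W (missed u x n)) \<longlonglongrightarrow> 0"
proof (rule LIMSEQ_I)
  interpret W: prob_space W by (rule prob_space_W)
  fix \<epsilon> :: real assume \<epsilon>: "0 < \<epsilon>"
  have inv0: "(\<lambda>m. 3 / real (Suc m)) \<longlonglongrightarrow> 0"
    using tendsto_mult_right_zero[OF LIMSEQ_inverse_real_of_nat, of 3] by (simp add: divide_inverse)
  have "(\<lambda>m. measure W {w \<in> space W. x - 3 / real (Suc m) < T x w}) \<longlonglongrightarrow> 0"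
  proof (rule W.measure_eventually_notin)
    show "{w \<in> space W. x - 3 / real (Suc m) < T x w} \<in> sets W" for m
      using T_measurable_W[OF x] by measurable
    show "AE w in W. \<forall>\<^sub>F m in sequentially. w \<notin> {w \<in> space W. x - 3 / real (Suc m) < T x w}"
      using T_range[OF x]
    proof eventually_elim
      case (elim w)
      then have "\<forall>\<^sub>F m in sequentially. 3 / real (Suc m) < x - T x w" by (intro order_tendstoD(2)[OF inv0]) simp
      then show ?case by (rule eventually_mono) simp
    qed
  qed
  then have "\<forall>\<^sub>F m in sequentially. measure W {w \<in> space W. x - 3 / real (Suc m) < T x w} < \<epsilon> / 4"
    by (rule order_tendstoD) (use \<epsilon> in simp)
  then obtain m0 where m0: "measure W {w \<in> space W. x - 3 / real (Suc m0) < T x w} < \<epsilon> / 4"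
    using eventually_happens'[OF sequentially_bot] by blast
  define t where "t = 1 / real (Suc m0)"
  have t: "0 < t" by (simp add: t_def)
  have t3: "3 / real (Suc m0) = 3 * t" by (simp add: t_def)
  have "(\<lambda>p. measure W {w \<in> space W. T t w < 1 / 2^p}) \<longlonglongrightarrow> 0"
  proof (rule W.measure_eventually_notin)
    show "{w \<in> space W. T t w < 1 / 2^p} \<in> sets W" for p
      using T_measurable_W[OF t] by measurable
    show "AE w in W. \<forall>\<^sub>F p in sequentially. w \<notin> {w \<in> space W. T t w < 1 / 2^p}"
      using T_range[OF t]
    proof eventually_elim
      case (elim w)
      then have "\<forall>\<^sub>F p in sequentially. 1 / 2^p < T t w" by (intro order_tendstoD(2)[OF inverse_power_tendsto]) simp
      then show ?case by (rule eventually_mono) simp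
    qed
  qed
  then have "\<forall>\<^sub>F p in sequentially. measure W {w \<in> space W. T t w < 1 / 2^p} < \<epsilon> / 16"
    by (rule order_tendstoD) (use \<epsilon> in simp)
  moreover have "\<forall>\<^sub>F p in sequentially. 1 / 2^p < t" by (rule order_tendstoD(2)[OF inverse_power_tendsto t])
  ultimately have "\<forall>\<^sub>F p in sequentially. measure W {w \<in> space W. T t w < 1 / 2^p} < \<epsilon> / 16 \<and> 1 / 2^p < t"
    by (rule eventually_conj)
  then obtain p where p: "measure W {w \<in> space W. T t w < 1 / 2^p} < \<epsilon> / 16" "1 / 2^p < t"
    using eventually_happens'[OF sequentially_bot] by blast
  define q where "q = measure W {w \<in> space W. T t w < 1 / 2^p}"
  \<comment> \<open>A bound for the number of windows of length 1 / 2^p that begin before x.\<close>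
  define m where "m = nat \<lceil>x * 2^p\<rceil>"
  define \<eta> where "\<eta> = \<epsilon> / (24 * real (Suc m))"
  have \<eta>: "0 < \<eta>" using \<epsilon> by (simp add: \<eta>_def)
  have "\<forall>a. \<exists>g. splice_continuous g \<and> (\<integral>w. \<bar>indicator (new_cell u p a) w - g w\<bar> \<partial>W) < \<eta>"
  proof
    fix a
    obtain g where "splice_continuous g" "(\<integral>w. \<bar>indicator (new_cell u p a) w - g w\<bar> \<partial>W) < \<eta>"
      by (rule splice_continuous_approx[OF new_cell_sets[OF u] \<eta>])
    then show "\<exists>g. splice_continuous g \<and> (\<integral>w. \<bar>indicator (new_cell u p a) w - g w\<bar> \<partial>W) < \<eta>" by blast
  qed
  from choice[OF this] obtain g where g0: "\<forall>a. splice_continuous (g a) \<and> (\<integral>w. \<bar>indicator (new_cell u p a) w - g a w\<bar> \<partial>W) < \<eta>" ..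
  have g: "splice_continuous (g a)" "(\<integral>w. \<bar>indicator (new_cell u p a) w - g a w\<bar> \<partial>W) < \<eta>" for a using g0 by blast+
  let ?V = "\<lambda>a n. large_steps (g a) (Suc a) n"
  have "\<forall>\<^sub>F n in sequentially. \<forall>a\<in>{..<m}. measure W (?V a n) < \<epsilon> / (4 * real (Suc m))"
    by (intro eventually_ball_finite ballI order_tendstoD(2)[OF large_steps_tendsto[OF g(1)]]) (use \<epsilon> in auto)
  then obtain n0 where n0: "\<And>n. n0 \<le> n \<Longrightarrow> \<forall>a\<in>{..<m}. measure W (?V a n) < \<epsilon> / (4 * real (Suc m))"
    unfolding eventually_sequentially by blast
  show "\<exists>no. \<forall>n\<ge>no. norm (measure W (missed u x n) - 0) < \<epsilon>"
  proof (intro exI[of _ "max n0 p"] allI impI)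
    fix n assume n: "max n0 p \<le> n"
    define I where "I = {a \<in> {..<m}. grid p (Suc a) + t \<le> x}"
    have I: "finite I" "I \<subseteq> {..<m}" by (auto simp: I_def)
    let ?ae = "\<lambda>a R. AE w in W. \<forall>k\<in>{a * 2^(n-p)..<Suc a * 2^(n-p)}. w \<in> new_cell u n k \<and> grid n k < T x w \<and> T x w < grid n (Suc k) \<longrightarrow> w \<in> R"
    let ?le = "\<lambda>a R. measure W R \<le> measure W (?V a n) + 4 * \<eta> + 2 * q * (measure W (new_cell u p a) + \<eta>)"
    have "\<forall>a\<in>I. \<exists>R. R \<in> sets W \<and> ?le a R \<and> ?ae a R"
    proof
      fix a assume a: "a \<in> I"
      have 1: "p \<le> n" using n by simp
      have 2: "1 / 2^p \<le> t" using p(2) by simp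
      have 3: "grid p (Suc a) + t \<le> x" using a by (simp add: I_def)
      show "\<exists>R. R \<in> sets W \<and> ?le a R \<and> ?ae a R"
        using window_bound[OF u g(1) 1 2 3 g(2) q_def] by (simp only: Bex_def)
    qed
    from bchoice[OF this] obtain R where R0: "\<forall>a\<in>I. R a \<in> sets W \<and> ?le a (R a) \<and> ?ae a (R a)" ..
    have R: "R a \<in> sets W" "?le a (R a)" "?ae a (R a)" if "a \<in> I" for a using R0 that by blast+
    let ?E = "{w \<in> space W. x - 3 * t < T x w}"
    have E: "?E \<in> sets W" using T_measurable_W[OF x] by measurable
    have UR: "(\<Union>a\<in>I. R a) \<in> sets W" using R(1) I(1) by (intro sets.finite_UN) auto
    have AER: "AE w in W. \<forall>a\<in>I. \<forall>k\<in>{a * 2^(n-p)..<Suc a * 2^(n-p)}. w \<in> new_cell u n k \<and> grid n k < T x w \<and> T x w < grid n (Suc k) \<longrightarrow> w \<in> R a"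
      by (rule AE_finite_allI[OF I(1) R(3)])
    \<comment> \<open>Without atoms at grid times, \<open>T x\<close> lies strictly inside a
      cell.\<close>
    have AEatom: "AE w in W. \<forall>k. 0 < grid n k \<and> grid n k < x \<longrightarrow> T x w \<noteq> grid n k"
      by (rule AE_all_imp, rule T_no_atom) auto
    have AEpre: "AE w in W. \<forall>k. 0 < grid n k \<and> grid n k < x \<longrightarrow> (T x w < grid n k \<longrightarrow> T x w = T (grid n k) w)"
      by (rule AE_all_imp, rule T_prefix) auto
    have AEjump: "AE w in W. \<forall>k. w \<in> crossed u (grid n (Suc k)) \<and> w \<notin> crossed u (grid n k) \<longrightarrow> grid n k \<le> T (grid n (Suc k)) w"
    proof -
      have "AE w in W. w \<in> crossed u (grid n (Suc k)) \<and> w \<notin> crossed u (grid n k) \<longrightarrow> grid n k \<le> T (grid n (Suc k)) w" for k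
        by (rule crossed_jump[OF u]) (auto simp: divide_right_mono)
      then show ?thesis unfolding AE_all_countable by blast
    qed
    have pn: "p \<le> n" using n by simp
    have h: "1 / 2^n \<le> (1 / 2^p :: real)" using n by (intro divide_left_mono power_increasing) auto
    have "AE w in W. w \<in> missed u x n \<longrightarrow> w \<in> ?E \<union> (\<Union>a\<in>I. R a)"
      using T_range[OF x] AER AEatom AEpre AEjump AE_space[of W]
    proof eventually_elim
      case (elim w)
      show ?case
      proof
        assume "w \<in> missed u x n"
        then obtain k where k: "grid n (Suc k) < x" "w \<in> new_cell u n k" "T x w \<le> grid n (Suc k)" by (auto simp: missed_def)
        have pos: "0 < grid n (Suc k)" by simp
        have "T x w \<noteq> grid n (Suc k)" using elim(3) k(1) pos by blast
        then have lt: "T x w < grid n (Suc k)" using k(3) by linarith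
        then have eq: "T x w = T (grid n (Suc k)) w" using elim(4) k(1) pos by blast
        \<comment> \<open>The value after the crossing cannot land to the left of the cell, so a
          missed \<open>T x\<close> lies in the cell of the crossing itself.\<close>
        have "grid n k \<le> T x w" unfolding eq using elim(5) k(2) by (simp add: new_cell_def)
        moreover have gs: "grid n (Suc k) = grid n k + 1 / 2^n" by (simp add: add_divide_distrib)
        then have gkx: "grid n k < x" using k(1) by (smt (verit) divide_nonneg_nonneg zero_le_power)
        have "T x w \<noteq> grid n k"
        proof (cases "k = 0")
          case True then show ?thesis using elim(1) by simp
        next
          case False
          then have "0 < grid n k" by simp
          then show ?thesis using elim(3) gkx by blast
        qed
        ultimately have gt: "grid n k < T x w" by linarith
        \<comment> \<open>If the cell ends after x - 2 * t, then \<open>T x\<close> exceeds x - 3 *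
          t, the cell being shorter than t. Otherwise the coarse window containing the cell starts
          at least 2 * t before x, and after its end there is room for a restart of length
          t.\<close>
        show "w \<in> ?E \<union> (\<Union>a\<in>I. R a)"
        proof (cases "x - 2 * t < grid n (Suc k)")
          case True
          then have "x - 3 * t < T x w" using gt gs h p(2) by linarith
          then show ?thesis using elim(6) by blast
        next
          case False
          define a where "a = k div 2^(n-p)"
          have ka: "k \<in> {a * 2^(n-p)..<Suc a * 2^(n-p)}"
            unfolding a_def by (simp add: dividend_less_div_times)
          have "grid p a \<le> grid n k"
          proof -
            have "real (a * 2^(n-p)) \<le> real k" using ka by (simp only: of_nat_le_iff) simp
            then have "grid n (a * 2^(n-p)) \<le> grid n k" by (rule divide_right_mono) simp
            then show ?thesis by (simp only: grid_refine[OF pn])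
          qed
          then have le: "grid p a \<le> x - 2 * t" and lx: "grid p a < x" using False gs gkx by (smt (verit) divide_nonneg_nonneg zero_le_power)+
          have "grid p (Suc a) + t \<le> x" using le p(2) by (simp add: add_divide_distrib)
          moreover have "a < m"
          proof -
            have "real a < x * 2^p" using lx by (simp add: divide_less_eq)
            also have "\<dots> \<le> real m" unfolding m_def by (rule real_nat_ceiling_ge)
            finally show ?thesis by simp
          qed
          ultimately have "a \<in> I" by (simp add: I_def)
          then show ?thesis using elim(2) ka k(2) gt lt by blast
        qed
      qed
    qed
    then have "measure W (missed u x n) \<le> measure W (?E \<union> (\<Union>a\<in>I. R a))"
      by (rule W.finite_measure_mono_AE) (rule sets.Un[OF E UR])
    also have "\<dots> \<le> measure W ?E + (\<Sum>a\<in>I. measure W (R a))"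
    proof -
      have "measure W (\<Union>a\<in>I. R a) \<le> (\<Sum>a\<in>I. measure W (R a))"
        by (rule W.finite_measure_subadditive_finite[OF I(1)]) (use R(1) in auto)
      then show ?thesis using measure_Un_le[OF E UR] by linarith
    qed
    also have "(\<Sum>a\<in>I. measure W (R a)) \<le> (\<Sum>a\<in>I. \<epsilon> / (4 * real (Suc m)) + 4 * \<eta> + 2 * q * (measure W (new_cell u p a) + \<eta>))"
    proof (rule sum_mono)
      fix a assume a: "a \<in> I"
      then have "a \<in> {..<m}" using I(2) by blast
      then have "measure W (?V a n) < \<epsilon> / (4 * real (Suc m))" using n0[of n] n by (simp only: max.bounded_iff)
      then show "measure W (R a) \<le> \<epsilon> / (4 * real (Suc m)) + 4 * \<eta> + 2 * q * (measure W (new_cell u p a) + \<eta>)"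
        using R(2)[OF a] by linarith
    qed
    also have "\<dots> \<le> (\<Sum>a<m. \<epsilon> / (4 * real (Suc m)) + 4 * \<eta> + 2 * q * (measure W (new_cell u p a) + \<eta>))"
    proof (rule sum_mono2[OF finite_lessThan I(2)])
      fix a
      have "0 \<le> q" "0 \<le> measure W (new_cell u p a) + \<eta>" using \<eta> by (simp_all add: q_def)
      then have "0 \<le> 2 * q * (measure W (new_cell u p a) + \<eta>)" by (intro mult_nonneg_nonneg) simp_all
      moreover have "0 \<le> \<epsilon> / (4 * real (Suc m))" using \<epsilon> by simp
      ultimately show "0 \<le> \<epsilon> / (4 * real (Suc m)) + 4 * \<eta> + 2 * q * (measure W (new_cell u p a) + \<eta>)"
        using \<eta> by linarith
    qed
    also have "\<dots> = real m * (\<epsilon> / (4 * real (Suc m))) + real m * (4 * \<eta>) + 2 * q * (\<Sum>a<m. measure W (new_cell u p a)) + 2 * q * (real m * \<eta>)"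
      by (rule sum_affine)
    \<comment> \<open>Together with \<epsilon> / 4 for values near x the total is 7/8 of \<epsilon>;
      the constants 24 in \<eta> and 16 in the choice of p come from here.\<close>
    also have "\<dots> \<le> \<epsilon> / 4 + \<epsilon> / 6 + 2 * (\<epsilon> / 16) + 2 * (\<epsilon> / 24)"
    proof -
      have q: "0 \<le> q" "q \<le> 1" "q < \<epsilon> / 16" using p(1) by (simp_all add: q_def)
      have f: "real m / real (Suc m) \<le> 1" by simp
      have "real m * (\<epsilon> / (4 * real (Suc m))) = (real m / real (Suc m)) * (\<epsilon> / 4)" by simp
      also have "\<dots> \<le> 1 * (\<epsilon> / 4)" by (rule mult_right_mono[OF f]) (use \<epsilon> in simp)
      finally have 1: "real m * (\<epsilon> / (4 * real (Suc m))) \<le> \<epsilon> / 4" by simp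
      have "real m * \<eta> = (real m / real (Suc m)) * (\<epsilon> / 24)" by (simp add: \<eta>_def)
      also have "\<dots> \<le> 1 * (\<epsilon> / 24)" by (rule mult_right_mono[OF f]) (use \<epsilon> in simp)
      finally have 2: "real m * \<eta> \<le> \<epsilon> / 24" by simp
      have 3: "q * (\<Sum>a<m. measure W (new_cell u p a)) \<le> (\<epsilon> / 16) * 1"
        by (rule mult_mono) (use q \<epsilon> sum_prob_new_cell[OF u] in \<open>auto intro: sum_nonneg\<close>)
      have "q * (real m * \<eta>) \<le> 1 * (real m * \<eta>)" by (rule mult_right_mono) (use q \<eta> in auto)
      then have 4: "q * (real m * \<eta>) \<le> \<epsilon> / 24" using 2 by linarith
      show ?thesis using 1 2 3 4 by linarith
    qed
    finally have "measure W (missed u x n) < \<epsilon>" using m0 \<epsilon> unfolding t3 by linarith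
    then show "norm (measure W (missed u x n) - 0) < \<epsilon>" by simp
  qed
qed

end

section \<open>The independent exponential time\<close>

lemma space_exp_law [simp]: "space (exp_law l) = {0<..}"
  by (simp add: exp_law_def space_restrict_space)

lemma sets_exp_law: "sets (exp_law l) = sets (restrict_space borel {0<..})"
  unfolding exp_law_def by (rule sets_restrict_space_cong) simp

lemma nn_integral_exp_law:
  assumes "f \<in> borel_measurable (exp_law l)"
  shows "(\<integral>\<^sup>+x. f x \<partial>exp_law l) = (\<integral>\<^sup>+x. ennreal (exponential_density l x) * (f x * indicator {0<..} x) \<partial>lborel)"
proof -
  have f: "(\<lambda>x. f x * indicator {0<..} x) \<in> borel_measurable borel"
    using assms unfolding measurable_cong_sets[OF sets_exp_law refl] by (simp add: borel_measurable_restrict_space_iff_ennreal)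
  have "(\<integral>\<^sup>+x. f x \<partial>exp_law l) = (\<integral>\<^sup>+x. f x * indicator {0<..} x \<partial>density lborel (\<lambda>x. ennreal (exponential_density l x)))"
    unfolding exp_law_def by (rule nn_integral_restrict_space) simp
  also have "\<dots> = (\<integral>\<^sup>+x. ennreal (exponential_density l x) * (f x * indicator {0<..} x) \<partial>lborel)"
    by (rule nn_integral_density) (use f in auto)
  finally show ?thesis .
qed

lemma prob_space_exp_law:
  assumes "0 < l" shows "prob_space (exp_law l)"
proof
  interpret D: prob_space "density lborel (\<lambda>x. ennreal (exponential_density l x))"
    by (rule prob_space_exponential_density[OF assms])
  have "emeasure (exp_law l) {0<..} = emeasure (density lborel (\<lambda>x. ennreal (exponential_density l x))) {0<..}"
    unfolding exp_law_def by (rule emeasure_restrict_space) auto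
  also have "\<dots> = emeasure (density lborel (\<lambda>x. ennreal (exponential_density l x))) UNIV"
  proof (rule emeasure_eq_AE)
    show "AE x in density lborel (\<lambda>x. ennreal (exponential_density l x)). x \<in> {0<..} \<longleftrightarrow> x \<in> UNIV"
    proof (subst AE_density)
      show "AE x in lborel. 0 < ennreal (exponential_density l x) \<longrightarrow> (x \<in> {0<..} \<longleftrightarrow> x \<in> UNIV)"
        using AE_lborel_singleton[of 0] by eventually_elim (simp add: exponential_density_def)
    qed simp
  qed auto
  also have "\<dots> = 1" using D.emeasure_space_1 by simp
  finally show "emeasure (exp_law l) (space (exp_law l)) = 1" by simp
qed

text \<open>The time left after s. The value 1 for x \<le> s is a placeholder that keeps the map
  inside (0, \<infinity>), where \<open>exp_law\<close> lives.\<close>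

definition lapse :: "real \<Rightarrow> real \<Rightarrow> real" where
  "lapse s x = (if s < x then x - s else 1)"

lemma measurable_lapse: "lapse s \<in> exp_law l \<rightarrow>\<^sub>M exp_law l"
proof -
  have "lapse s \<in> restrict_space borel {0<..} \<rightarrow>\<^sub>M restrict_space borel {0<..}"
  proof (rule measurable_restrict_space2)
    have "lapse s \<in> borel_measurable borel" unfolding lapse_def by measurable
    then show "lapse s \<in> borel_measurable (restrict_space borel {0<..})" by (rule measurable_restrict_space1)
  qed (auto simp: lapse_def)
  then show ?thesis unfolding measurable_cong_sets[OF sets_exp_law sets_exp_law] .
qed

text \<open>Substitute x = s + y: the density at s + y is \<open>exp (- s * l)\<close> times the
  density at y.\<close>

lemma exp_law_memoryless:
  assumes f: "f \<in> borel_measurable (exp_law l)" and s: "0 \<le> s"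
  shows "(\<integral>\<^sup>+x. indicator {s<..} x * f (lapse s x) \<partial>exp_law l) = ennreal (exp (- s * l)) * (\<integral>\<^sup>+x. f x \<partial>exp_law l)"
proof -
  let ?F = "\<lambda>x. f x * indicator {0<..} x"
  have F: "?F \<in> borel_measurable borel"
    using f unfolding measurable_cong_sets[OF sets_exp_law refl] by (simp add: borel_measurable_restrict_space_iff_ennreal)
  have ind: "(\<lambda>x. indicator {s<..} x * f (lapse s x)) \<in> borel_measurable (exp_law l)"
  proof (rule borel_measurable_times_ennreal)
    show "(\<lambda>x. f (lapse s x)) \<in> borel_measurable (exp_law l)" by (rule measurable_compose[OF measurable_lapse f])
    have "indicator {s<..} \<in> borel_measurable (borel :: real measure)" by (rule borel_measurable_indicator) simp
    then show "indicator {s<..} \<in> borel_measurable (exp_law l)"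
      unfolding measurable_cong_sets[OF sets_exp_law refl] by (rule measurable_restrict_space1)
  qed
  have F'': "?F \<in> borel_measurable lborel" using F by simp
  have F': "(\<lambda>x. ennreal (exponential_density l x) * ?F (x - s)) \<in> borel_measurable borel"
    by (intro borel_measurable_times_ennreal measurable_compose[OF _ F] measurable_compose[OF _ measurable_ennreal]) auto
  have "(\<integral>\<^sup>+x. indicator {s<..} x * f (lapse s x) \<partial>exp_law l) = (\<integral>\<^sup>+x. ennreal (exponential_density l x) * ((indicator {s<..} x * f (lapse s x)) * indicator {0<..} x) \<partial>lborel)"
    by (rule nn_integral_exp_law[OF ind])
  also have "\<dots> = (\<integral>\<^sup>+x. ennreal (exponential_density l x) * ?F (x - s) \<partial>lborel)"
    by (rule nn_integral_cong) (use s in \<open>auto simp: lapse_def indicator_def\<close>)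
  also have "\<dots> = (\<integral>\<^sup>+y. ennreal (exponential_density l (s + 1 * y)) * ?F (s + 1 * y - s) \<partial>lborel)"
    using nn_integral_real_affine[OF F', of 1 s] by simp
  also have "\<dots> = (\<integral>\<^sup>+y. ennreal (exp (- s * l)) * (ennreal (exponential_density l y) * ?F y) \<partial>lborel)"
  proof (rule nn_integral_cong)
    fix y :: real
    show "ennreal (exponential_density l (s + 1 * y)) * ?F (s + 1 * y - s) = ennreal (exp (- s * l)) * (ennreal (exponential_density l y) * ?F y)"
    proof (cases "0 < y")
      case True
      then have "exponential_density l (s + y) = exp (- s * l) * exponential_density l y"
        using s by (simp add: exponential_density_def exp_add[symmetric] algebra_simps)
      then show ?thesis by (simp add: ennreal_mult' mult.assoc)
    qed simp
  qed
  also have "\<dots> = ennreal (exp (- s * l)) * (\<integral>\<^sup>+y. ennreal (exponential_density l y) * ?F y \<partial>lborel)"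
    by (rule nn_integral_cmult) (rule borel_measurable_times_ennreal[OF _ F'' ], simp)
  also have "(\<integral>\<^sup>+y. ennreal (exponential_density l y) * ?F y \<partial>lborel) = (\<integral>\<^sup>+x. f x \<partial>exp_law l)"
    by (rule nn_integral_exp_law[OF f, symmetric])
  finally show ?thesis .
qed

section \<open>Integration over the exponential time\<close>

locale exp_splitting_time = splitting_time P T for P T +
  fixes l :: real
  assumes l_pos: "0 < l"
    and T_joint: "(\<lambda>(w, x). T x w) \<in> borel_measurable (with_exp (completion P) l)"
    and T_nonneg: "0 < x \<Longrightarrow> w \<in> space (completion P) \<Longrightarrow> 0 \<le> T x w"
begin

abbreviation W_exp :: "((real \<Rightarrow> real) \<times> real) measure" where "W_exp \<equiv> with_exp W l"

lemma pair_prob: "pair_prob_space W (exp_law l)"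
proof -
  interpret W: prob_space W by (rule prob_space_W)
  interpret E: prob_space "exp_law l" by (rule prob_space_exp_law[OF l_pos])
  show ?thesis ..
qed

lemma prob_space_W_exp: "prob_space W_exp"
proof -
  interpret pair_prob_space W "exp_law l" by (rule pair_prob)
  show ?thesis unfolding with_exp_def by (rule prob_space_axioms)
qed

lemma space_W_exp: "space W_exp = space W \<times> {0<..}"
  by (simp add: with_exp_def space_pair_measure)

definition fibre :: "((real \<Rightarrow> real) \<times> real) set \<Rightarrow> real \<Rightarrow> (real \<Rightarrow> real) set" where
  "fibre X x = (\<lambda>w. (w, x)) -` X"

lemma fibre_sets:
  assumes "X \<in> sets W_exp" shows "fibre X x \<in> sets W"
  unfolding fibre_def by (rule sets_Pair2) (use assms in \<open>simp only: with_exp_def\<close>)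

lemma emeasure_fibre:
  assumes "X \<in> sets W_exp" shows "emeasure W_exp X = (\<integral>\<^sup>+x. emeasure W (fibre X x) \<partial>exp_law l)"
proof -
  interpret pair_prob_space W "exp_law l" by (rule pair_prob)
  show ?thesis using assms unfolding with_exp_def fibre_def by (rule emeasure_pair_measure_alt2)
qed

lemma measurable_emeasure_fibre:
  assumes "X \<in> sets W_exp" shows "(\<lambda>x. emeasure W (fibre X x)) \<in> borel_measurable (exp_law l)"
proof -
  interpret pair_prob_space W "exp_law l" by (rule pair_prob)
  show ?thesis using assms unfolding with_exp_def fibre_def by (rule measurable_emeasure_Pair2)
qed

lemma measure_fibre:
  assumes X: "X \<in> sets W_exp" shows "measure W_exp X = (\<integral>x. measure W (fibre X x) \<partial>exp_law l)"
proof -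
  interpret W: prob_space W by (rule prob_space_W)
  have "measure W_exp X = enn2real (\<integral>\<^sup>+x. ennreal (measure W (fibre X x)) \<partial>exp_law l)"
    unfolding measure_def[of W_exp] emeasure_fibre[OF X] by (simp only: W.emeasure_eq_measure)
  also have "\<dots> = (\<integral>x. measure W (fibre X x) \<partial>exp_law l)"
  proof (rule integral_eq_nn_integral[symmetric])
    show "(\<lambda>x. measure W (fibre X x)) \<in> borel_measurable (exp_law l)"
      unfolding measure_def by (rule borel_measurable_enn2real[OF measurable_emeasure_fibre[OF X]])
  qed simp
  finally show ?thesis .
qed

lemma measurable_measure_fibre:
  assumes X: "X \<in> sets W_exp" shows "(\<lambda>x. measure W (fibre X x)) \<in> borel_measurable (exp_law l)"
  unfolding measure_def by (rule borel_measurable_enn2real[OF measurable_emeasure_fibre[OF X]])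

lemma measure_fibre_tendsto:
  assumes X: "\<And>n. X n \<in> sets W_exp" "Y \<in> sets W_exp"
    and lim: "\<And>x. 0 < x \<Longrightarrow> (\<lambda>n. measure W (fibre (X n) x)) \<longlonglongrightarrow> measure W (fibre Y x)"
  shows "(\<lambda>n. measure W_exp (X n)) \<longlonglongrightarrow> measure W_exp Y"
  unfolding measure_fibre[OF X(1)] measure_fibre[OF X(2)]
proof (rule integral_dominated_convergence[where w="\<lambda>_. 1"])
  interpret W: prob_space W by (rule prob_space_W)
  interpret E: prob_space "exp_law l" by (rule prob_space_exp_law[OF l_pos])
  show "AE x in exp_law l. (\<lambda>n. measure W (fibre (X n) x)) \<longlonglongrightarrow> measure W (fibre Y x)"
    by (rule AE_I2) (use lim in simp)
  show "AE x in exp_law l. norm (measure W (fibre (X n) x)) \<le> 1" for n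
    by (rule AE_I2) simp
  show "integrable (exp_law l) (\<lambda>_. 1::real)" by simp
qed (rule measurable_measure_fibre[OF X(1)] measurable_measure_fibre[OF X(2)])+

text \<open>Properties of \<open>T\<close> are known almost surely for each value of the exponential
  time separately; measurability of the exceptional set allows them to be integrated.\<close>

lemma AE_W_exp_fibre:
  assumes X: "{p \<in> space W_exp. \<not> Q p} \<in> sets W_exp" and ae: "\<And>x. 0 < x \<Longrightarrow> AE w in W. Q (w, x)"
  shows "AE p in W_exp. Q p"
proof -
  have "emeasure W_exp {p \<in> space W_exp. \<not> Q p} = (\<integral>\<^sup>+x. emeasure W (fibre {p \<in> space W_exp. \<not> Q p} x) \<partial>exp_law l)"
    by (rule emeasure_fibre[OF X])
  also have "\<dots> = (\<integral>\<^sup>+x. 0 \<partial>exp_law l)"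
  proof (rule nn_integral_cong)
    fix x assume "x \<in> space (exp_law l)"
    then have x: "0 < x" by simp
    have "AE w in W. w \<notin> fibre {p \<in> space W_exp. \<not> Q p} x"
      using ae[OF x] by eventually_elim (simp add: fibre_def)
    then show "emeasure W (fibre {p \<in> space W_exp. \<not> Q p} x) = 0"
      using AE_iff_null_sets[OF fibre_sets[OF X]] null_setsD1 by blast
  qed
  finally have "{p \<in> space W_exp. \<not> Q p} \<in> null_sets W_exp" using X by (simp add: null_sets_def)
  then show ?thesis by (rule AE_I') blast
qed

text \<open>Working fibre by fibre avoids joint measurability of \<open>f x w\<close> on the
  completed space. It serves for reversal at the exponential time, where each \<open>f x\<close>
  preserves the measure.\<close>

lemma measure_eq_fibre:
  assumes XY: "X \<in> sets W_exp" "Y \<in> sets W_exp"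
    and f: "\<And>x. 0 < x \<Longrightarrow> f x \<in> W \<rightarrow>\<^sub>M W"
      "\<And>x A. 0 < x \<Longrightarrow> A \<in> sets W \<Longrightarrow> emeasure W (f x -` A \<inter> space W) = emeasure W A"
    and ae: "\<And>x. 0 < x \<Longrightarrow> AE w in W. (w, x) \<in> Y \<longleftrightarrow> (f x w, x) \<in> X"
  shows "measure W_exp Y = measure W_exp X"
  unfolding measure_fibre[OF XY(1)] measure_fibre[OF XY(2)]
proof (rule Bochner_Integration.integral_cong[OF refl])
  fix x assume "x \<in> space (exp_law l)"
  then have x: "0 < x" by simp
  note fx = f[OF x]
  have "emeasure W (fibre Y x) = emeasure W (f x -` fibre X x \<inter> space W)"
  proof (rule emeasure_eq_AE)
    show "AE w in W. w \<in> fibre Y x \<longleftrightarrow> w \<in> f x -` fibre X x \<inter> space W"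
      using ae[OF x] AE_space[of W] by eventually_elim (simp add: fibre_def)
  qed (rule fibre_sets[OF XY(2)], rule measurable_sets[OF fx(1) fibre_sets[OF XY(1)]])
  then show "measure W (fibre Y x) = measure W (fibre X x)"
    unfolding fx(2)[OF fibre_sets[OF XY(1)]] by (simp only: measure_def)
qed

text \<open>The two coordinates are treated in turn: for fixed x, independence of increments
  factorises the fibre; then the memoryless property evaluates the integral over x.\<close>

lemma restart_law:
  assumes A: "A \<in> sets (incr_field W (-\<infinity>) (ereal s))" and s: "0 \<le> s"
    and B: "B \<in> sets W_exp" "\<And>x. 0 < x \<Longrightarrow> fibre B x \<in> sets (incr_field W 0 \<infinity>)"
  shows "{(w, x) \<in> space W_exp. w \<in> A \<and> s < x \<and> (levy_shift s w, x - s) \<in> B} \<in> sets W_exp" (is "?Y \<in> _")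
    and "measure W_exp {(w, x) \<in> space W_exp. w \<in> A \<and> s < x \<and> (levy_shift s w, x - s) \<in> B} =
      measure W A * exp (- s * l) * measure W_exp B"
proof -
  interpret W: prob_space W by (rule prob_space_W)
  interpret WE: prob_space W_exp by (rule prob_space_W_exp)
  have AW: "A \<in> sets W" using A sets_incr_field_subset by blast
  have shift: "(\<lambda>p. (levy_shift s (fst p), lapse s (snd p))) \<in> W_exp \<rightarrow>\<^sub>M W_exp"
    unfolding with_exp_def
    by (intro measurable_Pair measurable_compose[OF measurable_fst levy_shift_W] measurable_compose[OF measurable_snd measurable_lapse])
  have sE: "{s<..} \<inter> {0<..} \<in> sets (exp_law l)"
    unfolding sets_exp_law sets_restrict_space by (intro image_eqI[of _ _ "{s<..}"]) auto
  have "?Y = (A \<times> ({s<..} \<inter> {0<..})) \<inter> ((\<lambda>p. (levy_shift s (fst p), lapse s (snd p))) -` B \<inter> space W_exp)"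
    using sets.sets_into_space[OF AW] by (auto simp: space_W_exp lapse_def)
  moreover have "A \<times> ({s<..} \<inter> {0<..}) \<in> sets W_exp"
    unfolding with_exp_def by (rule pair_measureI[OF AW sE])
  ultimately show Y: "?Y \<in> sets W_exp" using measurable_sets[OF shift B(1)] by (simp only: sets.Int)
  have "emeasure W_exp ?Y = (\<integral>\<^sup>+x. emeasure W (fibre ?Y x) \<partial>exp_law l)" by (rule emeasure_fibre[OF Y])
  also have "\<dots> = (\<integral>\<^sup>+x. indicator {s<..} x * (emeasure W A * emeasure W (fibre B (lapse s x))) \<partial>exp_law l)"
  proof (rule nn_integral_cong)
    fix x assume "x \<in> space (exp_law l)"
    then have x: "0 < x" by simp
    show "emeasure W (fibre ?Y x) = indicator {s<..} x * (emeasure W A * emeasure W (fibre B (lapse s x)))"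
    proof (cases "s < x")
      case True
      have "fibre ?Y x = A \<inter> (levy_shift s -` fibre B (x - s) \<inter> space W)"
        using True x sets.sets_into_space[OF AW] by (auto simp: fibre_def space_W_exp)
      then show ?thesis
        using independent_increments[OF A s B(2), of "x - s"] True by (simp add: lapse_def)
    next
      case False
      then have "fibre ?Y x = {}" by (auto simp: fibre_def)
      then show ?thesis using False by simp
    qed
  qed
  also have "\<dots> = ennreal (exp (- s * l)) * (\<integral>\<^sup>+x. emeasure W A * emeasure W (fibre B x) \<partial>exp_law l)"
    by (rule exp_law_memoryless[OF _ s]) (intro borel_measurable_times_ennreal borel_measurable_const measurable_emeasure_fibre[OF B(1)])
  also have "\<dots> = ennreal (exp (- s * l)) * (emeasure W A * emeasure W_exp B)"
    unfolding emeasure_fibre[OF B(1)] by (subst nn_integral_cmult[OF measurable_emeasure_fibre[OF B(1)]]) simp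
  finally have "emeasure W_exp ?Y = ennreal (exp (- s * l)) * (emeasure W A * emeasure W_exp B)" .
  then show "measure W_exp ?Y = measure W A * exp (- s * l) * measure W_exp B"
    by (simp add: measure_def enn2real_mult)
qed

text \<open>Agrees almost surely with \<open>new_cell\<close>, but is disjoint for different k at
  every path, since all earlier grid times are excluded and not just the preceding one.\<close>

definition first_cell :: "real \<Rightarrow> nat \<Rightarrow> nat \<Rightarrow> (real \<Rightarrow> real) set" where
  "first_cell u n k = crossed u (grid n (Suc k)) - (\<Union>i\<le>k. crossed u (grid n i))"

lemma first_cell_past:
  assumes u: "0 \<le> u" and A: "A \<in> sets (incr_field W (-\<infinity>) (ereal u))"
  shows "A \<inter> first_cell u n k \<in> sets (incr_field W (-\<infinity>) (ereal (grid n (Suc k))))"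
proof (cases "u < grid n (Suc k)")
  case True
  let ?F = "incr_field W (-\<infinity>) (ereal (grid n (Suc k)))"
  have cr: "crossed u (grid n i) \<in> sets ?F" if "i \<le> Suc k" for i
  proof -
    have "grid n i \<le> grid n (Suc k)" using that by (intro divide_right_mono) auto
    then have "sets (incr_field W (-\<infinity>) (ereal (grid n i))) \<subseteq> sets ?F" by (intro incr_field_mono) auto
    then show ?thesis using crossed_past[OF u] by blast
  qed
  have "first_cell u n k \<in> sets ?F"
    unfolding first_cell_def 
    by (rule sets.Diff[OF cr[OF order_refl] sets.finite_UN[OF finite_atMost cr]]) (simp only: atMost_iff le_SucI)
  moreover have "sets (incr_field W (-\<infinity>) (ereal u)) \<subseteq> sets ?F" using True by (intro incr_field_mono) auto
  ultimately show ?thesis using A by (intro sets.Int) auto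
next
  case False
  then have "first_cell u n k = {}" unfolding first_cell_def crossed_def by blast
  then show ?thesis by simp
qed

lemma disjoint_first_cell: "i \<noteq> k \<Longrightarrow> first_cell u n i \<inter> first_cell u n k = {}"
proof -
  have "first_cell u n i \<inter> first_cell u n k = {}" if "i < k" for i k
  proof (rule equals0I)
    fix w assume "w \<in> first_cell u n i \<inter> first_cell u n k"
    moreover have "Suc i \<in> {..k}" using that by simp
    ultimately show False unfolding first_cell_def by blast
  qed
  then show "i \<noteq> k \<Longrightarrow> first_cell u n i \<inter> first_cell u n k = {}" by (metis Int_commute nat_neq_iff)
qed

lemma first_cellI:
  assumes "0 \<le> u" "w \<in> crossed u (grid n m)"
  shows "\<exists>k. Suc k \<le> m \<and> w \<in> first_cell u n k"
proof -
  define j where "j = (LEAST j. w \<in> crossed u (grid n j))"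
  have j: "w \<in> crossed u (grid n j)" unfolding j_def by (rule LeastI[of _ m]) (rule assms)
  have jm: "j \<le> m" unfolding j_def by (rule Least_le) (rule assms)
  have nj: "w \<notin> crossed u (grid n i)" if "i < j" for i using not_less_Least[of i] that unfolding j_def by blast
  have "j \<noteq> 0"
  proof
    assume "j = 0" then show False using j assms(1) by (simp add: crossed_def)
  qed
  then obtain k where "j = Suc k" using not0_implies_Suc by blast
  then show ?thesis using j jm nj by (intro exI[of _ k]) (auto simp: first_cell_def)
qed

lemma abs_measure_diff_le:
  assumes "X \<in> sets W" "Y \<in> sets W" "Z \<in> sets W" "AE w in W. w \<notin> Z \<longrightarrow> (w \<in> X \<longleftrightarrow> w \<in> Y)"
  shows "\<bar>measure W X - measure W Y\<bar> \<le> measure W Z"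
proof -
  interpret W: prob_space W by (rule prob_space_W)
  have "measure W X \<le> measure W (Y \<union> Z)" "measure W Y \<le> measure W (X \<union> Z)"
    using assms by (auto intro!: W.finite_measure_mono_AE elim: eventually_mono)
  then show ?thesis using measure_Un_le[OF assms(2,3)] measure_Un_le[OF assms(1,3)] by linarith
qed

lemma missed_sets:
  assumes "0 \<le> u" "0 < x" shows "missed u x n \<in> sets W"
proof -
  have T: "{w \<in> space W. T x w \<le> c} \<in> sets W" for c
    using T_measurable_W[OF assms(2)] by measurable
  have "missed u x n = (\<Union>k\<in>{k. grid n (Suc k) < x}. new_cell u n k \<inter> {w \<in> space W. T x w \<le> grid n (Suc k)})"
    unfolding missed_def new_cell_def crossed_def by blast
  also have "\<dots> \<in> sets W"
    by (rule sets.countable_UN''[OF countableI_type sets.Int[OF new_cell_sets[OF assms(1)] T]])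
  finally show ?thesis .
qed

text \<open>The second bad event: \<open>T x\<close> is beyond u, but the crossing is not observed
  at any grid time before x.\<close>

definition uncrossed :: "real \<Rightarrow> real \<Rightarrow> nat \<Rightarrow> (real \<Rightarrow> real) set" where
  "uncrossed u x n = {w \<in> space W. u < T x w} - (\<Union>k\<in>{k. grid n (Suc k) < x}. first_cell u n k)"

lemma first_cell_sets: "0 \<le> u \<Longrightarrow> first_cell u n k \<in> sets W"
  unfolding first_cell_def by (intro sets.Diff sets.finite_UN crossed_sets) auto

lemma uncrossed_sets:
  assumes "0 \<le> u" "0 < x" shows "uncrossed u x n \<in> sets W"
proof -
  have "{w \<in> space W. u < T x w} \<in> sets W" using T_measurable_W[OF assms(2)] by measurable
  then show ?thesis unfolding uncrossed_def
    by (intro sets.Diff sets.countable_UN'' first_cell_sets[OF assms(1)]) auto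
qed

text \<open>As \<open>T x\<close> is less than x, a fine grid has a point between the two; by
  nestedness \<open>T\<close> already has the value \<open>T x\<close> there, and the crossing is
  visible.\<close>

lemma uncrossed_tendsto:
  assumes u: "0 \<le> u" and x: "0 < x"
  shows "(\<lambda>n. measure W (uncrossed u x n)) \<longlonglongrightarrow> 0"
proof -
  interpret W: prob_space W by (rule prob_space_W)
  have pre: "AE w in W. \<forall>n k. 0 < grid n k \<and> grid n k < x \<longrightarrow> (T x w < grid n k \<longrightarrow> T x w = T (grid n k) w)"
    by (subst AE_all_countable, intro allI, rule AE_all_imp, rule T_prefix) auto
  show ?thesis
  proof (rule W.measure_eventually_notin)
    show "uncrossed u x n \<in> sets W" for n by (rule uncrossed_sets[OF u x])
    show "AE w in W. \<forall>\<^sub>F n in sequentially. w \<notin> uncrossed u x n"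
      using T_range[OF x] pre AE_space[of W]
    proof eventually_elim
      case (elim w)
      have "\<forall>\<^sub>F n in sequentially. 1 / 2^n < x - T x w" by (intro order_tendstoD(2)[OF inverse_power_tendsto]) (use elim in simp)
      then show ?case
      proof (rule eventually_mono)
        fix n :: nat assume n: "1 / 2^n < x - T x w"
        show "w \<notin> uncrossed u x n"
        proof
          assume "w \<in> uncrossed u x n"
          then have uT: "u < T x w" and no: "\<And>k. grid n (Suc k) < x \<Longrightarrow> w \<notin> first_cell u n k" by (auto simp: uncrossed_def)
          \<comment> \<open>The last grid index strictly before x; the grid time is at most one mesh
            away from x.\<close>
          define m where "m = nat (\<lceil>x * 2^n\<rceil> - 1)"
          have pos: "0 < x * 2^n" using x by simp
          then have m: "real m = real_of_int \<lceil>x * 2^n\<rceil> - 1" by (simp add: m_def)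
          have "real m < x * 2^n" "x * 2^n \<le> real m + 1" using m by linarith+
          then have "grid n m < x" "x \<le> grid n m + 1 / 2^n" by (simp_all add: field_simps)
          then have lt: "T x w < grid n m" "grid n m < x" using n by linarith+
          then have "0 < grid n m" using elim(1) by linarith
          then have "T x w = T (grid n m) w" using elim(2) lt by blast
          then have "w \<in> crossed u (grid n m)" using uT lt elim(3) by (simp add: crossed_def)
          then obtain k where k: "Suc k \<le> m" "w \<in> first_cell u n k" using first_cellI[OF u] by blast
          have "grid n (Suc k) \<le> grid n m" using k(1) by (intro divide_right_mono) auto
          then show False using no[of k] k(2) lt by linarith
        qed
      qed
    qed
  qed
qed

text \<open>At the first grid time by which \<open>T\<close> has moved beyond \<open>u\<close> the path and the exponential time start
  afresh, and up to the vanishing events \<open>missed\<close> and \<open>uncrossed\<close> this restart does not affect \<open>B\<close>.\<close>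

lemma splitting_product:
  assumes u: "0 \<le> u" and A: "A \<in> sets (incr_field W (-\<infinity>) (ereal u))"
    and B: "B \<in> sets W_exp" "\<And>x. 0 < x \<Longrightarrow> fibre B x \<in> sets (incr_field W 0 \<infinity>)"
    and cov: "\<And>s x. 0 < s \<Longrightarrow> s < x \<Longrightarrow> AE w in W. s < T x w \<longrightarrow> ((w, x) \<in> B \<longleftrightarrow> (levy_shift s w, x - s) \<in> B)"
  defines "L \<equiv> {(w, x) \<in> space W_exp. w \<in> A \<and> u < T x w}"
  shows "L \<in> sets W_exp" "measure W_exp (L \<inter> B) = measure W_exp L * measure W_exp B"
proof -
  interpret W: prob_space W by (rule prob_space_W)
  interpret WE: prob_space W_exp by (rule prob_space_W_exp)
  have AW: "A \<in> sets W" using A sets_incr_field_subset by blast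
  show L: "L \<in> sets W_exp"
  proof -
    have "(\<lambda>(w, x). T x w) -` {u<..} \<inter> space W_exp \<in> sets W_exp" by (rule measurable_sets[OF T_joint]) simp
    moreover have "A \<times> space (exp_law l) \<in> sets W_exp" unfolding with_exp_def by (rule pair_measureI[OF AW sets.top])
    moreover have "L = ((\<lambda>(w, x). T x w) -` {u<..} \<inter> space W_exp) \<inter> (A \<times> space (exp_law l))"
      unfolding L_def by (auto simp: space_W_exp)
    ultimately show ?thesis by (simp only: sets.Int)
  qed
  define C where "C n k = A \<inter> first_cell u n k" for n k
  have C: "C n k \<in> sets (incr_field W (-\<infinity>) (ereal (grid n (Suc k))))" for n k
    unfolding C_def by (rule first_cell_past[OF u A])
  have CW: "C n k \<in> sets W" for n k using C sets_incr_field_subset by blast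
  \<comment> \<open>The crossing is first seen at the end of cell k, and the pair restarted there
    belongs to \<open>X\<close>. By the restart law the events for \<open>B\<close> and for the
    whole space differ by the factor \<open>measure W_exp B\<close> in each cell, hence also in the
    sum over the cells.\<close>
  define Y where "Y X n k = {(w, x) \<in> space W_exp. w \<in> C n k \<and> grid n (Suc k) < x \<and> (levy_shift (grid n (Suc k)) w, x - grid n (Suc k)) \<in> X}" for X n k
  have s0: "0 \<le> grid n (Suc k)" for n k by simp
  have top: "fibre (space W_exp) x \<in> sets (incr_field W 0 \<infinity>)" if "0 < x" for x
  proof -
    have "fibre (space W_exp) x = space (incr_field W 0 \<infinity>)" using that by (auto simp: fibre_def space_W_exp)
    then show ?thesis by (simp only: sets.top)
  qed
  have YB: "Y B n k \<in> sets W_exp" "measure W_exp (Y B n k) = measure W (C n k) * exp (- grid n (Suc k) * l) * measure W_exp B" for n k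
    unfolding Y_def by (rule restart_law[OF C s0 B]; assumption)+
  have YT: "Y (space W_exp) n k \<in> sets W_exp" "measure W_exp (Y (space W_exp) n k) = measure W (C n k) * exp (- grid n (Suc k) * l) * measure W_exp (space W_exp)" for n k
    unfolding Y_def by (rule restart_law[OF C s0 sets.top top]; assumption)+
  have Ysum: "(\<lambda>k. measure W_exp (Y X n k)) sums measure W_exp (\<Union>k. Y X n k)" if "\<And>k. Y X n k \<in> sets W_exp" for X n
  proof (rule WE.finite_measure_UNION)
    show "range (Y X n) \<subseteq> sets W_exp" using that by blast
    show "disjoint_family (Y X n)"
      unfolding disjoint_family_on_def
    proof (intro ballI impI equals0I)
      fix i k :: nat and p assume "i \<noteq> k" "p \<in> Y X n i \<inter> Y X n k"
      then have "fst p \<in> first_cell u n i \<inter> first_cell u n k" by (auto simp: Y_def C_def)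
      then show False using disjoint_first_cell[OF \<open>i \<noteq> k\<close>] by blast
    qed
  qed
  define GB where "GB n = (\<Union>k. Y B n k)" for n
  define GT where "GT n = (\<Union>k. Y (space W_exp) n k)" for n
  have GBs: "GB n \<in> sets W_exp" and GTs: "GT n \<in> sets W_exp" for n
    unfolding GB_def GT_def using YB(1) YT(1) by (intro sets.countable_UN; blast)+
  have prod: "measure W_exp (GB n) = measure W_exp (GT n) * measure W_exp B" for n
  proof -
    have "(\<lambda>k. measure W_exp (Y (space W_exp) n k) * measure W_exp B) sums (measure W_exp (GT n) * measure W_exp B)"
      unfolding GT_def by (rule sums_mult2[OF Ysum[OF YT(1)]])
    moreover have "measure W_exp (Y (space W_exp) n k) * measure W_exp B = measure W_exp (Y B n k)" for k
      unfolding YB(2) YT(2) by (simp only: WE.prob_space mult_1_right)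
    ultimately have "(\<lambda>k. measure W_exp (Y B n k)) sums (measure W_exp (GT n) * measure W_exp B)" by (simp only:)
    then show ?thesis using sums_unique2[OF Ysum[OF YB(1)]] unfolding GB_def by blast
  qed
  have fib: "w \<in> fibre (\<Union>k. Y X n k) x \<longleftrightarrow> (\<exists>k. w \<in> C n k \<and> grid n (Suc k) < x \<and> (levy_shift (grid n (Suc k)) w, x - grid n (Suc k)) \<in> X)"
    if "w \<in> space W" "0 < x" for w x X n
    using that by (auto simp: fibre_def Y_def space_W_exp)
  \<comment> \<open>Off \<open>missed\<close> and \<open>uncrossed\<close> the restart takes place
    before \<open>T x\<close>, and invariance of \<open>X\<close> under such a restart identifies
    the two fibres. It is applied to \<open>B\<close> and to the whole space.\<close>
  have lim: "(\<lambda>n. measure W (fibre (\<Union>k. Y X n k) x)) \<longlonglongrightarrow> measure W (fibre (L \<inter> X) x)"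
    if X: "X \<in> sets W_exp" and Xs: "\<And>n. (\<Union>k. Y X n k) \<in> sets W_exp" and x: "0 < x"
      and Xc: "\<And>s x. 0 < s \<Longrightarrow> s < x \<Longrightarrow> AE w in W. s < T x w \<longrightarrow> ((w, x) \<in> X \<longleftrightarrow> (levy_shift s w, x - s) \<in> X)" for X x
  proof -
    have bd: "\<bar>measure W (fibre (\<Union>k. Y X n k) x) - measure W (fibre (L \<inter> X) x)\<bar> \<le> measure W (missed u x n) + measure W (uncrossed u x n)" for n
    proof -
      have c: "AE w in W. \<forall>k. grid n (Suc k) < x \<longrightarrow> (grid n (Suc k) < T x w \<longrightarrow> ((w, x) \<in> X \<longleftrightarrow> (levy_shift (grid n (Suc k)) w, x - grid n (Suc k)) \<in> X))"
        by (rule AE_all_imp, rule Xc) auto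
      have m: "AE w in W. \<forall>k. grid n (Suc k) < x \<longrightarrow> (w \<in> crossed u (grid n (Suc k)) \<longrightarrow> w \<in> crossed u x)"
        by (rule AE_all_imp, rule crossed_mono[OF u]) auto
      have "\<bar>measure W (fibre (\<Union>k. Y X n k) x) - measure W (fibre (L \<inter> X) x)\<bar> \<le> measure W (missed u x n \<union> uncrossed u x n)"
      proof (rule abs_measure_diff_le[OF fibre_sets[OF Xs] fibre_sets[OF sets.Int[OF L X]] sets.Un[OF missed_sets[OF u x] uncrossed_sets[OF u x]]])
        show "AE w in W. w \<notin> missed u x n \<union> uncrossed u x n \<longrightarrow> (w \<in> fibre (\<Union>k. Y X n k) x \<longleftrightarrow> w \<in> fibre (L \<inter> X) x)"
          using c m AE_space[of W]
        proof eventually_elim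
          case (elim w)
          have fL: "w \<in> fibre (L \<inter> X) x \<longleftrightarrow> w \<in> A \<and> u < T x w \<and> (w, x) \<in> X"
            using elim(3) x by (auto simp: fibre_def L_def space_W_exp)
          have late: "grid n (Suc k) < T x w" if "w \<notin> missed u x n" "w \<in> first_cell u n k" "grid n (Suc k) < x" for k
          proof -
            have "w \<in> new_cell u n k" using that(2) by (auto simp: first_cell_def new_cell_def)
            then show ?thesis using that elim(3) by (fastforce simp: missed_def not_le)
          qed
          show ?case
          proof (intro impI iffI)
            assume good: "w \<notin> missed u x n \<union> uncrossed u x n" and "w \<in> fibre (\<Union>k. Y X n k) x"
            then obtain k where k: "w \<in> A" "w \<in> first_cell u n k" "grid n (Suc k) < x" "(levy_shift (grid n (Suc k)) w, x - grid n (Suc k)) \<in> X"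
              unfolding fib[OF elim(3) x] C_def by blast
            have "w \<in> crossed u (grid n (Suc k))" using k(2) by (simp add: first_cell_def)
            then have "u < T x w" using elim(2) k(3) by (simp add: crossed_def)
            moreover have "(w, x) \<in> X" using elim(1) k late[OF _ k(2,3)] good by blast
            ultimately show "w \<in> fibre (L \<inter> X) x" using k(1) fL by blast
          next
            assume good: "w \<notin> missed u x n \<union> uncrossed u x n" and "w \<in> fibre (L \<inter> X) x"
            then have w: "w \<in> A" "u < T x w" "(w, x) \<in> X" using fL by blast+
            obtain k where k: "grid n (Suc k) < x" "w \<in> first_cell u n k"
              using good w(2) elim(3) unfolding uncrossed_def by blast
            then have "(levy_shift (grid n (Suc k)) w, x - grid n (Suc k)) \<in> X" using elim(1) late[OF _ k(2,1)] good w(3) by blast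
            then show "w \<in> fibre (\<Union>k. Y X n k) x" unfolding fib[OF elim(3) x] C_def using w(1) k by blast
          qed
        qed
      qed
      also have "\<dots> \<le> measure W (missed u x n) + measure W (uncrossed u x n)"
        by (rule measure_Un_le[OF missed_sets[OF u x] uncrossed_sets[OF u x]])
      finally show ?thesis .
    qed
    have zero: "(\<lambda>n. measure W (missed u x n) + measure W (uncrossed u x n)) \<longlonglongrightarrow> 0"
      using tendsto_add[OF missed_tendsto[OF u x] uncrossed_tendsto[OF u x]] by simp
    have "(\<lambda>n. measure W (fibre (\<Union>k. Y X n k) x) - measure W (fibre (L \<inter> X) x)) \<longlonglongrightarrow> 0"
    proof (rule Lim_null_comparison[OF _ zero])
      show "\<forall>\<^sub>F n in sequentially. norm (measure W (fibre (\<Union>k. Y X n k) x) - measure W (fibre (L \<inter> X) x)) \<le> measure W (missed u x n) + measure W (uncrossed u x n)"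
        unfolding real_norm_def using bd by (rule always_eventually[OF allI])
    qed
    then show ?thesis by (rule LIM_zero_cancel)
  qed
  have "(\<lambda>n. measure W_exp (GB n)) \<longlonglongrightarrow> measure W_exp (L \<inter> B)"
    by (rule measure_fibre_tendsto[OF GBs sets.Int[OF L B(1)]])
      (unfold GB_def, rule lim[OF B(1) GBs[unfolded GB_def] _ cov])
  moreover have "(\<lambda>n. measure W_exp (GT n)) \<longlonglongrightarrow> measure W_exp (L \<inter> space W_exp)"
  proof (rule measure_fibre_tendsto[OF GTs sets.Int[OF L sets.top]], unfold GT_def, rule lim[OF sets.top GTs[unfolded GT_def]])
    fix s x :: real assume sx: "0 < s" "s < x"
    show "AE w in W. s < T x w \<longrightarrow> ((w, x) \<in> space W_exp \<longleftrightarrow> (levy_shift s w, x - s) \<in> space W_exp)"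
      by (rule AE_I2) (use sx levy_shift_paths in \<open>simp add: space_W_exp space_P\<close>)
  qed
  then have "(\<lambda>n. measure W_exp (GT n) * measure W_exp B) \<longlonglongrightarrow> measure W_exp (L \<inter> space W_exp) * measure W_exp B"
    by (rule tendsto_mult_right)
  ultimately have "measure W_exp (L \<inter> B) = measure W_exp (L \<inter> space W_exp) * measure W_exp B"
    unfolding prod by (rule LIMSEQ_unique)
  then show "measure W_exp (L \<inter> B) = measure W_exp L * measure W_exp B"
    using sets.sets_into_space[OF L] by (simp only: Int_absorb2)
qed

end

section \<open>Measurability with the coffin state\<close>

lemma sets_coffin_borel: "sets coffin_borel = sigma_sets UNIV (insert {None} ((`) Some ` sets borel))"
  unfolding coffin_borel_def by (rule sets_measure_of) simp

lemma space_coffin_borel [simp]: "space coffin_borel = UNIV"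
  by (simp add: coffin_borel_def space_measure_of_conv)

lemma coffin_borel_None [measurable]: "{None} \<in> sets coffin_borel"
  unfolding sets_coffin_borel by (rule sigma_sets.Basic) simp

lemma coffin_borel_Some: "A \<in> sets borel \<Longrightarrow> Some ` A \<in> sets coffin_borel"
  unfolding sets_coffin_borel by (rule sigma_sets.Basic) simp

lemma measurable_the: "the \<in> borel_measurable coffin_borel"
proof (rule measurableI)
  fix A :: "real set" assume A: "A \<in> sets borel"
  \<comment> \<open>\<open>the None\<close> is a fixed but unspecified real, so whether
    \<open>None\<close> belongs to the preimage depends on \<open>A\<close>.\<close>
  have "the -` A \<inter> space coffin_borel = Some ` A \<union> (if the None \<in> A then {None} else {})"
  proof (rule set_eqI)
    fix y :: "real option"
    show "y \<in> the -` A \<inter> space coffin_borel \<longleftrightarrow> y \<in> Some ` A \<union> (if the None \<in> A then {None} else {})"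
      by (cases y) auto
  qed
  moreover have "(if the None \<in> A then {None} else {}) \<in> sets coffin_borel"
    using coffin_borel_None by simp
  ultimately show "the -` A \<inter> space coffin_borel \<in> sets coffin_borel"
    using coffin_borel_Some[OF A] by (simp only: sets.Un)
qed simp

lemma measurable_coffin_uminus: "map_option uminus \<in> coffin_borel \<rightarrow>\<^sub>M coffin_borel"
proof -
  have gen: "insert {None} ((`) Some ` sets (borel :: real measure)) \<subseteq> Pow UNIV" by simp
  have "map_option uminus \<in> coffin_borel \<rightarrow>\<^sub>M sigma UNIV (insert {None} ((`) Some ` sets borel))"
  proof (rule measurable_sigma_sets[OF sets_measure_of[OF gen] gen])
    fix Y :: "real option set" assume "Y \<in> insert {None} ((`) Some ` sets borel)"
    then show "map_option uminus -` Y \<inter> space coffin_borel \<in> sets coffin_borel"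
    proof
      assume "Y = {None}"
      then have "map_option uminus -` Y \<inter> space coffin_borel = {None}" by auto
      then show ?thesis using coffin_borel_None by simp
    next
      assume "Y \<in> (`) Some ` sets borel"
      then obtain A where A: "A \<in> sets borel" "Y = Some ` A" by blast
      have "map_option uminus -` Y \<inter> space coffin_borel = Some ` (uminus -` A)"
      proof (rule set_eqI)
        fix y :: "real option"
        show "y \<in> map_option uminus -` Y \<inter> space coffin_borel \<longleftrightarrow> y \<in> Some ` (uminus -` A)"
          unfolding A(2) by (cases y) auto
      qed
      then show ?thesis using coffin_borel_Some[OF uminus_vimage_borel[OF A(1)]] by simp
    qed
  qed simp
  then show ?thesis unfolding coffin_borel_def .
qed

lemma coffin_graph_sets:
  assumes S: "S \<in> N \<rightarrow>\<^sub>M coffin_borel" and f: "f \<in> borel_measurable N"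
  shows "{x \<in> space N. S x = Some (f x)} \<in> sets N"
proof -
  have [measurable]: "(\<lambda>x. the (S x)) \<in> borel_measurable N" by (rule measurable_compose[OF S measurable_the])
  note f[measurable]
  have "{x \<in> space N. the (S x) = f x} \<in> sets N" by measurable
  moreover have "S -` {None} \<inter> space N \<in> sets N" by (rule measurable_sets[OF S coffin_borel_None])
  moreover have "{x \<in> space N. S x = Some (f x)} = {x \<in> space N. the (S x) = f x} - (S -` {None} \<inter> space N)"
    by auto
  ultimately show ?thesis by (simp only: sets.Diff)
qed

lemma restrict_levy_shift_paths:
  assumes "w \<in> paths UNIV" shows "restrict (levy_shift u w) {0..} \<in> paths {0..}"
proof -
  have "continuous_on {0..} (levy_shift u w)"
    using levy_shift_paths[OF assms, of u] by (auto simp: paths_UNIV_iff intro: continuous_on_subset)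
  then have "continuous_on {0..} (restrict (levy_shift u w) {0..})"
    by (rule continuous_on_eq) simp
  then show ?thesis by (simp add: paths_def levy_shift_def)
qed

lemma restrict_paths:
  assumes "w \<in> paths UNIV" shows "restrict w {0..} \<in> paths {0..}"
proof -
  have "continuous_on {0..} w"
    using assms by (auto simp: paths_UNIV_iff intro: continuous_on_subset)
  then have "continuous_on {0..} (restrict w {0..})"
    by (rule continuous_on_eq) simp
  then show ?thesis using assms by (simp add: paths_def)
qed

context exp_splitting_time
begin

section \<open>The past of a splitting time\<close>

text \<open>Events known at time u, on the part where T is beyond u, generate the strict past of T.
  The clause \<open>u = 0\<close> admits the events known at time 0 also where T vanishes, and with
  them the whole space.\<close>

definition past_set :: "real \<Rightarrow> (real \<Rightarrow> real) set \<Rightarrow> ((real \<Rightarrow> real) \<times> real) set" where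
  "past_set u A = {(w, x) \<in> space W_exp. w \<in> A \<and> (u < T x w \<or> u = 0)}"

definition past_sets :: "((real \<Rightarrow> real) \<times> real) set set" where
  "past_sets = {past_set u A | u A. 0 \<le> u \<and> A \<in> sets (incr_field W (-\<infinity>) (ereal u))}"

definition past_algebra :: "((real \<Rightarrow> real) \<times> real) measure" where
  "past_algebra = sigma (space W_exp) past_sets"

text \<open>The hypotheses of the restart argument: the event is decided by the path after 0 for
  each value of the exponential time, and a restart before T does not affect it. The future at T and
  membership of T in a stationary local set are of this kind.\<close>

definition renewing :: "((real \<Rightarrow> real) \<times> real) set \<Rightarrow> bool" where
  "renewing B \<longleftrightarrow> B \<in> sets W_exp \<and> (\<forall>x>0. fibre B x \<in> sets (incr_field W 0 \<infinity>)) \<and>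
     (\<forall>s>0. \<forall>x>s. AE w in W. s < T x w \<longrightarrow> ((w, x) \<in> B \<longleftrightarrow> (levy_shift s w, x - s) \<in> B))"

lemma renewing_Int:
  assumes "renewing B" "renewing C" shows "renewing (B \<inter> C)"
  unfolding renewing_def
proof (intro conjI allI impI)
  show "B \<inter> C \<in> sets W_exp" using assms unfolding renewing_def by (intro sets.Int) blast+
  show "fibre (B \<inter> C) x \<in> sets (incr_field W 0 \<infinity>)" if "0 < x" for x
  proof -
    have "fibre (B \<inter> C) x = fibre B x \<inter> fibre C x" by (auto simp: fibre_def)
    moreover have "fibre B x \<in> sets (incr_field W 0 \<infinity>)" "fibre C x \<in> sets (incr_field W 0 \<infinity>)"
      using assms that unfolding renewing_def by blast+
    ultimately show ?thesis by (simp only: sets.Int)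
  qed
  fix s x :: real assume "0 < s" "s < x"
  then have "AE w in W. s < T x w \<longrightarrow> ((w, x) \<in> B \<longleftrightarrow> (levy_shift s w, x - s) \<in> B)"
    "AE w in W. s < T x w \<longrightarrow> ((w, x) \<in> C \<longleftrightarrow> (levy_shift s w, x - s) \<in> C)"
    using assms unfolding renewing_def by blast+
  then show "AE w in W. s < T x w \<longrightarrow> ((w, x) \<in> B \<inter> C \<longleftrightarrow> (levy_shift s w, x - s) \<in> B \<inter> C)"
    by eventually_elim blast
qed

lemma past_set_sets:
  assumes "0 \<le> u" "A \<in> sets (incr_field W (-\<infinity>) (ereal u))"
  shows "past_set u A \<in> sets W_exp"
proof -
  have A: "A \<in> sets W" using assms(2) sets_incr_field_subset by blast
  have "(\<lambda>(w, x). T x w) -` {u<..} \<inter> space W_exp \<in> sets W_exp" by (rule measurable_sets[OF T_joint]) simp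
  then have "((\<lambda>(w, x). T x w) -` {u<..} \<inter> space W_exp) \<union> (if u = 0 then space W_exp else {}) \<in> sets W_exp" by auto
  moreover have "A \<times> space (exp_law l) \<in> sets W_exp" unfolding with_exp_def by (rule pair_measureI[OF A sets.top])
  moreover have "past_set u A = (((\<lambda>(w, x). T x w) -` {u<..} \<inter> space W_exp) \<union> (if u = 0 then space W_exp else {})) \<inter> (A \<times> space (exp_law l))"
    unfolding past_set_def by (auto simp: space_W_exp)
  ultimately show ?thesis by (simp only: sets.Int)
qed

lemma measurable_snd_W_exp: "snd \<in> borel_measurable W_exp"
proof -
  have "(\<lambda>x. x) \<in> borel_measurable (exp_law l)"
    unfolding measurable_cong_sets[OF sets_exp_law refl] by (rule measurable_restrict_space1) simp
  from measurable_compose[OF measurable_snd this] show ?thesis by (simp only: with_exp_def)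
qed

lemma T_joint': "(\<lambda>p. T (snd p) (fst p)) \<in> borel_measurable W_exp"
  using T_joint by (simp add: case_prod_beta')

lemma AE_T_range: "AE p in W_exp. 0 < T (snd p) (fst p) \<and> T (snd p) (fst p) < snd p"
proof (rule AE_W_exp_fibre)
  note T_joint'[measurable] measurable_snd_W_exp[measurable]
  show "{p \<in> space W_exp. \<not> (0 < T (snd p) (fst p) \<and> T (snd p) (fst p) < snd p)} \<in> sets W_exp" by measurable
  show "AE w in W. 0 < T (snd (w, x)) (fst (w, x)) \<and> T (snd (w, x)) (fst (w, x)) < snd (w, x)" if "0 < x" for x
    using T_range[OF that] by simp
qed

text \<open>T is positive almost surely, so the clause \<open>u = 0\<close> changes the event of the
  restart argument by a null set only.\<close>

lemma past_set_product:
  assumes u: "0 \<le> u" and A: "A \<in> sets (incr_field W (-\<infinity>) (ereal u))" and B: "renewing B"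
  shows "measure W_exp (past_set u A \<inter> B) = measure W_exp (past_set u A) * measure W_exp B"
proof -
  interpret WE: prob_space W_exp by (rule prob_space_W_exp)
  define L where "L = {(w, x) \<in> space W_exp. w \<in> A \<and> u < T x w}"
  have B': "B \<in> sets W_exp" "\<And>x. 0 < x \<Longrightarrow> fibre B x \<in> sets (incr_field W 0 \<infinity>)"
    "\<And>s x. 0 < s \<Longrightarrow> s < x \<Longrightarrow> AE w in W. s < T x w \<longrightarrow> ((w, x) \<in> B \<longleftrightarrow> (levy_shift s w, x - s) \<in> B)"
    using B unfolding renewing_def by blast+
  note L = splitting_product[OF u A B', folded L_def]
  have LX: "AE p in W_exp. p \<in> past_set u A \<longleftrightarrow> p \<in> L"
    using AE_T_range by eventually_elim (auto simp: past_set_def L_def)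
  have "measure W_exp (past_set u A) = measure W_exp L"
    by (rule WE.finite_measure_eq_AE[OF LX past_set_sets[OF u A] L(1)])
  moreover have "measure W_exp (past_set u A \<inter> B) = measure W_exp (L \<inter> B)"
    by (rule WE.finite_measure_eq_AE[OF _ sets.Int[OF past_set_sets[OF u A] B'(1)] sets.Int[OF L(1) B'(1)]])
      (use LX in eventually_elim, blast)
  ultimately show ?thesis using L(2) by simp
qed

lemma Int_stable_past_sets: "Int_stable past_sets"
proof (rule Int_stableI)
  fix X Y assume "X \<in> past_sets" "Y \<in> past_sets"
  then obtain u A v B where X: "X = past_set u A" "0 \<le> u" "A \<in> sets (incr_field W (-\<infinity>) (ereal u))"
    and Y: "Y = past_set v B" "0 \<le> v" "B \<in> sets (incr_field W (-\<infinity>) (ereal v))"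
    unfolding past_sets_def by blast
  let ?F = "incr_field W (-\<infinity>) (ereal (max u v))"
  have "A \<in> sets ?F" using X(3) incr_field_mono[of "-\<infinity>" "-\<infinity>" "ereal u" "ereal (max u v)" W] by auto
  moreover have "B \<in> sets ?F" using Y(3) incr_field_mono[of "-\<infinity>" "-\<infinity>" "ereal v" "ereal (max u v)" W] by auto
  ultimately have "A \<inter> B \<in> sets ?F" by blast
  moreover have "X \<inter> Y = past_set (max u v) (A \<inter> B)"
  proof -
    have "(u < r \<or> u = 0) \<and> (v < r \<or> v = 0) \<longleftrightarrow> max u v < r \<or> max u v = 0" if "0 \<le> r" for r
      using that X(2) Y(2) by (auto simp: max_def)
    moreover have "0 \<le> T x w" if "(w, x) \<in> space W_exp" for w x
      using T_nonneg[of x w] that by (simp add: space_W_exp)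
    ultimately show ?thesis unfolding X(1) Y(1) past_set_def by blast
  qed
  ultimately show "X \<inter> Y \<in> past_sets"
    unfolding past_sets_def using X(2) by (intro CollectI exI[of _ "max u v"] exI[of _ "A \<inter> B"]) auto
qed

lemma past_sets_subset: "past_sets \<subseteq> sets W_exp"
  unfolding past_sets_def using past_set_sets by blast

lemma sets_past_algebra: "sets past_algebra = sigma_sets (space W_exp) past_sets"
  unfolding past_algebra_def
  by (rule sets_measure_of) (use past_sets_subset sets.sets_into_space in blast)

lemma space_past_algebra [simp]: "space past_algebra = space W_exp"
  by (simp add: past_algebra_def space_measure_of_conv)

lemma sets_past_algebra_subset: "sets past_algebra \<subseteq> sets W_exp"
  unfolding sets_past_algebra by (rule sets.sigma_sets_subset[OF past_sets_subset])

lemma past_algebra_product: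
  assumes X: "X \<in> sets past_algebra" and B: "renewing B"
  shows "measure W_exp (X \<inter> B) = measure W_exp X * measure W_exp B"
proof -
  interpret WE: prob_space W_exp by (rule prob_space_W_exp)
  have BW: "B \<in> sets W_exp" using B by (simp add: renewing_def)
  have "WE.indep_set past_sets {B}"
  proof (rule WE.indep_setI)
    show "past_sets \<subseteq> WE.events" by (rule past_sets_subset)
    show "{B} \<subseteq> WE.events" using BW by simp
    fix a b assume "a \<in> past_sets" "b \<in> {B}"
    then show "WE.prob (a \<inter> b) = WE.prob a * WE.prob b"
      unfolding past_sets_def using past_set_product[OF _ _ B] by auto
  qed
  then have "WE.indep_set (sigma_sets (space W_exp) past_sets) (sigma_sets (space W_exp) {B})"
    by (rule WE.indep_set_sigma_sets[OF _ Int_stable_past_sets]) (simp add: Int_stable_def)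
  then show ?thesis
    by (rule WE.indep_setD) (use X in \<open>auto simp: sets_past_algebra intro: sigma_sets.Basic\<close>)
qed

text \<open>Left continuity allows evaluation at the last grid time strictly before T. There the
  value is known at the grid time and T lies beyond it, which is the form of the generators. Hence
  the field of the left-continuous processes at T is contained in
  \<open>past_algebra\<close>.\<close>

lemma measurable_left_continuous_at_T:
  assumes Z: "\<And>w t. w \<in> space W \<Longrightarrow> 0 < t \<Longrightarrow> continuous (at_left t) (\<lambda>s. Z s w)"
    and ad: "\<And>t. 0 \<le> t \<Longrightarrow> Z t \<in> borel_measurable (incr_field W (-\<infinity>) (ereal t))"
  shows "(\<lambda>p. Z (T (snd p) (fst p)) (fst p) :: real) \<in> borel_measurable past_algebra"
proof (rule borel_measurable_LIMSEQ_real)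
  \<comment> \<open>The index of the grid cell, open on the left, that contains T. For T = 0 the
    ceiling minus one is -1, which \<open>nat\<close> turns into 0, in accordance with the clause
    \<open>u = 0\<close> of \<open>past_set\<close>.\<close>
  define \<kappa> where "\<kappa> n p = nat (\<lceil>T (snd p) (fst p) * 2^n\<rceil> - 1)" for n :: nat and p :: "(real \<Rightarrow> real) \<times> real"
  have kap: "\<kappa> n p = k \<longleftrightarrow> (grid n k < T (snd p) (fst p) \<or> grid n k = 0) \<and> \<not> (grid n (Suc k) < T (snd p) (fst p) \<or> grid n (Suc k) = 0)"
    if "p \<in> space W_exp" for n k p
  proof -
    have T0: "0 \<le> T (snd p) (fst p)" using T_nonneg that by (auto simp: space_W_exp)
    let ?y = "T (snd p) (fst p) * 2^n"
    have "grid n k < T (snd p) (fst p) \<longleftrightarrow> real k < ?y" "grid n (Suc k) < T (snd p) (fst p) \<longleftrightarrow> real k + 1 < ?y"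
      by (simp_all add: divide_less_eq add.commute)
    moreover have "grid n k = 0 \<longleftrightarrow> k = 0" "grid n (Suc k) \<noteq> 0" by auto
    moreover have "nat (\<lceil>?y\<rceil> - 1) = k \<longleftrightarrow> (real k < ?y \<or> k = 0) \<and> \<not> real k + 1 < ?y"
    proof (cases "?y = 0")
      case False
      then have "0 < ?y" using T0 by simp
      then show ?thesis by linarith
    qed auto
    ultimately show ?thesis unfolding \<kappa>_def by simp
  qed
  show "(\<lambda>n. Z (grid n (\<kappa> n p)) (fst p)) \<longlonglongrightarrow> Z (T (snd p) (fst p)) (fst p)" if p: "p \<in> space past_algebra" for p
  proof (cases "T (snd p) (fst p) = 0")
    case True
    then have "\<kappa> n p = 0" for n by (simp add: \<kappa>_def)
    then show ?thesis using True by simp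
  next
    case False
    let ?t = "T (snd p) (fst p)"
    have pw: "fst p \<in> space W" "0 < snd p" and pe: "p \<in> space W_exp" using p by (auto simp: space_W_exp)
    have t: "0 < ?t" using T_nonneg[OF pw(2,1)] False by simp
    have lt: "grid n (\<kappa> n p) < ?t" and ge: "?t - 1 / 2^n \<le> grid n (\<kappa> n p)" for n
    proof -
      have "(grid n (\<kappa> n p) < ?t \<or> grid n (\<kappa> n p) = 0) \<and> \<not> (grid n (Suc (\<kappa> n p)) < ?t \<or> grid n (Suc (\<kappa> n p)) = 0)"
        using kap[OF pe, of n "\<kappa> n p"] by blast
      moreover have "grid n (Suc (\<kappa> n p)) = grid n (\<kappa> n p) + 1 / 2^n" by (simp add: add_divide_distrib)
      ultimately show "grid n (\<kappa> n p) < ?t" "?t - 1 / 2^n \<le> grid n (\<kappa> n p)" using t by linarith+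
    qed
    have "(\<lambda>n. grid n (\<kappa> n p)) \<longlonglongrightarrow> ?t"
    proof (rule tendsto_sandwich[of "\<lambda>n. ?t - 1 / 2^n" _ _ "\<lambda>_. ?t"])
      show "(\<lambda>n. ?t - 1 / 2^n) \<longlonglongrightarrow> ?t" using tendsto_diff[OF tendsto_const inverse_power_tendsto, of ?t] by simp
    qed (use ge lt in \<open>auto intro!: always_eventually less_imp_le\<close>)
    then have "filterlim (\<lambda>n. grid n (\<kappa> n p)) (at_left ?t) sequentially"
      unfolding filterlim_at using lt by (auto intro!: always_eventually simp: less_imp_neq)
    moreover have "((\<lambda>s. Z s (fst p)) \<longlongrightarrow> Z ?t (fst p)) (at_left ?t)"
      using Z[OF pw(1) t] by (simp add: continuous_within)
    ultimately show ?thesis by (rule filterlim_compose[rotated])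
  qed
  fix n
  show "(\<lambda>p. Z (grid n (\<kappa> n p)) (fst p)) \<in> borel_measurable past_algebra"
  proof (rule measurableI)
    fix A :: "real set" assume A: "A \<in> sets borel"
    let ?C = "\<lambda>k. Z (grid n k) -` A \<inter> space W"
    have C: "?C k \<in> sets (incr_field W (-\<infinity>) (ereal (grid n k)))" for k
      using measurable_sets[OF ad A, of "grid n k"] by simp
    have "(\<lambda>p. Z (grid n (\<kappa> n p)) (fst p)) -` A \<inter> space past_algebra = (\<Union>k. past_set (grid n k) (?C k) - past_set (grid n (Suc k)) (space W))"
    proof (rule set_eqI)
      fix p
      show "p \<in> (\<lambda>p. Z (grid n (\<kappa> n p)) (fst p)) -` A \<inter> space past_algebra \<longleftrightarrow> p \<in> (\<Union>k. past_set (grid n k) (?C k) - past_set (grid n (Suc k)) (space W))"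
      proof (cases "p \<in> space W_exp")
        case True
        then have pw: "fst p \<in> space W" by (auto simp: space_W_exp)
        have "p \<in> past_set (grid n k) (?C k) - past_set (grid n (Suc k)) (space W) \<longleftrightarrow> \<kappa> n p = k \<and> Z (grid n k) (fst p) \<in> A" for k
          unfolding kap[OF True] past_set_def using True pw by (simp add: case_prod_beta') blast
        then show ?thesis using True by auto
      next
        case False
        then show ?thesis by (auto simp: past_set_def)
      qed
    qed
    also have "\<dots> \<in> sets past_algebra"
    proof (intro sets.countable_UN image_subsetI sets.Diff)
      fix k
      show "past_set (grid n k) (?C k) \<in> sets past_algebra"
        unfolding sets_past_algebra past_sets_def using C by (intro sigma_sets.Basic CollectI exI conjI refl) auto
      show "past_set (grid n (Suc k)) (space W) \<in> sets past_algebra"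
        unfolding sets_past_algebra past_sets_def
        by (intro sigma_sets.Basic CollectI exI conjI refl) (auto intro!: incr_field_trivial simp: prob_space.emeasure_space_1[OF prob_space_W, simplified])
    qed
    finally show "(\<lambda>p. Z (grid n (\<kappa> n p)) (fst p)) -` A \<inter> space past_algebra \<in> sets past_algebra" .
  qed simp
qed

end

section \<open>Path functionals before and after the splitting time\<close>

lemma left_continuous_path:
  fixes f :: "real \<Rightarrow> real"
  assumes "continuous_on UNIV f" shows "continuous (at_left t) f"
  using assms by (auto simp: continuous_on_eq_continuous_at intro: continuous_at_imp_continuous_at_within)

text \<open>Extension by 0 to negative times, so that a one-sided path can be evaluated at any
  random time.\<close>

lemma measurable_path_extend:
  "(\<lambda>f t. f (max t 0)) \<in> path_borel {0..} \<rightarrow>\<^sub>M path_borel UNIV"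
proof (rule measurable_path_borelI)
  fix f :: "real \<Rightarrow> real" assume "f \<in> space (path_borel {0..})"
  then have f: "continuous_on {0..} f" "f 0 = 0" by (auto dest: pathsD)
  have "continuous_on UNIV (\<lambda>t. f (max t 0))"
    by (rule continuous_on_compose2[OF f(1)]) (auto intro: continuous_on_max continuous_on_id continuous_on_const)
  then show "(\<lambda>t. f (max t 0)) \<in> paths UNIV" using f(2) by (simp add: paths_UNIV_iff)
qed (auto intro: measurable_path_eval)

context exp_splitting_time
begin

lemma measurable_fst_W_exp: "fst \<in> W_exp \<rightarrow>\<^sub>M path_borel UNIV"
proof -
  have "(\<lambda>w. w) \<in> W \<rightarrow>\<^sub>M path_borel UNIV"
    using measurable_completion[OF measurable_ident_sets[OF sets_P]] .
  from measurable_compose[OF measurable_fst this] show ?thesis by (simp only: with_exp_def)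
qed

definition future :: "(real \<Rightarrow> real) \<times> real \<Rightarrow> real \<times> (real \<Rightarrow> real)" where
  "future p = (snd p - T (snd p) (fst p), restrict (levy_shift (T (snd p) (fst p)) (fst p)) {0..})"

text \<open>\<open>f\<close> replaces \<open>g\<close> where only increments after 0 are available:
  the two agree at nonnegative times, and the shift by a nonnegative \<open>r\<close> looks at no
  others.\<close>

lemma measurable_shifted_path:
  assumes f: "f \<in> N \<rightarrow>\<^sub>M path_borel UNIV" and r: "r \<in> borel_measurable N"
    and e: "\<And>y. y \<in> space N \<Longrightarrow> g y \<in> paths UNIV \<and> 0 \<le> r y" "\<And>y t. y \<in> space N \<Longrightarrow> 0 \<le> t \<Longrightarrow> f y t = g y t"
  shows "(\<lambda>y. restrict (levy_shift (r y) (g y)) {0..}) \<in> N \<rightarrow>\<^sub>M path_borel {0..}"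
proof (rule measurable_path_borelI)
  show "restrict (levy_shift (r y) (g y)) {0..} \<in> paths {0..}" if "y \<in> space N" for y
    using restrict_levy_shift_paths e(1)[OF that] by blast
  fix t :: real assume t: "t \<in> {0..}"
  have "(\<lambda>y. f y (r y + t) - f y (r y)) \<in> borel_measurable N"
    by (intro borel_measurable_diff borel_measurable_path_at[OF f] borel_measurable_add r borel_measurable_const)
  then show "(\<lambda>y. restrict (levy_shift (r y) (g y)) {0..} t) \<in> borel_measurable N"
    by (rule measurable_cong[THEN iffD1, rotated]) (use e t in \<open>simp add: levy_shift_def\<close>)
qed simp

lemma measurable_future: "future \<in> W_exp \<rightarrow>\<^sub>M future_space"
  unfolding future_def future_space_def
proof (rule measurable_Pair)
  show "(\<lambda>p. snd p - T (snd p) (fst p)) \<in> borel_measurable W_exp"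
    by (intro borel_measurable_diff measurable_snd_W_exp T_joint')
  show "(\<lambda>p. restrict (levy_shift (T (snd p) (fst p)) (fst p)) {0..}) \<in> W_exp \<rightarrow>\<^sub>M path_borel {0..}"
    by (rule measurable_shifted_path[OF measurable_fst_W_exp T_joint'])
      (use T_nonneg in \<open>auto simp: space_W_exp space_P\<close>)
qed

lemma T_restart:
  assumes "0 < s" "s < x"
  shows "AE w in W. s < T x w \<longrightarrow> T x w = s + T (x - s) (levy_shift s w)"
proof -
  have "AE w in W. s < T x w \<and> T x w < s + (x - s) \<longrightarrow> T x w = s + T (x - s) (levy_shift s w)"
    by (rule T_nested) (use assms in auto)
  moreover have "AE w in W. 0 < T x w \<and> T x w < x" by (rule T_range) (use assms in auto)
  ultimately show ?thesis by eventually_elim simp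
qed

text \<open>A restart at s before T lowers T and the exponential time by s and moves the origin of
  the path by s; neither the remaining time nor the path after T changes.\<close>

lemma renewing_future:
  assumes X: "X \<in> sets future_space" shows "renewing (future -` X \<inter> space W_exp)"
  unfolding renewing_def
proof (intro conjI allI impI)
  show "future -` X \<inter> space W_exp \<in> sets W_exp" by (rule measurable_sets[OF measurable_future X])
  fix x :: real assume x: "0 < x"
  have "(\<lambda>w. (x - T x w, restrict (levy_shift (T x w) w) {0..})) \<in> incr_field W 0 \<infinity> \<rightarrow>\<^sub>M future_space"
    unfolding future_space_def
  proof (rule measurable_Pair)
    show "(\<lambda>w. x - T x w) \<in> borel_measurable (incr_field W 0 \<infinity>)"
      by (intro borel_measurable_diff borel_measurable_const T_future_measurable[OF x])
    show "(\<lambda>w. restrict (levy_shift (T x w) w) {0..}) \<in> incr_field W 0 \<infinity> \<rightarrow>\<^sub>M path_borel {0..}"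
      by (rule measurable_shifted_path[OF measurable_future_clip T_future_measurable[OF x]])
        (use T_nonneg[OF x] in \<open>auto simp: space_P max_absorb1\<close>)
  qed
  from measurable_sets[OF this X]
  show "fibre (future -` X \<inter> space W_exp) x \<in> sets (incr_field W 0 \<infinity>)"
    by (rule back_subst[of "\<lambda>Y. Y \<in> sets (incr_field W 0 \<infinity>)"])
      (use x in \<open>auto simp: fibre_def future_def space_W_exp\<close>)
next
  fix s x :: real assume sx: "0 < s" "s < x"
  show "AE w in W. s < T x w \<longrightarrow> ((w, x) \<in> future -` X \<inter> space W_exp \<longleftrightarrow> (levy_shift s w, x - s) \<in> future -` X \<inter> space W_exp)"
    using T_restart[OF sx] AE_space[of W]
  proof eventually_elim
    case (elim w)
    show ?case
    proof
      assume "s < T x w"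
      then have T: "T x w = s + T (x - s) (levy_shift s w)" using elim by simp
      have "future (w, x) = future (levy_shift s w, x - s)"
        unfolding future_def by (simp add: levy_shift_levy_shift) (simp add: T)
      then show "(w, x) \<in> future -` X \<inter> space W_exp \<longleftrightarrow> (levy_shift s w, x - s) \<in> future -` X \<inter> space W_exp"
        using sx elim(2) levy_shift_paths by (simp add: space_W_exp space_P)
    qed
  qed
qed

text \<open>The event that T lies in the random set, expressed by an enumeration so that it is
  measurable before completion.\<close>

definition mark :: "(nat \<Rightarrow> (real \<Rightarrow> real) \<Rightarrow> real option) \<Rightarrow> ((real \<Rightarrow> real) \<times> real) set" where
  "mark S = {p \<in> space W_exp. \<exists>i. S i (fst p) = Some (T (snd p) (fst p))}"

text \<open>T being positive, locality on (0, \<infinity>) makes the fibres events of the future of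
  0; stationarity carries membership over to the restarted path.\<close>

lemma renewing_mark:
  assumes M: "stationary_local_rcs W M" and S: "measurable_enumeration W W M S"
  shows "renewing (mark S)"
  unfolding renewing_def
proof (intro conjI allI impI)
  have MS: "AE w in W. M w = {x. \<exists>i. S i w = Some x}" using S by (simp add: measurable_enumeration_def)
  have SW: "S i \<in> W \<rightarrow>\<^sub>M coffin_borel" for i using S by (simp add: measurable_enumeration_def)
  have "{p \<in> space W_exp. S i (fst p) = Some (T (snd p) (fst p))} \<in> sets W_exp" for i
    by (rule coffin_graph_sets[OF _ T_joint']) (unfold with_exp_def, rule measurable_compose[OF measurable_fst SW])
  then have "(\<Union>i. {p \<in> space W_exp. S i (fst p) = Some (T (snd p) (fst p))}) \<in> sets W_exp" by blast
  moreover have "(\<Union>i. {p \<in> space W_exp. S i (fst p) = Some (T (snd p) (fst p))}) = mark S" unfolding mark_def by blast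
  ultimately show mark: "mark S \<in> sets W_exp" by (simp only:)
  fix x :: real assume x: "0 < x"
  have "(0::ereal) < \<infinity>" by simp
  then obtain S' where "measurable_enumeration W (incr_field W 0 \<infinity>) (\<lambda>w. M w \<inter> {x. 0 < ereal x \<and> ereal x < \<infinity>}) S'"
    using M unfolding stationary_local_rcs_def local_set_def by blast
  then have S': "\<And>i. S' i \<in> incr_field W 0 \<infinity> \<rightarrow>\<^sub>M coffin_borel" "AE w in W. M w \<inter> {x. 0 < ereal x \<and> ereal x < \<infinity>} = {x. \<exists>i. S' i w = Some x}"
    unfolding measurable_enumeration_def by blast+
  let ?F = "incr_field W 0 \<infinity>"
  have "{w \<in> space ?F. S' i w = Some (T x w)} \<in> sets ?F" for i
    by (rule coffin_graph_sets[OF S'(1) T_future_measurable[OF x]])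
  then have F: "(\<Union>i. {w \<in> space ?F. S' i w = Some (T x w)}) \<in> sets ?F" by blast
  show "fibre (mark S) x \<in> sets ?F"
  proof (rule incr_field_AE_sets[OF F])
    show "fibre (mark S) x \<subseteq> space W" using x by (auto simp: fibre_def mark_def space_W_exp)
    show "AE w in W. w \<in> (\<Union>i. {w \<in> space ?F. S' i w = Some (T x w)}) \<longleftrightarrow> w \<in> fibre (mark S) x"
      using MS S'(2) T_range[OF x] AE_space[of W]
    proof eventually_elim
      case (elim w)
      have "(\<exists>i. S' i w = Some (T x w)) \<longleftrightarrow> T x w \<in> M w \<inter> {x. 0 < ereal x \<and> ereal x < \<infinity>}" unfolding elim(2) by blast
      also have "\<dots> \<longleftrightarrow> T x w \<in> M w" using elim(3) by simp
      also have "\<dots> \<longleftrightarrow> (\<exists>i. S i w = Some (T x w))" unfolding elim(1) by blast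
      finally show ?case using elim(4) x by (simp add: fibre_def mark_def space_W_exp)
    qed
  qed
next
  have MS: "AE w in W. M w = {x. \<exists>i. S i w = Some x}" using S by (simp add: measurable_enumeration_def)
  fix s x :: real assume sx: "0 < s" "s < x"
  have "AE w in W. M w = (\<lambda>x. s + x) ` M (levy_shift s w)"
    using M unfolding stationary_local_rcs_def stationary_set_def by blast
  then show "AE w in W. s < T x w \<longrightarrow> ((w, x) \<in> mark S \<longleftrightarrow> (levy_shift s w, x - s) \<in> mark S)"
    using MS AE_levy_shift[OF MS, of s] T_restart[OF sx] AE_space[of W]
  proof eventually_elim
    case (elim w)
    show ?case
    proof
      assume "s < T x w"
      then have T: "T x w = s + T (x - s) (levy_shift s w)" using elim(4) by simp
      have "(\<exists>i. S i w = Some (T x w)) \<longleftrightarrow> T x w \<in> M w" unfolding elim(2) by blast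
      also have "\<dots> \<longleftrightarrow> T (x - s) (levy_shift s w) \<in> M (levy_shift s w)" unfolding elim(1) T by auto
      also have "\<dots> \<longleftrightarrow> (\<exists>i. S i (levy_shift s w) = Some (T (x - s) (levy_shift s w)))" unfolding elim(3) by blast
      finally show "(w, x) \<in> mark S \<longleftrightarrow> (levy_shift s w, x - s) \<in> mark S"
        using sx elim(5) levy_shift_paths by (simp add: mark_def space_W_exp space_P)
    qed
  qed
qed

lemma AE_W_exp_fst:
  assumes "AE w in W. Q w" shows "AE p in W_exp. Q (fst p)"
proof -
  interpret pair_prob_space W "exp_law l" by (rule pair_prob)
  obtain N where N0: "{w \<in> space W. \<not> Q w} \<subseteq> N" "emeasure W N = 0" "N \<in> sets W" by (rule AE_E[OF assms])
  then have N: "N \<in> null_sets W" "{w \<in> space W. \<not> Q w} \<subseteq> N" by (blast intro: null_setsI)+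
  have "N \<times> space (exp_law l) \<in> null_sets W_exp"
    unfolding with_exp_def by (rule M2.times_in_null_sets1[OF N(1) sets.top])
  then show ?thesis by (rule AE_I') (use N(2) in \<open>auto simp: space_W_exp\<close>)
qed

lemma AE_mark:
  assumes S: "measurable_enumeration W W M S"
  shows "AE p in W_exp. p \<in> mark S \<longleftrightarrow> p \<in> {(w, x) \<in> space W_exp. T x w \<in> M w}"
proof -
  have "AE w in W. M w = {x. \<exists>i. S i w = Some x}" using S by (simp add: measurable_enumeration_def)
  from AE_W_exp_fst[OF this] show ?thesis
    using AE_space[of W_exp] by eventually_elim (auto simp: mark_def)
qed

definition stopped_past :: "(real \<Rightarrow> real) \<times> real \<Rightarrow> real \<times> (real \<Rightarrow> real)" where
  "stopped_past p = (T (snd p) (fst p), stopped (T (snd p) (fst p)) (fst p))"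

definition reversed_past :: "(real \<Rightarrow> real) \<times> real \<Rightarrow> real \<times> (real \<Rightarrow> real)" where
  "reversed_past p = (T (snd p) (fst p), restrict (time_refl (levy_shift (T (snd p) (fst p)) (fst p))) {0..})"

lemma T_past_algebra: "(\<lambda>p. T (snd p) (fst p)) \<in> borel_measurable past_algebra"
  using measurable_left_continuous_at_T[of "\<lambda>s w. s"] by simp

text \<open>Each coordinate of the stopped path is a left-continuous adapted process evaluated at
  T.\<close>

lemma measurable_stopped_past: "stopped_past \<in> past_algebra \<rightarrow>\<^sub>M borel \<Otimes>\<^sub>M path_borel UNIV"
  unfolding stopped_past_def
proof (rule measurable_Pair[OF T_past_algebra], rule measurable_path_borelI)
  show "stopped (T (snd p) (fst p)) (fst p) \<in> paths UNIV" if "p \<in> space past_algebra" for p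
    using that T_nonneg clip_paths[OF _ min_clip] unfolding stopped_def by (auto simp: space_W_exp space_P)
  fix t :: real
  show "(\<lambda>p. stopped (T (snd p) (fst p)) (fst p) t) \<in> borel_measurable past_algebra"
    unfolding stopped_def
  proof (rule measurable_left_continuous_at_T[of "\<lambda>s w. w (min t s)"])
    fix w assume "w \<in> space W"
    then have "continuous_on UNIV w" by (simp add: space_P paths_UNIV_iff)
    then have "continuous_on UNIV (\<lambda>s. w (min t s))"
      by (rule continuous_on_compose2) (simp_all add: continuous_on_min continuous_on_const continuous_on_id)
    then show "continuous (at_left r) (\<lambda>s. w (min t s))" for r by (rule left_continuous_path)
  next
    fix s :: real assume "0 \<le> s"
    then have "(\<lambda>w. w (min t s) - w 0) \<in> borel_measurable (incr_field W (-\<infinity>) (ereal s))"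
      by (intro measurable_incr_field_increment) auto
    then show "(\<lambda>w. w (min t s)) \<in> borel_measurable (incr_field W (-\<infinity>) (ereal s))"
      by (rule measurable_cong[THEN iffD1, rotated]) (simp add: space_P paths_UNIV_iff)
  qed
qed simp

text \<open>Looking back from T by t evaluates the continuous process \<open>w (s - t) - w s\<close>
  at T; it is adapted because t is nonnegative.\<close>

lemma measurable_reversed_past: "reversed_past \<in> past_algebra \<rightarrow>\<^sub>M future_space"
  unfolding reversed_past_def future_space_def
proof (rule measurable_Pair[OF T_past_algebra], rule measurable_path_borelI)
  show "restrict (time_refl (levy_shift (T (snd p) (fst p)) (fst p))) {0..} \<in> paths {0..}" if "p \<in> space past_algebra" for p
    using that restrict_paths[OF time_refl_paths[OF levy_shift_paths]] by (auto simp: space_W_exp space_P)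
  fix t :: real assume t: "t \<in> {0..}"
  have "(\<lambda>p. fst p (T (snd p) (fst p) - t) - fst p (T (snd p) (fst p))) \<in> borel_measurable past_algebra"
  proof (rule measurable_left_continuous_at_T[of "\<lambda>s w. w (s - t) - w s"])
    fix w assume "w \<in> space W"
    then have w: "continuous_on UNIV w" by (simp add: space_P paths_UNIV_iff)
    have "continuous_on UNIV (\<lambda>s. w (s - t))"
      by (rule continuous_on_compose2[OF w]) (simp_all add: continuous_on_diff continuous_on_const continuous_on_id)
    then have "continuous_on UNIV (\<lambda>s. w (s - t) - w s)" using w by (rule continuous_on_diff)
    then show "continuous (at_left r) (\<lambda>s. w (s - t) - w s)" for r by (rule left_continuous_path)
  next
    fix s :: real assume "0 \<le> s"
    then show "(\<lambda>w. w (s - t) - w s) \<in> borel_measurable (incr_field W (-\<infinity>) (ereal s))"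
      using t by (intro measurable_incr_field_increment) auto
  qed
  moreover have "restrict (time_refl (levy_shift r w)) {0..} t = w (r - t) - w r" for r w
    using t by (simp add: time_refl_def levy_shift_def)
  ultimately show "(\<lambda>p. restrict (time_refl (levy_shift (T (snd p) (fst p)) (fst p))) {0..} t) \<in> borel_measurable past_algebra"
    by (simp only:)
qed simp

text \<open>The path is recovered by gluing, and the exponential time by adding, so that an event independent
  of past and future jointly is independent of itself.\<close>

lemma trivial_if_independent_of_past_and_future:
  assumes C: "C \<in> sets W_exp"
    and ind: "\<And>X Y. X \<in> sets past_algebra \<Longrightarrow> Y \<in> sets future_space \<Longrightarrow>
      measure W_exp (X \<inter> (C \<inter> (future -` Y \<inter> space W_exp))) = measure W_exp X * measure W_exp (future -` Y \<inter> space W_exp) * measure W_exp C"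
  shows "measure W_exp C \<in> {0, 1}"
proof -
  interpret WE: prob_space W_exp by (rule prob_space_W_exp)
  interpret W: prob_space W by (rule prob_space_W)
  interpret E: prob_space "exp_law l" by (rule prob_space_exp_law[OF l_pos])
  let ?D = "\<lambda>Y. future -` Y \<inter> space W_exp"
  \<comment> \<open>An intersection-stable system. The assumption on \<open>C\<close>, together with
    the independence of past and future, makes \<open>C\<close> independent of it.\<close>
  define G where "G = {X \<inter> ?D Y | X Y. X \<in> sets past_algebra \<and> Y \<in> sets future_space}"
  have DW: "?D Y \<in> sets W_exp" if "Y \<in> sets future_space" for Y by (rule measurable_sets[OF measurable_future that])
  have GW: "G \<subseteq> sets W_exp" unfolding G_def using sets_past_algebra_subset DW by blast
  have GI: "Int_stable G"
  proof (rule Int_stableI)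
    fix a b assume "a \<in> G" "b \<in> G"
    then obtain X Y X' Y' where "a = X \<inter> ?D Y" "b = X' \<inter> ?D Y'" "X \<in> sets past_algebra" "Y \<in> sets future_space"
      "X' \<in> sets past_algebra" "Y' \<in> sets future_space" unfolding G_def by blast
    then show "a \<inter> b \<in> G" unfolding G_def by (intro CollectI exI[of _ "X \<inter> X'"] exI[of _ "Y \<inter> Y'"]) auto
  qed
  have "WE.indep_set G {C}"
  proof (rule WE.indep_setI[OF GW])
    show "{C} \<subseteq> WE.events" using C by simp
    fix a b assume "a \<in> G" "b \<in> {C}"
    then obtain X Y where XY: "a = X \<inter> ?D Y" "X \<in> sets past_algebra" "Y \<in> sets future_space" "b = C" unfolding G_def by blast
    have "WE.prob (a \<inter> b) = WE.prob (X \<inter> (C \<inter> ?D Y))" unfolding XY by (rule arg_cong[of _ _ WE.prob]) blast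
    also have "\<dots> = WE.prob X * WE.prob (?D Y) * WE.prob C" by (rule ind[OF XY(2,3)])
    also have "WE.prob X * WE.prob (?D Y) = WE.prob a"
      unfolding XY(1) by (rule past_algebra_product[OF XY(2) renewing_future[OF XY(3)], symmetric])
    finally show "WE.prob (a \<inter> b) = WE.prob a * WE.prob b" unfolding XY(4) .
  qed
  then have "WE.indep_set (sigma_sets (space W_exp) G) (sigma_sets (space W_exp) {C})"
    by (rule WE.indep_set_sigma_sets[OF _ GI]) (simp add: Int_stable_def)
  then have indG: "WE.prob (a \<inter> C) = WE.prob a * WE.prob C" if "a \<in> sigma_sets (space W_exp) G" for a
    by (rule WE.indep_setD[OF _ that]) (auto intro: sigma_sets.Basic)
  define N where "N = sigma (space W_exp) G"
  have Gpow: "G \<subseteq> Pow (space W_exp)" using GW sets.sets_into_space by blast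
  have Nsets: "sets N = sigma_sets (space W_exp) G" unfolding N_def by (rule sets_measure_of[OF Gpow])
  have Nspace: "space N = space W_exp" by (simp add: N_def space_measure_of_conv)
  have pN: "sets past_algebra \<subseteq> sets N"
  proof
    fix X assume X: "X \<in> sets past_algebra"
    have "?D (space future_space) = space W_exp" using measurable_space[OF measurable_future] by blast
    then have "X = X \<inter> ?D (space future_space)" using sets.sets_into_space[OF X] by auto
    then have "X \<in> G" unfolding G_def using X by blast
    then show "X \<in> sets N" unfolding Nsets by (rule sigma_sets.Basic)
  qed
  have past: "f \<in> N \<rightarrow>\<^sub>M M" if "f \<in> past_algebra \<rightarrow>\<^sub>M M" for f and M :: "'c measure"
    by (rule measurable_from_subalg[OF _ that]) (simp add: subalgebra_def pN Nspace)
  have fut: "future \<in> N \<rightarrow>\<^sub>M future_space"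
  proof (rule measurableI)
    show "future p \<in> space future_space" if "p \<in> space N" for p using measurable_space[OF measurable_future] that Nspace by simp
    fix Y assume Y: "Y \<in> sets future_space"
    have "?D Y = space past_algebra \<inter> ?D Y" by auto
    then have "?D Y \<in> G" unfolding G_def using Y sets.top[of past_algebra] by blast
    then show "future -` Y \<inter> space N \<in> sets N" unfolding Nsets Nspace by (rule sigma_sets.Basic)
  qed
  \<comment> \<open>The field generated by \<open>G\<close> determines the path and the exponential
    time, but only as far as Borel events of the path are concerned.\<close>
  have id: "(\<lambda>p. (fst p, snd p)) \<in> N \<rightarrow>\<^sub>M P \<Otimes>\<^sub>M exp_law l"
  proof (rule measurable_Pair)
    have T: "(\<lambda>p. T (snd p) (fst p)) \<in> borel_measurable N" by (rule past[OF T_past_algebra])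
    have st: "(\<lambda>p. stopped (T (snd p) (fst p)) (fst p)) \<in> N \<rightarrow>\<^sub>M path_borel UNIV"
      using measurable_compose[OF past[OF measurable_stopped_past] measurable_snd] by (simp add: stopped_past_def)
    have f1: "(\<lambda>p. snd p - T (snd p) (fst p)) \<in> borel_measurable N"
      using measurable_compose[OF fut[unfolded future_space_def] measurable_fst] by (simp add: future_def)
    have f2: "(\<lambda>p. \<lambda>t. (restrict (levy_shift (T (snd p) (fst p)) (fst p)) {0..}) (max t 0)) \<in> N \<rightarrow>\<^sub>M path_borel UNIV"
      using measurable_compose[OF measurable_compose[OF fut[unfolded future_space_def] measurable_snd] measurable_path_extend] by (simp add: future_def)
    have "fst \<in> N \<rightarrow>\<^sub>M path_borel UNIV"
    proof (rule measurable_path_borelI)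
      show "fst p \<in> paths UNIV" if "p \<in> space N" for p using that by (auto simp: Nspace space_W_exp space_P)
      fix t :: real
      have "(\<lambda>p. stopped (T (snd p) (fst p)) (fst p) t + (restrict (levy_shift (T (snd p) (fst p)) (fst p)) {0..}) (max (t - T (snd p) (fst p)) 0)) \<in> borel_measurable N"
        by (intro borel_measurable_add borel_measurable_path_at[OF st] borel_measurable_path_at[OF f2] borel_measurable_const borel_measurable_diff T)
      \<comment> \<open>Before \<open>r\<close> the second term vanishes and the stopped path has
        the value; afterwards the second term adds the increment since \<open>r\<close>.\<close>
      moreover have "stopped r w t + (restrict (levy_shift r w) {0..}) (max (t - r) 0) = w t" for r w
        by (cases "t \<le> r") (simp_all add: stopped_def levy_shift_def min_absorb1 min_absorb2 max_absorb1 max_absorb2)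
      ultimately show "(\<lambda>p. fst p t) \<in> borel_measurable N" by (simp only:)
    qed simp
    then show "fst \<in> N \<rightarrow>\<^sub>M P" unfolding measurable_cong_sets[OF refl sets_P] .
    have "(\<lambda>p. T (snd p) (fst p) + (snd p - T (snd p) (fst p))) \<in> borel_measurable N"
      by (rule borel_measurable_add[OF T f1])
    then have "snd \<in> borel_measurable N" by simp
    then have "snd \<in> N \<rightarrow>\<^sub>M restrict_space borel {0<..}"
      by (rule measurable_restrict_space2[rotated]) (auto simp: Nspace space_W_exp)
    then show "snd \<in> N \<rightarrow>\<^sub>M exp_law l" unfolding measurable_cong_sets[OF refl sets_exp_law] .
  qed
  have raw: "A \<times> B \<in> sigma_sets (space W_exp) G" if AB: "A \<in> sets P" "B \<in> sets (exp_law l)" for A B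
  proof -
    have "(\<lambda>p. (fst p, snd p)) -` (A \<times> B) \<inter> space N \<in> sets N" by (rule measurable_sets[OF id pair_measureI[OF AB]])
    moreover have "(\<lambda>p. (fst p, snd p)) -` (A \<times> B) \<inter> space N = A \<times> B"
      using sets.sets_into_space[OF AB(1)] sets.sets_into_space[OF AB(2)] by (auto simp: Nspace space_W_exp)
    ultimately show ?thesis unfolding Nsets by (simp only:)
  qed
  \<comment> \<open>From Borel to completed events: a completed event differs from its main part by
    a null set, so independence of \<open>C\<close> extends to all rectangles, and with them to a
    field containing \<open>C\<close>.\<close>
  let ?R = "{A \<times> B | A B. A \<in> sets W \<and> B \<in> sets (exp_law l)}"
  have "WE.indep_set ?R {C}"
  proof (rule WE.indep_setI)
    show "?R \<subseteq> WE.events" unfolding with_exp_def using pair_measureI by blast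
    show "{C} \<subseteq> WE.events" using C by simp
    fix a b assume "a \<in> ?R" "b \<in> {C}"
    then obtain A B where AB: "a = A \<times> B" "A \<in> sets W" "B \<in> sets (exp_law l)" "b = C" by blast
    let ?A = "main_part P A"
    have mp: "?A \<in> sets P" by (rule main_part_sets[OF AB(2)])
    have "AE w in W. w \<in> A \<longleftrightarrow> w \<in> ?A"
      using AE_in_main_part[OF AB(2)] unfolding AE_completion_iff by (auto elim: eventually_mono)
    then have ae: "AE p in W_exp. fst p \<in> A \<longleftrightarrow> fst p \<in> ?A" by (rule AE_W_exp_fst)
    have aW: "a \<in> sets W_exp" unfolding AB(1) with_exp_def by (rule pair_measureI[OF AB(2,3)])
    have a'W: "?A \<times> B \<in> sets W_exp" unfolding with_exp_def by (rule pair_measureI[OF sets_completionI_sets[OF mp] AB(3)])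
    have "WE.prob a = WE.prob (?A \<times> B)"
      by (rule WE.finite_measure_eq_AE[OF _ aW a'W]) (use ae in eventually_elim, auto simp: AB(1))
    moreover have "WE.prob (a \<inter> C) = WE.prob ((?A \<times> B) \<inter> C)"
      by (rule WE.finite_measure_eq_AE[OF _ sets.Int[OF aW C] sets.Int[OF a'W C]]) (use ae in eventually_elim, auto simp: AB(1))
    ultimately show "WE.prob (a \<inter> b) = WE.prob a * WE.prob b" using indG[OF raw[OF mp AB(3)]] unfolding AB(4) by simp
  qed
  then have "WE.indep_set (sigma_sets (space W_exp) ?R) (sigma_sets (space W_exp) {C})"
    by (rule WE.indep_set_sigma_sets) (simp_all add: Int_stable_pair_measure_generator, simp add: Int_stable_def)
  moreover have "C \<in> sigma_sets (space W_exp) ?R"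
    using C unfolding with_exp_def sets_pair_measure space_pair_measure .
  ultimately have "WE.prob (C \<inter> C) = WE.prob C * WE.prob C"
    by (rule WE.indep_setD) (auto intro: sigma_sets.Basic)
  then have "WE.prob C = 0 \<or> WE.prob C = 1" by simp
  then show ?thesis by simp
qed

end

section \<open>Nested indexations and time reversal\<close>

context wiener_space
begin

text \<open>The properties of an honest indexation that do not mention the random set. They pass to
  the dual, so that one development serves both.\<close>

definition nested_indexation :: "(real \<Rightarrow> real \<Rightarrow> (real \<Rightarrow> real) \<Rightarrow> real option) \<Rightarrow> bool" where
  "nested_indexation \<tau> \<longleftrightarrow>
     (\<forall>s t. s < t \<longrightarrow> (AE w in W. \<tau> s t w \<in> Some ` {s<..<t}) \<and>
        \<tau> s t \<in> incr_field W (ereal s) (ereal t) \<rightarrow>\<^sub>M coffin_borel) \<and>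
     (\<forall>h s t. s < t \<longrightarrow>
        (AE w in W. \<tau> (s + h) (t + h) w = map_option (\<lambda>x. h + x) (\<tau> s t (levy_shift h w)))) \<and>
     (\<forall>s u v t. s \<le> u \<and> u < v \<and> v \<le> t \<longrightarrow>
        (AE w in W. \<tau> s t w \<in> Some ` {u<..<v} \<longrightarrow> \<tau> s t w = \<tau> u v w))"

lemma honest_imp_nested: "honest_indexation W M \<tau> \<Longrightarrow> nested_indexation \<tau>"
  unfolding honest_indexation_def nested_indexation_def by blast

lemma nested_indexationD:
  assumes "nested_indexation \<tau>"
  shows "s < t \<Longrightarrow> AE w in W. \<tau> s t w \<in> Some ` {s<..<t}"
    and "s < t \<Longrightarrow> \<tau> s t \<in> incr_field W (ereal s) (ereal t) \<rightarrow>\<^sub>M coffin_borel"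
    and "s < t \<Longrightarrow> AE w in W. \<tau> (s + h) (t + h) w = map_option (\<lambda>x. h + x) (\<tau> s t (levy_shift h w))"
    and "s \<le> u \<Longrightarrow> u < v \<Longrightarrow> v \<le> t \<Longrightarrow> AE w in W. \<tau> s t w \<in> Some ` {u<..<v} \<longrightarrow> \<tau> s t w = \<tau> u v w"
  using assms unfolding nested_indexation_def by blast+

lemma map_option_uminus_image:
  "map_option uminus y \<in> Some ` {u<..<v} \<longleftrightarrow> y \<in> Some ` {-v<..<-u}" for u v :: real
  by (cases y) auto

text \<open>Reflection preserves \<open>W\<close> and exchanges the increment fields of (s, t) and
  (-t, -s), so each property of the dual is one of \<tau> on the reflected interval, read at the
  reflected path.\<close>

lemma nested_dual:
  assumes "nested_indexation \<tau>" shows "nested_indexation (dual_indexation \<tau>)"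
  unfolding nested_indexation_def
proof (intro conjI allI impI)
  fix s t :: real assume st: "s < t"
  then have st': "-t < -s" by simp
  have "AE w in W. \<tau> (-t) (-s) (time_refl w) \<in> Some ` {-t<..<-s}"
    by (rule AE_time_refl[OF nested_indexationD(1)[OF assms st']])
  then show "AE w in W. dual_indexation \<tau> s t w \<in> Some ` {s<..<t}"
    unfolding dual_indexation_def map_option_uminus_image .
  have "\<tau> (-t) (-s) \<in> incr_field W (- ereal t) (- ereal s) \<rightarrow>\<^sub>M coffin_borel"
    using nested_indexationD(2)[OF assms st'] by simp
  from measurable_compose[OF measurable_compose[OF measurable_time_refl_incr_field this] measurable_coffin_uminus]
  show "dual_indexation \<tau> s t \<in> incr_field W (ereal s) (ereal t) \<rightarrow>\<^sub>M coffin_borel"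
    by (simp add: dual_indexation_def[abs_def])
next
  fix h s t :: real assume st: "s < t"
  then have st': "-t < -s" by simp
  have "AE w in W. \<tau> (-t + -h) (-s + -h) (time_refl w) = map_option (\<lambda>x. -h + x) (\<tau> (-t) (-s) (levy_shift (-h) (time_refl w)))"
    by (rule AE_time_refl[OF nested_indexationD(3)[OF assms st']])
  then show "AE w in W. dual_indexation \<tau> (s + h) (t + h) w = map_option (\<lambda>x. h + x) (dual_indexation \<tau> s t (levy_shift h w))"
  proof eventually_elim
    case (elim w)
    have e: "-t + -h = - (t + h)" "-s + -h = - (s + h)" by simp_all
    show ?case unfolding dual_indexation_def elim[unfolded e]
      by (simp add: levy_shift_time_refl option.map_comp comp_def)
  qed
next
  fix s u v t :: real assume a: "s \<le> u \<and> u < v \<and> v \<le> t"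
  have "AE w in W. \<tau> (-t) (-s) (time_refl w) \<in> Some ` {-v<..<-u} \<longrightarrow> \<tau> (-t) (-s) (time_refl w) = \<tau> (-v) (-u) (time_refl w)"
    by (rule AE_time_refl[OF nested_indexationD(4)[OF assms]]) (use a in auto)
  then show "AE w in W. dual_indexation \<tau> s t w \<in> Some ` {u<..<v} \<longrightarrow> dual_indexation \<tau> s t w = dual_indexation \<tau> u v w"
    unfolding dual_indexation_def map_option_uminus_image by eventually_elim simp
qed

lemma splitting_time_of_nested:
  assumes \<tau>: "nested_indexation \<tau>" shows "splitting_time P (\<lambda>t w. the (\<tau> 0 t w))"
proof
  fix t :: real assume t: "0 < t"
  show "AE w in W. 0 < the (\<tau> 0 t w) \<and> the (\<tau> 0 t w) < t"
    using nested_indexationD(1)[OF \<tau> t] by eventually_elim auto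
  have "\<tau> 0 t \<in> incr_field W 0 (ereal t) \<rightarrow>\<^sub>M coffin_borel"
    using nested_indexationD(2)[OF \<tau> t] by (simp add: zero_ereal_def)
  from measurable_compose[OF this measurable_the]
  show "(\<lambda>w. the (\<tau> 0 t w)) \<in> borel_measurable (incr_field W 0 (ereal t))" .
next
  fix s r t :: real assume a: "0 \<le> s" "0 < r" "s + r \<le> t"
  then have t: "0 < t" by simp
  have "AE w in W. \<tau> 0 t w \<in> Some ` {s<..<s + r} \<longrightarrow> \<tau> 0 t w = \<tau> s (s + r) w"
    by (rule nested_indexationD(4)[OF \<tau>]) (use a in auto)
  moreover have "AE w in W. \<tau> (0 + s) (r + s) w = map_option (\<lambda>x. s + x) (\<tau> 0 r (levy_shift s w))"
    by (rule nested_indexationD(3)[OF \<tau> a(2)])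
  ultimately show "AE w in W. s < the (\<tau> 0 t w) \<and> the (\<tau> 0 t w) < s + r \<longrightarrow> the (\<tau> 0 t w) = s + the (\<tau> 0 r (levy_shift s w))"
    using nested_indexationD(1)[OF \<tau> t]
  proof eventually_elim
    case (elim w)
    show ?case
    proof
      assume w: "s < the (\<tau> 0 t w) \<and> the (\<tau> 0 t w) < s + r"
      obtain y where y: "\<tau> 0 t w = Some y" using elim(3) by blast
      then have "\<tau> 0 t w = \<tau> s (s + r) w" using elim(1) w by auto
      then have "Some y = map_option (\<lambda>x. s + x) (\<tau> 0 r (levy_shift s w))" using elim(2) y by (simp add: add.commute)
      then show "the (\<tau> 0 t w) = s + the (\<tau> 0 r (levy_shift s w))" using y by (cases "\<tau> 0 r (levy_shift s w)") auto
    qed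
  qed
qed

lemma exp_splitting_time_of_nested:
  assumes \<tau>: "nested_indexation \<tau>" and reg: "regular_indexation W \<tau>" and l: "0 < l"
  shows "exp_splitting_time P (\<lambda>t w. the (\<tau> 0 t w)) l"
proof (rule exp_splitting_time.intro[OF splitting_time_of_nested[OF \<tau>]], unfold_locales)
  show "0 < l" by (rule l)
  show "0 \<le> the (\<tau> 0 x w)" if "0 < x" "w \<in> space W" for x w
    using reg that unfolding regular_indexation_def by fastforce
  have r: "(\<lambda>(t, w). the (\<tau> 0 t w)) \<in> (restrict_space borel {0<..} \<Otimes>\<^sub>M W) \<rightarrow>\<^sub>M restrict_space borel {0..}"
    using reg unfolding regular_indexation_def by blast
  have "(\<lambda>y. y) \<in> restrict_space borel {0::real..} \<rightarrow>\<^sub>M borel" by (rule measurable_restrict_space1) simp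
  from measurable_compose[OF r this]
  have r': "(\<lambda>p. case p of (t, w) \<Rightarrow> the (\<tau> 0 t w)) \<in> borel_measurable (restrict_space borel {0<..} \<Otimes>\<^sub>M W)" .
  have "(\<lambda>p. (snd p, fst p)) \<in> with_exp W l \<rightarrow>\<^sub>M restrict_space borel {0<..} \<Otimes>\<^sub>M W"
  proof (rule measurable_Pair)
    have "snd \<in> with_exp W l \<rightarrow>\<^sub>M exp_law l" unfolding with_exp_def by (rule measurable_snd)
    then show "snd \<in> with_exp W l \<rightarrow>\<^sub>M restrict_space borel {0<..}" unfolding measurable_cong_sets[OF refl sets_exp_law] .
    show "fst \<in> with_exp W l \<rightarrow>\<^sub>M W" unfolding with_exp_def by (rule measurable_fst)
  qed
  from measurable_compose[OF this r'] show "(\<lambda>(w, x). the (\<tau> 0 x w)) \<in> borel_measurable (with_exp W l)"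
    by (simp add: case_prod_beta')
qed

section \<open>Reversal of time at a fixed time\<close>

definition reversal :: "real \<Rightarrow> (real \<Rightarrow> real) \<Rightarrow> real \<Rightarrow> real" where
  "reversal x w = time_refl (levy_shift x w)"

lemma time_refl_reversal: "time_refl (reversal x w) = levy_shift x w"
  by (simp add: reversal_def)

lemma levy_shift_reversal: "time_refl (levy_shift r (reversal x w)) = levy_shift (x - r) w"
  by (simp add: reversal_def levy_shift_time_refl levy_shift_levy_shift)

lemma measurable_reversal: "reversal x \<in> W \<rightarrow>\<^sub>M W"
  unfolding reversal_def[abs_def] by (rule measurable_compose[OF levy_shift_W time_refl_W])

lemma emeasure_reversal:
  assumes A: "A \<in> sets W" shows "emeasure W (reversal x -` A \<inter> space W) = emeasure W A"
proof -
  have "reversal x -` A \<inter> space W = levy_shift x -` (time_refl -` A \<inter> space W) \<inter> space W"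
    using levy_shift_paths by (auto simp: reversal_def space_P)
  then show ?thesis
    using emeasure_levy_shift[OF measurable_sets[OF time_refl_W A]] emeasure_time_refl[OF A] by (simp only:)
qed

text \<open>The reflection in the dual undoes the one in the reversal and leaves the shift by x;
  stationarity then moves the interval (-x, 0) to (0, x).\<close>

lemma dual_reversal:
  assumes \<tau>: "nested_indexation \<tau>" and x: "0 < x"
  shows "AE w in W. the (dual_indexation \<tau> 0 x (reversal x w)) = x - the (\<tau> 0 x w)"
proof -
  have "AE w in W. \<tau> (-x + x) (0 + x) w = map_option (\<lambda>y. x + y) (\<tau> (-x) 0 (levy_shift x w))"
    by (rule nested_indexationD(3)[OF \<tau>]) (use x in simp)
  then show ?thesis using nested_indexationD(1)[OF \<tau> x]
  proof eventually_elim
    case (elim w)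
    then obtain y where y: "\<tau> 0 x w = Some y" by blast
    then obtain z where z: "\<tau> (-x) 0 (levy_shift x w) = Some z" "y = x + z"
      using elim(1) by (cases "\<tau> (-x) 0 (levy_shift x w)") auto
    then show ?case using y by (simp add: dual_indexation_def time_refl_reversal)
  qed
qed

text \<open>Under reversal the dual time is tested against the reflected set, whose mark must again
  be renewing.\<close>

lemma stationary_local_rcs_dual:
  assumes M: "stationary_local_rcs W M"
  shows "stationary_local_rcs W (\<lambda>w. uminus ` M (time_refl w))"
    and "measurable_enumeration W W M S \<Longrightarrow>
      measurable_enumeration W W (\<lambda>w. uminus ` M (time_refl w)) (\<lambda>i w. map_option uminus (S i (time_refl w)))"
proof -
  have enum: "{x. \<exists>i. map_option uminus (S i v) = Some x} = uminus ` {x. \<exists>i. S i v = Some x}" for S :: "nat \<Rightarrow> (real \<Rightarrow> real) \<Rightarrow> real option" and v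
    by (force simp: image_iff)
  show en: "measurable_enumeration W W (\<lambda>w. uminus ` M (time_refl w)) (\<lambda>i w. map_option uminus (S i (time_refl w)))"
    if S: "measurable_enumeration W W M S" for S
    unfolding measurable_enumeration_def
  proof (intro conjI allI)
    show "(\<lambda>w. map_option uminus (S i (time_refl w))) \<in> W \<rightarrow>\<^sub>M coffin_borel" for i
      by (rule measurable_compose[OF measurable_compose[OF time_refl_W] measurable_coffin_uminus])
        (use S in \<open>simp add: measurable_enumeration_def\<close>)
    have "AE w in W. M w = {x. \<exists>i. S i w = Some x}" using S by (simp add: measurable_enumeration_def)
    from AE_time_refl[OF this]
    show "AE w in W. uminus ` M (time_refl w) = {x. \<exists>i. map_option uminus (S i (time_refl w)) = Some x}"
      unfolding enum by eventually_elim simp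
  qed
  show "stationary_local_rcs W (\<lambda>w. uminus ` M (time_refl w))"
    unfolding stationary_local_rcs_def
  proof (intro conjI)
    obtain S where "measurable_enumeration W W M S"
      using M unfolding stationary_local_rcs_def random_countable_set_def by blast
    from en[OF this] show "random_countable_set W (\<lambda>w. uminus ` M (time_refl w))"
      unfolding random_countable_set_def by blast
    show "local_set W (\<lambda>w. uminus ` M (time_refl w))"
      unfolding local_set_def
    proof (intro allI impI)
      fix s t :: ereal assume "s < t"
      then have "- t < - s" by simp
      then obtain S where S: "measurable_enumeration W (incr_field W (-t) (-s)) (\<lambda>w. M w \<inter> {x. -t < ereal x \<and> ereal x < -s}) S"
        using M unfolding stationary_local_rcs_def local_set_def by blast
      have "measurable_enumeration W (incr_field W s t) (\<lambda>w. uminus ` M (time_refl w) \<inter> {x. s < ereal x \<and> ereal x < t}) (\<lambda>i w. map_option uminus (S i (time_refl w)))"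
        unfolding measurable_enumeration_def
      proof (intro conjI allI)
        show "(\<lambda>w. map_option uminus (S i (time_refl w))) \<in> incr_field W s t \<rightarrow>\<^sub>M coffin_borel" for i
          by (rule measurable_compose[OF measurable_compose[OF measurable_time_refl_incr_field] measurable_coffin_uminus])
            (use S in \<open>simp add: measurable_enumeration_def\<close>)
        have "AE w in W. M w \<inter> {x. -t < ereal x \<and> ereal x < -s} = {x. \<exists>i. S i w = Some x}" using S by (simp add: measurable_enumeration_def)
        from AE_time_refl[OF this]
        show "AE w in W. uminus ` M (time_refl w) \<inter> {x. s < ereal x \<and> ereal x < t} = {x. \<exists>i. map_option uminus (S i (time_refl w)) = Some x}"
          unfolding enum
        proof eventually_elim
          case (elim w)
          have "s < ereal (-x) \<and> ereal (-x) < t \<longleftrightarrow> -t < ereal x \<and> ereal x < -s" for x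
            unfolding uminus_ereal.simps(1)[symmetric] ereal_less_uminus_reorder[of s] ereal_uminus_less_reorder[of _ t] by blast
          then have "uminus ` M (time_refl w) \<inter> {x. s < ereal x \<and> ereal x < t} = uminus ` (M (time_refl w) \<inter> {x. -t < ereal x \<and> ereal x < -s})"
            by (force simp: image_iff)
          then show ?case unfolding elim .
        qed
      qed
      then show "\<exists>S. measurable_enumeration W (incr_field W s t) (\<lambda>w. uminus ` M (time_refl w) \<inter> {x. s < ereal x \<and> ereal x < t}) S" by blast
    qed
    show "stationary_set W (\<lambda>w. uminus ` M (time_refl w))"
      unfolding stationary_set_def
    proof
      fix u
      have "AE w in W. M w = (\<lambda>x. -u + x) ` M (levy_shift (-u) w)"
        using M unfolding stationary_local_rcs_def stationary_set_def by blast
      from AE_time_refl[OF this]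
      show "AE w in W. uminus ` M (time_refl w) = (\<lambda>x. u + x) ` (uminus ` M (time_refl (levy_shift u w)))"
      proof eventually_elim
        case (elim w)
        have "levy_shift (-u) (time_refl w) = time_refl (levy_shift u w)" by (simp add: levy_shift_time_refl)
        then have e: "M (time_refl w) = (\<lambda>x. -u + x) ` M (time_refl (levy_shift u w))" using elim by simp
        show ?case unfolding e image_image by (rule image_cong) auto
      qed
    qed
  qed
qed

end

theorem theorem5p7:
  fixes W :: "(real \<Rightarrow> real) measure" and l :: real
    and M M' :: "(real \<Rightarrow> real) \<Rightarrow> real set"
    and \<tau> :: "real \<Rightarrow> real \<Rightarrow> (real \<Rightarrow> real) \<Rightarrow> real option"
  assumes "completed_wiener W"
    and "0 < l"
    and "stationary_local_rcs W M"
    and "honest_indexation W M \<tau>"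
    and "stationary_local_rcs W M'"
    and "regular_indexation W \<tau>"
    and "regular_indexation W (dual_indexation \<tau>)"
  shows "(future_pair \<tau> \<in> with_exp W l \<rightarrow>\<^sub>M future_space \<and>
      prob_space.indep_set (with_exp W l) (sets (past_field W l \<tau>))
        (sets (vimage_algebra (space (with_exp W l)) (future_pair \<tau>) future_space)) \<and>
      prob_space.indep_var (with_exp W l)
        (borel \<Otimes>\<^sub>M path_borel UNIV) (past_pair \<tau>) future_space (future_pair \<tau>)) \<and>
    ({(w, e) \<in> space (with_exp W l). at_exp \<tau> (w, e) \<in> M' w} \<in> sets (completion (with_exp W l)) \<and>
      measure (completion (with_exp W l))
        {(w, e) \<in> space (with_exp W l). at_exp \<tau> (w, e) \<in> M' w} \<in> {0, 1}) \<and>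
    (reversed_past_pair (dual_indexation \<tau>) \<in> with_exp W l \<rightarrow>\<^sub>M future_space \<and>
      distr (with_exp W l) future_space (future_pair \<tau>) =
      distr (with_exp W l) future_space (reversed_past_pair (dual_indexation \<tau>)))"
proof -
  obtain P where P: "two_sided_wiener P" "W = completion P" using assms(1) unfolding completed_wiener_def by blast
  interpret wiener_space P using P(1) by (simp only: two_sided_wiener_iff)
  have nested: "nested_indexation \<tau>" by (rule honest_imp_nested[OF assms(4)[unfolded P(2)]])
  \<comment> \<open>\<open>A\<close> is the setting for \<tau> and \<open>B\<close> the one for its
    dual. Reversal at the exponential time turns the future in \<open>A\<close> into the reversed
    past in \<open>B\<close>.\<close>
  interpret A: exp_splitting_time P "\<lambda>t w. the (\<tau> 0 t w)" l
    by (rule exp_splitting_time_of_nested[OF nested assms(6)[unfolded P(2)] assms(2)])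
  interpret B: exp_splitting_time P "\<lambda>t w. the (dual_indexation \<tau> 0 t w)" l
    by (rule exp_splitting_time_of_nested[OF nested_dual[OF nested] assms(7)[unfolded P(2)] assms(2)])
  interpret WE: prob_space "with_exp (completion P) l" by (rule A.prob_space_W_exp)
  let ?We = "with_exp (completion P) l"
  have fp: "future_pair \<tau> = A.future"
    by (rule ext) (simp add: future_pair_def A.future_def at_exp_def case_prod_beta')
  have pp: "past_pair \<tau> = A.stopped_past"
    by (rule ext) (simp add: past_pair_def A.stopped_past_def at_exp_def case_prod_beta')
  have rp: "reversed_past_pair (dual_indexation \<tau>) = B.reversed_past"
    by (rule ext) (simp add: reversed_past_pair_def B.reversed_past_def at_exp_def case_prod_beta')
  let ?D = "\<lambda>Y. A.future -` Y \<inter> space ?We"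
  let ?R = "\<lambda>Y. B.reversed_past -` Y \<inter> space ?We"
  have DW: "?D Y \<in> sets ?We" if "Y \<in> sets future_space" for Y
    by (rule measurable_sets[OF A.measurable_future that])
  have Rp: "?R Y \<in> sets B.past_algebra" if "Y \<in> sets future_space" for Y
    using measurable_sets[OF B.measurable_reversed_past that] by simp
  have RW: "?R Y \<in> sets ?We" if "Y \<in> sets future_space" for Y
    using Rp[OF that] B.sets_past_algebra_subset by blast
  have split: "WE.prob (X \<inter> ?D Y) = WE.prob X * WE.prob (?D Y)" if "X \<in> sets A.past_algebra" "Y \<in> sets future_space" for X Y
    by (rule A.past_algebra_product[OF that(1) A.renewing_future[OF that(2)]])
  have rev_future: "AE w in W. B.reversed_past (reversal x w, x) = A.future (w, x)" if "0 < x" for x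
    using dual_reversal[OF nested that] unfolding P(2)
    by eventually_elim (simp add: B.reversed_past_def A.future_def levy_shift_reversal)

  have pf: "sets (past_field W l \<tau>) \<subseteq> sets A.past_algebra"
  proof -
    let ?G = "{(\<lambda>(w, e). Z (at_exp \<tau> (w, e)) w) -` A \<inter> space ?We | Z A. bounded_left_continuous_adapted (completion P) Z \<and> A \<in> sets borel}"
    have "?G \<subseteq> sets A.past_algebra"
    proof
      fix X assume "X \<in> ?G"
      then obtain Z A where X: "X = (\<lambda>(w, e). Z (at_exp \<tau> (w, e)) w) -` A \<inter> space ?We"
        and Z: "bounded_left_continuous_adapted (completion P) Z" and A: "A \<in> sets borel" by blast
      have "(\<lambda>p. Z (the (\<tau> 0 (snd p) (fst p))) (fst p)) \<in> borel_measurable A.past_algebra"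
        by (rule A.measurable_left_continuous_at_T) (use Z in \<open>auto simp: bounded_left_continuous_adapted_def\<close>)
      from measurable_sets[OF this A] show "X \<in> sets A.past_algebra"
        unfolding X by (simp add: at_exp_def case_prod_beta')
    qed
    moreover have "?G \<subseteq> Pow (space ?We)" by blast
    ultimately show ?thesis
      unfolding past_field_def P(2) using sets.sigma_sets_subset[of ?G A.past_algebra] by (simp add: sets_measure_of)
  qed
  have ind: "WE.indep_set (sets A.past_algebra) {?D Y | Y. Y \<in> sets future_space}"
    by (rule WE.indep_setI) (use A.sets_past_algebra_subset DW split in blast)+

  have part1: "WE.indep_set (sets (past_field W l \<tau>)) (sets (vimage_algebra (space ?We) A.future future_space))"
  proof (rule WE.indep_setI)
    have v: "sets (vimage_algebra (space ?We) A.future future_space) = {?D Y | Y. Y \<in> sets future_space}"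
      by (rule sets_vimage_algebra2) (use measurable_space[OF A.measurable_future] in blast)
    show "sets (past_field W l \<tau>) \<subseteq> WE.events" using pf A.sets_past_algebra_subset by blast
    show "sets (vimage_algebra (space ?We) A.future future_space) \<subseteq> WE.events" unfolding v using DW by blast
    fix a b assume "a \<in> sets (past_field W l \<tau>)" "b \<in> sets (vimage_algebra (space ?We) A.future future_space)"
    then show "WE.prob (a \<inter> b) = WE.prob a * WE.prob b" unfolding v using pf split by blast
  qed
  have stop: "A.stopped_past \<in> ?We \<rightarrow>\<^sub>M borel \<Otimes>\<^sub>M path_borel UNIV"
    by (rule measurable_from_subalg[OF _ A.measurable_stopped_past])
      (simp add: subalgebra_def A.sets_past_algebra_subset)
  have part1': "WE.indep_var (borel \<Otimes>\<^sub>M path_borel UNIV) A.stopped_past future_space A.future"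
    unfolding WE.indep_var_eq
  proof (intro conjI stop A.measurable_future WE.indep_set_sigma_sets WE.indep_setI)
    let ?N = "borel \<Otimes>\<^sub>M path_borel UNIV :: (real \<times> (real \<Rightarrow> real)) measure"
    have sp: "A.stopped_past -` Y \<inter> space ?We \<in> sets A.past_algebra" if "Y \<in> sets ?N" for Y
      using measurable_sets[OF A.measurable_stopped_past that] by simp
    show "{A.stopped_past -` Y \<inter> space ?We | Y. Y \<in> sets ?N} \<subseteq> WE.events" using measurable_sets[OF stop] by blast
    show "{?D Y | Y. Y \<in> sets future_space} \<subseteq> WE.events" using DW by blast
    show "WE.prob (a \<inter> b) = WE.prob a * WE.prob b"
      if "a \<in> {A.stopped_past -` Y \<inter> space ?We | Y. Y \<in> sets ?N}" "b \<in> {?D Y | Y. Y \<in> sets future_space}" for a b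
      using that sp split by blast
    have "Int_stable {f -` Y \<inter> space ?We | Y. Y \<in> sets K}" for f :: "(real \<Rightarrow> real) \<times> real \<Rightarrow> real \<times> (real \<Rightarrow> real)" and K
    proof (rule Int_stableI)
      fix a b assume "a \<in> {f -` Y \<inter> space ?We | Y. Y \<in> sets K}" "b \<in> {f -` Y \<inter> space ?We | Y. Y \<in> sets K}"
      then obtain Y Y' where "a = f -` Y \<inter> space ?We" "b = f -` Y' \<inter> space ?We" "Y \<in> sets K" "Y' \<in> sets K" by blast
      then show "a \<inter> b \<in> {f -` Y \<inter> space ?We | Y. Y \<in> sets K}" by (intro CollectI exI[of _ "Y \<inter> Y'"]) auto
    qed
    then show "Int_stable {A.stopped_past -` Y \<inter> space ?We | Y. Y \<in> sets ?N}" "Int_stable {?D Y | Y. Y \<in> sets future_space}" by blast+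
  qed

  have law: "WE.prob (?D Y) = WE.prob (?R Y)" if Y: "Y \<in> sets future_space" for Y
  proof (rule A.measure_eq_fibre[OF RW[OF Y] DW[OF Y] measurable_reversal emeasure_reversal])
    fix x :: real assume x: "0 < x"
    show "AE w in completion P. (w, x) \<in> ?D Y \<longleftrightarrow> (reversal x w, x) \<in> ?R Y"
      using rev_future[OF x, unfolded P(2)] AE_space[of "completion P"]
      by eventually_elim (use x measurable_space[OF measurable_reversal] in \<open>auto simp: A.space_W_exp\<close>)
  qed
  have rmeas: "B.reversed_past \<in> ?We \<rightarrow>\<^sub>M future_space"
    by (rule measurable_from_subalg[OF _ B.measurable_reversed_past])
      (simp add: subalgebra_def B.sets_past_algebra_subset)
  have part3: "distr ?We future_space A.future = distr ?We future_space B.reversed_past"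
  proof (rule measure_eqI)
    fix Y assume "Y \<in> sets (distr ?We future_space A.future)"
    then have Y: "Y \<in> sets future_space" by simp
    show "emeasure (distr ?We future_space A.future) Y = emeasure (distr ?We future_space B.reversed_past) Y"
      using law[OF Y] by (simp only: emeasure_distr[OF A.measurable_future Y] emeasure_distr[OF rmeas Y] WE.emeasure_eq_measure)
  qed simp

  obtain S where S: "measurable_enumeration (completion P) (completion P) M' S"
    using assms(5) unfolding P(2) stationary_local_rcs_def random_countable_set_def by blast
  have M': "stationary_local_rcs (completion P) M'" using assms(5) unfolding P(2) .
  let ?S = "\<lambda>i w. map_option uminus (S i (time_refl w))"
  have rC: "A.renewing (A.mark S)" by (rule A.renewing_mark[OF M' S])
  have rC': "B.renewing (B.mark ?S)"
    by (rule B.renewing_mark[OF stationary_local_rcs_dual(1)[OF M'] stationary_local_rcs_dual(2)[OF M' S]])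
  have C: "A.mark S \<in> sets ?We" using rC by (simp add: A.renewing_def)
  have C': "B.mark ?S \<in> sets ?We" using rC' by (simp add: B.renewing_def)
  have rev_mark: "AE w in completion P. (w, x) \<in> A.mark S \<longleftrightarrow> (reversal x w, x) \<in> B.mark ?S" if x: "0 < x" for x
  proof -
    have MS: "AE w in completion P. M' w = {y. \<exists>i. S i w = Some y}" using S by (simp add: measurable_enumeration_def)
    have "AE w in completion P. M' w = (\<lambda>y. x + y) ` M' (levy_shift x w)"
      using M' unfolding stationary_local_rcs_def stationary_set_def by blast
    then show ?thesis using MS AE_levy_shift[OF MS, of x] dual_reversal[OF nested x] AE_space[of "completion P"]
    proof eventually_elim
      case (elim w)
      let ?y = "the (\<tau> 0 x w)"
      have "(\<exists>i. S i w = Some ?y) \<longleftrightarrow> ?y \<in> M' w" unfolding elim(2) by blast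
      also have "\<dots> \<longleftrightarrow> ?y - x \<in> M' (levy_shift x w)" unfolding elim(1) by force
      also have "\<dots> \<longleftrightarrow> (\<exists>i. S i (levy_shift x w) = Some (?y - x))" unfolding elim(3) by blast
      also have "\<dots> \<longleftrightarrow> (\<exists>i. map_option uminus (S i (levy_shift x w)) = Some (x - ?y))"
        by (intro ex_cong1) (auto simp: map_option_case split: option.split)
      finally show ?case
        using x elim(5) measurable_space[OF measurable_reversal, of w x] elim(4)
        by (simp add: A.mark_def B.mark_def A.space_W_exp time_refl_reversal)
    qed
  qed
  have Ceq: "WE.prob (A.mark S) = WE.prob (B.mark ?S)"
    by (rule A.measure_eq_fibre[OF C' C measurable_reversal emeasure_reversal rev_mark])
  \<comment> \<open>Reversal turns the mark into the mark of the reflected set, which is renewing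
    for \<open>B\<close>, and the future into an event of the past algebra of \<open>B\<close>. Thus
    independence of past and future for the dual gives independence of mark and future for
    \<tau>.\<close>
  have CD: "WE.prob (A.mark S \<inter> ?D Y) = WE.prob (?D Y) * WE.prob (A.mark S)" if Y: "Y \<in> sets future_space" for Y
  proof -
    have "WE.prob (A.mark S \<inter> ?D Y) = WE.prob (B.mark ?S \<inter> ?R Y)"
    proof (rule A.measure_eq_fibre[OF sets.Int[OF C' RW[OF Y]] sets.Int[OF C DW[OF Y]] measurable_reversal emeasure_reversal])
      fix x :: real assume x: "0 < x"
      show "AE w in completion P. (w, x) \<in> A.mark S \<inter> ?D Y \<longleftrightarrow> (reversal x w, x) \<in> B.mark ?S \<inter> ?R Y"
        using rev_future[OF x, unfolded P(2)] rev_mark[OF x] AE_space[of "completion P"]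
        by eventually_elim (use x measurable_space[OF measurable_reversal] in \<open>auto simp: A.space_W_exp\<close>)
    qed
    also have "\<dots> = WE.prob (?R Y \<inter> B.mark ?S)" by (simp only: Int_commute)
    also have "\<dots> = WE.prob (?R Y) * WE.prob (B.mark ?S)" by (rule B.past_algebra_product[OF Rp[OF Y] rC'])
    finally show ?thesis unfolding law[OF Y] Ceq .
  qed
  have triv: "WE.prob (A.mark S) \<in> {0, 1}"
  proof (rule A.trivial_if_independent_of_past_and_future[OF C])
    fix X Y assume X: "X \<in> sets A.past_algebra" and Y: "Y \<in> sets future_space"
    \<comment> \<open>Mark and future form one renewing event, which is independent of the past;
      \<open>CD\<close> then separates mark and future.\<close>
    show "WE.prob (X \<inter> (A.mark S \<inter> ?D Y)) = WE.prob X * WE.prob (?D Y) * WE.prob (A.mark S)"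
      unfolding A.past_algebra_product[OF X A.renewing_Int[OF rC A.renewing_future[OF Y]]] CD[OF Y] by simp
  qed

  let ?E = "{(w, e) \<in> space ?We. at_exp \<tau> (w, e) \<in> M' w}"
  have E: "?E = {(w, x) \<in> space ?We. the (\<tau> 0 x w) \<in> M' w}" by (simp add: at_exp_def)
  have ae: "AE p in ?We. p \<in> A.mark S \<longleftrightarrow> p \<in> ?E" unfolding E by (rule A.AE_mark[OF S])
  \<comment> \<open>The event stated with \<open>M'\<close> itself differs from the mark by a null
    set and is therefore measurable in the completion.\<close>
  have ae': "AE p in completion ?We. p \<in> A.mark S \<longleftrightarrow> p \<in> ?E" by (rule AE_completion[OF ae])
  have Es: "?E \<in> sets (completion ?We)"
    by (rule completion.in_sets_AE[OF ae' sets_completionI_sets[OF C]]) auto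
  have "emeasure (completion ?We) (A.mark S) = emeasure (completion ?We) ?E"
    by (rule emeasure_eq_AE[OF ae' sets_completionI_sets[OF C] Es])
  then have "measure (completion ?We) ?E = WE.prob (A.mark S)"
    using C by (simp add: measure_def)
  then have part2: "?E \<in> sets (completion ?We) \<and> measure (completion ?We) ?E \<in> {0, 1}"
    using Es triv by simp

  show ?thesis
    unfolding fp pp rp P(2)
    using A.measurable_future part1[unfolded P(2)] part1' part2 rmeas part3 by blast
qed

end
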